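(* Let $\Sigma$ be a marked surface with a fixed global coefficient, and consider its dotted Ptolemy groupoid. (1) For any dot rotation $A_v=[\dot\triangle_1,\dot\triangle_2]$ with common underlying triangulation $\triangle$, one has $\mathrm{Ad}(\mathsf A_v)\circ\iota_{\dot\triangle_2}=\iota_{\dot\triangle_1}$ as maps $\mathcal X^{\triangle}_{\mathbf y^\triangle}\to\mathcal W_{\dot\triangle_1}$. (2) For any flip $T_{vw}=[\dot\triangle_1,\dot\triangle_2]$ with underlying flip $\mu_\kappa:\triangle_1\to\triangle_2$, one has $\mathrm{Ad}(\mathsf T_{vw})\circ\iota_{\dot\triangle_2}=\iota_{\dot\triangle_1}\circ\mu_\kappa^\ast$ as maps $\mathcal X^{\triangle_2}_{\mathbf y^{\triangle_2}}\to\mathcal W_{\dot\triangle_1}$.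
   Context: Roots of unity. $N$ is a positive odd integer, $q=-e^{\pi i/N}$ ($q^N=1$), $\mathbb Z_N=\mathbb Z/N$, $\gamma(k)=q^{k^2}$, $i^x=e^{\pi ix/2}$. Fermat curve and dilogarithm. $\mathcal F_N=\{(p^+,p^-)\in(\mathbb C^\ast)^2:(p^+)^N+(p^-)^N=1\}$, $\overline{\mathcal F}_N=\mathcal F_N\cup\{(0,1)\}$. $\Psi_{\mathbf p}(X)=\prod_{j=0}^{N-1}(p^-+q^{2j+1}p^+X)^{j/N}$, defined by a convergent power series on $|yX|<1$ ($y=p^+/p^-$) and continued analytically to $\mathbb C\setminus\bigcup_k\{|yX|>1,\arg(yX)=\pi(2k+1)/N\}$, with branches obtained by continuation from $\mathbf p=(0,1)$, so that $\Psi_{\mathbf p}(q^{2k})=\Psi_{\mathbf p}(1)\prod_{j=1}^k(p^-+q^{2j-1}p^+)$. Parameters are generic so that all $q^{2k}$ lie in the domain. For $\mathsf X^N=1$, $\Psi_{\mathbf p}(\mathsf X)$ acts on $q^{2k}$-eigenvectors of $\mathsf X$ by $\Psi_{\mathbf p}(q^{2k})$. Weyl ordering: for $X_iX_j=q^{2\epsilon_{ij}}X_jX_i$, $[X_1\cdots X_n]=q^{-\sum_{i<j}\epsilon_{ij}}X_1\cdots X_n$. Surfaces. A marked surface is a compact oriented surface $\Sigma$ with a finite nonempty set $\mathbb M$ of marked points, each boundary component containing one, with $-2\chi(\Sigma\setminus\mathbb M)+|\mathbb M\cap\partial\Sigma|>0$. Ideal triangulations $\triangle$ have vertex set $\mathbb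 M$; $e(\triangle),e_{\rm int}(\triangle),t(\triangle)$ are edges, interior edges, triangles. $\pi_\triangle(\alpha)$ is the encircling edge if $\alpha$ is the interior edge of a self-folded triangle, and $\alpha$ otherwise. $\varepsilon^\triangle_{\alpha\beta}=\sum_T\varepsilon_{\alpha\beta}(T)$ over non-self-folded $T$, where $\varepsilon_{\alpha\beta}(T)=1$ (resp. $-1$) if $\pi_\triangle(\alpha),\pi_\triangle(\beta)$ are sides of $T$ with $\pi_\triangle(\beta)$ obtained from $\pi_\triangle(\alpha)$ by rotating clockwise (resp. counterclockwise) about their common corner in $T$, else $0$. A dotted triangulation $\dot\triangle$ is an ideal triangulation with a chosen corner (dot) in each triangle. Dot rotation $A_v=[\dot\triangle_1,\dot\triangle_2]$: the dot of $v$ moves to the next corner counterclockwise. Flip $T_{vw}=[\dot\triangle_1,\dot\triangle_2]$: in a square with corners $a,b,c,d$ counterclockwise, in $\dot\triangle_1$ $v=abd$ (dot at $a$), $w=bcd$ (dot at $b$); in $\dot\triangle_2$ $v=acd$ (dot at $a$), $w=abc$ (dot at $b$); $\kappa=bd$. Global coefficient. $\mathcal F_\triangle=\prod_{\alpha\in e_{\rm int}(\triangle)}\mathcal F_N\times\prod_{\alpha\notin e_{\rm int}(\triangle)}\overline{\mathcal F}_N$. A global coefficient is a collection $\mathbf p^\triangle\in\mathcal F_\triangle$ for all $\triangle$ such that for each flip $\mu_\kappa:\triangle\to\triangle'$: $p'^\pm_\kappa=p^\mp_\kappa$ and for $\alpha\neq\kappa$, $p'^+_\alpha/p'^-_\alpha=(p^+_\alpha/p^-_\alpha)(p_\kappa^+)^{\varepsilon_{\alpha\kappa}}$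 if $\varepsilon_{\alpha\kappa}\ge0$, $(p^+_\alpha/p^-_\alpha)(p_\kappa^-)^{\varepsilon_{\alpha\kappa}}$ if $\varepsilon_{\alpha\kappa}<0$. Put $y_\alpha^\triangle=p_\alpha^{\triangle,+}/p_\alpha^{\triangle,-}$. Chekhov–Fock algebra. $\mathcal X^\triangle_{\mathbf y^\triangle}$ is generated by $X_\alpha^{\pm1}$, $\alpha\in e(\triangle)$, with $X_\alpha X_\beta=q^{2\varepsilon_{\alpha\beta}}X_\beta X_\alpha$ and $X_\alpha^N=y_\alpha^N$; $\overline X_\alpha=y_\alpha^{-1}X_\alpha$. The quantum cluster Poisson transformation $\mu_\kappa^\ast:\mathcal X^{\triangle'}_{\mathbf y^{\triangle'}}\to\mathcal X^{\triangle}_{\mathbf y^{\triangle}}$ is the isomorphism induced by $X'_\kappa\mapsto X_\kappa^{-1}$, $X'_\alpha\mapsto X_\alpha\prod_{j=1}^{|\varepsilon_{\alpha\kappa}|}(1+q^{2j-1}X_\kappa^{-\mathrm{sgn}(\varepsilon_{\alpha\kappa})})^{-\varepsilon_{\alpha\kappa}/|\varepsilon_{\alpha\kappa}|}$ for $\alpha\ne\kappa$ (no product if $\varepsilon_{\alpha\kappa}=0$). Representation. $V_N$ has basis $|k\rangle$, $k\in\mathbb Z_N$, $\mathsf U|k\rangle=q^{2k}|k\rangle$, $\mathsf P|k\rangle=|k+1\rangle$; $V_{\dot\triangle}=\bigotimes_{v\in t(\triangle)}V_N$. $\mathcal W_{\dot\triangle}$ is the $q$-Weyl algebra generated by $U_v,P_v$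 ($U_vP_v=q^2P_vU_v$, different $v$ commute, $U_v^N=P_v^N=1$), acting on $V_{\dot\triangle}$ factorwise. $\mathsf A_v:V_{\dot\triangle_2}\to V_{\dot\triangle_1}$ acts on the $v$-th factor by $|k\rangle\mapsto\zeta_A\sum_m\gamma(m)^{-1}q^{-2km}|m\rangle$, $\zeta_A=N^{-1/2}i^{(1-N)/6}$; $\mathsf T_{vw}=\Psi_{\mathbf p_\kappa^{\triangle_1}}([\mathsf P_v^{-1}\mathsf U_v\mathsf P_w])\mathsf S_{vw}:V_{\dot\triangle_2}\to V_{\dot\triangle_1}$, $\mathsf S_{vw}=\frac1N\sum_{i,j}q^{2ij}\mathsf U_w^i\mathsf P_v^j$. $\mathrm{Ad}(\mathsf O)(x)=\mathsf Ox\mathsf O^{-1}$. Embedding $\iota_{\dot\triangle}$. In each triangle $v$, starting from the dotted corner and going counterclockwise along the boundary, assign to the three sides (more precisely to the half-edges of the dual graph crossing them) the Weyl weights $U_v^{-1}$, $[U_vP_v^{-1}]$, $P_v$. For a non-self-folded edge $\alpha$, $\iota_{\dot\triangle}(\overline X_\alpha)$ is the product of the weights at $\alpha$ from its adjacent triangles (only one if $\alpha$ is a boundary edge). For a self-folded edge $\alpha$, $\iota_{\dot\triangle}(\overline X_\alpha)$ is the Weyl-ordered product of the factors so associated with $\alpha$ and with $\pi_\triangle(\alpha)$.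
   Formalization: For a boundary edge with p_α=(0,1), where y_α=0 makes X_α^N=y_α^N and y_α^{-1}X_α meaningless, the generator is the normalised one with N-th power 1, and its image under μ_κ^* carries the factor (p_κ^±)^{-ε_{ακ}}; all other cases are literal. *)

theory Defs
  imports
    "HOL-Complex_Analysis.Complex_Analysis"
    "HOL-Homology.Homology"
    "HOL-Algebra.QuotRing"
    "HOL-Library.Poly_Mapping"
    "HOL-Library.Numeral_Type"
    "Berlekamp_Zassenhaus.Finite_Field"
begin

section \<open>Roots of unity and the Fermat curve\<close>

definition qroot :: "nat \<Rightarrow> complex" where
  "qroot N = - cis (pi / real N)"

definition gauss :: "nat \<Rightarrow> int \<Rightarrow> complex" where
  "gauss N k = qroot N powi (k\<^sup>2)"

text \<open>A point \<open>(p\<^sup>+, p\<^sup>-)\<close> is a pair; \<open>p\<^sup>+\<close> is its first and \<open>p\<^sup>-\<close> its second component.\<close>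

definition fermat :: "nat \<Rightarrow> (complex \<times> complex) set" where
  "fermat N = {(a, b). a \<noteq> 0 \<and> b \<noteq> 0 \<and> a ^ N + b ^ N = 1}"

definition fermat_bar :: "nat \<Rightarrow> (complex \<times> complex) set" where
  "fermat_bar N = fermat N \<union> {(0, 1)}"

definition yratio :: "complex \<times> complex \<Rightarrow> complex" where
  "yratio p = fst p / snd p"


section \<open>The cyclic quantum dilogarithm\<close>

definition dilog_domain :: "nat \<Rightarrow> complex \<times> complex \<Rightarrow> complex set" where
  "dilog_domain N p =
     - (\<Union>k::int. {X. \<exists>r>1. yratio p * X = rcis r (pi * (2 * of_int k + 1) / real N)})"

definition dilog_generic :: "nat \<Rightarrow> complex \<times> complex \<Rightarrow> bool" where
  "dilog_generic N p \<longleftrightarrow> (\<forall>k::int. qroot N powi (2 * k) \<in> dilog_domain N p)"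

text \<open>
  \<open>dilog_branch N p \<Psi>\<close>: on the \<open>N\<close>-th roots of unity, \<open>\<Psi>\<close> is the product over \<open>j < N\<close> of
  \<open>(p\<^sup>- + q\<^bsup>2j+1\<^esup> p\<^sup>+ X)\<^bsup>j/N\<^esup>\<close>, continued analytically from \<open>p = (0,1)\<close> (where it is
  \<open>1\<close>) along some path in the completed Fermat curve.  Here \<open>L j\<close> is the continuous
  logarithm of the \<open>j\<close>-th factor along the path; no factor vanishes on the curve, because for
  \<open>X\<^sup>N = 1\<close> their product is \<open>(p\<^sup>-)\<^sup>N + (p\<^sup>+)\<^sup>N = 1\<close>.
  The path has to be the same for all \<open>X\<close>: this is what makes
  \<open>\<Psi>(q\<^bsup>2k\<^esup>) = \<Psi>(1) (p\<^sup>- + q p\<^sup>+) \<cdots> (p\<^sup>- + q\<^bsup>2k-1\<^esup> p\<^sup>+)\<close> hold for every choice of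
  the \<open>N\<close>-th root \<open>p\<^sup>-\<close>.  On the sheet \<open>p\<^sup>- = (1 + y\<^sup>N)\<^bsup>-1/N\<^esup>\<close> (principal branch), the path
  \<open>t \<mapsto> t y\<close> gives \<open>(p\<^sup>-)\<^bsup>(N-1)/2\<^esup>\<close> times the principal powers
  \<open>(1 + q\<^bsup>2j+1\<^esup> y X)\<^bsup>j/N\<^esup>\<close>, i.e. the power series on \<open>\<bar>yX\<bar> < 1\<close> and its continuation to
  \<open>dilog_domain\<close>.
\<close>

definition dilog_branch :: "nat \<Rightarrow> complex \<times> complex \<Rightarrow> (complex \<Rightarrow> complex) \<Rightarrow> bool" where
  "dilog_branch N p \<Psi> \<longleftrightarrow>
     (\<exists>g :: real \<Rightarrow> complex \<times> complex.
        path g \<and> path_image g \<subseteq> fermat_bar N \<and> pathstart g = (0, 1) \<and> pathfinish g = p \<and>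
        (\<forall>X. X ^ N = 1 \<longrightarrow>
           (\<exists>L :: nat \<Rightarrow> real \<Rightarrow> complex.
              (\<forall>j<N. continuous_on {0..1} (L j) \<and> L j 0 = 0 \<and>
                 (\<forall>t\<in>{0..1}. exp (L j t) = snd (g t) + qroot N ^ (2 * j + 1) * fst (g t) * X)) \<and>
              \<Psi> X = (\<Prod>j<N. exp (of_nat j / of_nat N * L j 1)))))"


section \<open>Marked surfaces\<close>

text \<open>Topological orientation-preservation of an injective continuous planar map: small
  counterclockwise circles are mapped to loops of winding number one.\<close>

definition orientation_preserving_on :: "complex set \<Rightarrow> (complex \<Rightarrow> complex) \<Rightarrow> bool" where
  "orientation_preserving_on D h \<longleftrightarrow>
     (\<forall>z r. 0 < r \<and> cball z r \<subseteq> D \<longrightarrow> winding_number (h \<circ> circlepath z r) (h z) = 1)"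

record 's surface_data =
  surf :: "'s topology"
  atlas :: "('s set \<times> ('s \<Rightarrow> complex)) set"
  marked :: "'s set"

definition upper_half_plane :: "complex set" where
  "upper_half_plane = {z. Im z \<ge> 0}"

definition surface_chart :: "'s topology \<Rightarrow> 's set \<times> ('s \<Rightarrow> complex) \<Rightarrow> bool" where
  "surface_chart X = (\<lambda>(U, \<phi>).
     openin X U \<and> openin (top_of_set upper_half_plane) (\<phi> ` U) \<and>
     homeomorphic_map (subtopology X U) (top_of_set (\<phi> ` U)) \<phi>)"

definition oriented_atlas :: "'s topology \<Rightarrow> ('s set \<times> ('s \<Rightarrow> complex)) set \<Rightarrow> bool" where
  "oriented_atlas X \<A> \<longleftrightarrow>
     (\<forall>c\<in>\<A>. surface_chart X c) \<and> topspace X = (\<Union>c\<in>\<A>. fst c) \<and>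
     (\<forall>(U, \<phi>)\<in>\<A>. \<forall>(V, \<psi>)\<in>\<A>.
        orientation_preserving_on (\<phi> ` (U \<inter> V)) (\<psi> \<circ> inv_into U \<phi>))"

definition surface_boundary :: "'s surface_data \<Rightarrow> 's set" where
  "surface_boundary S = {x. \<exists>(U, \<phi>)\<in>atlas S. x \<in> U \<and> Im (\<phi> x) = 0}"

text \<open>Homology groups are written multiplicatively; the rank is the maximal number of
  elements that are linearly independent over the integers.\<close>

definition int_independent :: "('a, 'b) monoid_scheme \<Rightarrow> 'a set \<Rightarrow> bool" where
  "int_independent G B \<longleftrightarrow> finite B \<and> B \<subseteq> carrier G \<and>
     (\<forall>c :: 'a \<Rightarrow> int. finprod G (\<lambda>b. b [^]\<^bsub>G\<^esub> c b) B = \<one>\<^bsub>G\<^esub> \<longrightarrow> (\<forall>b\<in>B. c b = 0))"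

definition abelian_rank :: "('a, 'b) monoid_scheme \<Rightarrow> nat" where
  "abelian_rank G = Sup (card ` {B. int_independent G B})"

text \<open>Only degrees \<open>\<le> 2\<close> contribute for a surface.\<close>

definition euler_char :: "'s topology \<Rightarrow> int" where
  "euler_char X = (\<Sum>p\<le>2::nat. (- 1) ^ p * int (abelian_rank (homology_group (int p) X)))"

definition marked_surface :: "'s surface_data \<Rightarrow> bool" where
  "marked_surface S \<longleftrightarrow>
     compact_space (surf S) \<and> Hausdorff_space (surf S) \<and> oriented_atlas (surf S) (atlas S) \<and>
     finite (marked S) \<and> marked S \<noteq> {} \<and> marked S \<subseteq> topspace (surf S) \<and>
     (\<forall>C \<in> connected_components_of (subtopology (surf S) (surface_boundary S)).
        C \<inter> marked S \<noteq> {}) \<and>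
     - 2 * euler_char (subtopology (surf S) (topspace (surf S) - marked S))
       + int (card (marked S \<inter> surface_boundary S)) > 0"


section \<open>Dotted ideal triangulations\<close>

text \<open>The corners of \<open>polygon n\<close> are numbered counterclockwise, with index modulo \<open>n\<close>;
  the \<open>k\<close>-th side joins corners \<open>k\<close> and \<open>k + 1\<close>.\<close>

definition corner :: "nat \<Rightarrow> nat \<Rightarrow> complex" where
  "corner n k = cis (2 * pi * real k / real n)"

definition polygon :: "nat \<Rightarrow> complex set" where
  "polygon n = convex hull (range (corner n))"

definition open_side :: "nat \<Rightarrow> nat \<Rightarrow> complex set" where
  "open_side n k = open_segment (corner n k) (corner n (Suc k))"

text \<open>An oriented immersed polygon with corners at marked points, embedded except that sides
  may be glued to each other.\<close>

definition polygon_map :: "'s surface_data \<Rightarrow> nat \<Rightarrow> (complex \<Rightarrow> 's) \<Rightarrow> bool" where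
  "polygon_map S n f \<longleftrightarrow>
     continuous_map (top_of_set (polygon n)) (surf S) f \<and>
     f ` range (corner n) \<subseteq> marked S \<and>
     f ` (polygon n - range (corner n)) \<inter> marked S = {} \<and>
     inj_on f (interior (polygon n)) \<and> (\<forall>k. inj_on f (open_side n k)) \<and>
     (\<forall>(U, \<phi>)\<in>atlas S.
        orientation_preserving_on (interior (polygon n) \<inter> f -` U) (\<phi> \<circ> f))"

text \<open>
  Triangles are labelled by a finite type \<open>'v\<close>.  \<open>tri_face \<tau> v\<close> is the open triangle \<open>v\<close>, and
  \<open>tri_side \<tau> v 0\<close>, \<open>tri_side \<tau> v 1\<close>, \<open>tri_side \<tau> v 2\<close> are its three sides (open arcs) listed
  counterclockwise starting from the dotted corner.  The dot is recoverable from this list: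
  the three sides of a triangle never all coincide.
\<close>

record ('v, 's) dotted =
  tri_face :: "'v \<Rightarrow> 's set"
  tri_side :: "'v \<Rightarrow> 3 \<Rightarrow> 's set"

definition edges :: "('v, 's) dotted \<Rightarrow> 's set set" where
  "edges \<tau> = {tri_side \<tau> v k | v k. True}"

definition slots :: "('v, 's) dotted \<Rightarrow> 's set \<Rightarrow> ('v \<times> 3) set" where
  "slots \<tau> \<alpha> = {(v, k). tri_side \<tau> v k = \<alpha>}"

definition interior_edge :: "'s surface_data \<Rightarrow> 's set \<Rightarrow> bool" where
  "interior_edge S \<alpha> \<longleftrightarrow> \<not> \<alpha> \<subseteq> surface_boundary S"

definition dotted_triangulation :: "'s surface_data \<Rightarrow> ('v::finite, 's) dotted \<Rightarrow> bool" where
  "dotted_triangulation S \<tau> \<longleftrightarrow>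
     (\<exists>f. \<forall>v. polygon_map S 3 (f v) \<and> tri_face \<tau> v = f v ` interior (polygon 3) \<and>
        (\<forall>k. tri_side \<tau> v (of_nat k) = f v ` open_side 3 k)) \<and>
     (\<forall>v w. v \<noteq> w \<longrightarrow> tri_face \<tau> v \<inter> tri_face \<tau> w = {}) \<and>
     (\<forall>\<alpha>\<in>edges \<tau>. \<forall>\<beta>\<in>edges \<tau>. \<alpha> \<noteq> \<beta> \<longrightarrow> \<alpha> \<inter> \<beta> = {}) \<and>
     (\<forall>v. \<forall>\<alpha>\<in>edges \<tau>. tri_face \<tau> v \<inter> \<alpha> = {}) \<and>
     topspace (surf S) = marked S \<union> (\<Union>v. tri_face \<tau> v) \<union> \<Union>(edges \<tau>) \<and>
     (\<forall>\<alpha>\<in>edges \<tau>. card (slots \<tau> \<alpha>) = (if interior_edge S \<alpha> then 2 else 1))"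

definition folded_at :: "('v, 's) dotted \<Rightarrow> 'v \<Rightarrow> 3 \<Rightarrow> bool" where
  "folded_at \<tau> v k \<longleftrightarrow> tri_side \<tau> v k = tri_side \<tau> v (k + 1)"

definition self_folded :: "('v, 's) dotted \<Rightarrow> 'v \<Rightarrow> bool" where
  "self_folded \<tau> v \<longleftrightarrow> (\<exists>k. folded_at \<tau> v k)"

definition encircle :: "('v, 's) dotted \<Rightarrow> 's set \<Rightarrow> 's set" where
  "encircle \<tau> \<alpha> =
     (if \<exists>v k. folded_at \<tau> v k \<and> tri_side \<tau> v k = \<alpha>
      then (THE \<beta>. \<exists>v k. folded_at \<tau> v k \<and> tri_side \<tau> v k = \<alpha> \<and> \<beta> = tri_side \<tau> v (k + 2))
      else \<alpha>)"

text \<open>Sides are listed counterclockwise along the boundary, so rotating side \<open>k\<close> clockwise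
  about the corner it shares with side \<open>k + 1\<close> yields side \<open>k + 1\<close>.\<close>

definition eps_tri :: "('v, 's) dotted \<Rightarrow> 'v \<Rightarrow> 's set \<Rightarrow> 's set \<Rightarrow> int" where
  "eps_tri \<tau> v \<alpha> \<beta> =
     (if \<exists>k. encircle \<tau> \<alpha> = tri_side \<tau> v k \<and> encircle \<tau> \<beta> = tri_side \<tau> v (k + 1) then 1
      else if \<exists>k. encircle \<tau> \<beta> = tri_side \<tau> v k \<and> encircle \<tau> \<alpha> = tri_side \<tau> v (k + 1) then - 1
      else 0)"

definition eps :: "('v::finite, 's) dotted \<Rightarrow> 's set \<Rightarrow> 's set \<Rightarrow> int" where
  "eps \<tau> \<alpha> \<beta> = (\<Sum>v | \<not> self_folded \<tau> v. eps_tri \<tau> v \<alpha> \<beta>)"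

definition dot_rotation ::
  "'s surface_data \<Rightarrow> 'v::finite \<Rightarrow> ('v, 's) dotted \<Rightarrow> ('v, 's) dotted \<Rightarrow> bool" where
  "dot_rotation S v \<tau>1 \<tau>2 \<longleftrightarrow>
     dotted_triangulation S \<tau>1 \<and> dotted_triangulation S \<tau>2 \<and>
     tri_face \<tau>2 = tri_face \<tau>1 \<and>
     (\<forall>u k. tri_side \<tau>2 u k = tri_side \<tau>1 u (if u = v then k + 1 else k))"

text \<open>\<open>dotted_flip S v w \<kappa> \<kappa>' \<tau>1 \<tau>2\<close> replaces the diagonal \<open>\<kappa> = bd\<close> by \<open>\<kappa>' = ac\<close> of an immersed
  square; its corners \<open>a, b, c, d\<close> are \<open>corner 4 0, \<dots>, corner 4 3\<close>.\<close>

definition dotted_flip ::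
  "'s surface_data \<Rightarrow> 'v::finite \<Rightarrow> 'v \<Rightarrow> 's set \<Rightarrow> 's set \<Rightarrow>
     ('v, 's) dotted \<Rightarrow> ('v, 's) dotted \<Rightarrow> bool" where
  "dotted_flip S v w \<kappa> \<kappa>' \<tau>1 \<tau>2 \<longleftrightarrow>
     dotted_triangulation S \<tau>1 \<and> dotted_triangulation S \<tau>2 \<and> v \<noteq> w \<and>
     (\<forall>u. u \<noteq> v \<and> u \<noteq> w \<longrightarrow>
        tri_face \<tau>2 u = tri_face \<tau>1 u \<and> tri_side \<tau>2 u = tri_side \<tau>1 u) \<and>
     (\<exists>g. polygon_map S 4 g \<and>
        (let a = corner 4 0; b = corner 4 1; c = corner 4 2; d = corner 4 3;
             tri = (\<lambda>x y z. g ` interior (convex hull {x, y, z}));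
             arc = (\<lambda>x y. g ` open_segment x y);
             sides = (\<lambda>\<tau> u. (tri_side \<tau> u 0, tri_side \<tau> u 1, tri_side \<tau> u 2))
         in \<kappa> = arc b d \<and> \<kappa>' = arc a c \<and>
            tri_face \<tau>1 v = tri a b d \<and> sides \<tau>1 v = (arc a b, arc b d, arc d a) \<and>
            tri_face \<tau>1 w = tri b c d \<and> sides \<tau>1 w = (arc b c, arc c d, arc d b) \<and>
            tri_face \<tau>2 v = tri a c d \<and> sides \<tau>2 v = (arc a c, arc c d, arc d a) \<and>
            tri_face \<tau>2 w = tri a b c \<and> sides \<tau>2 w = (arc b c, arc c a, arc a b)))"


section \<open>Global coefficients\<close>

text \<open>An undotted triangulation is given by its set of edges.  All triangulations of a surface
  have the same number of triangles, which is \<open>CARD('v)\<close>.\<close>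

type_synonym 's coeff = "'s set set \<Rightarrow> 's set \<Rightarrow> complex \<times> complex"

definition global_coefficient ::
  "'v::finite itself \<Rightarrow> nat \<Rightarrow> 's surface_data \<Rightarrow> 's coeff \<Rightarrow> bool" where
  "global_coefficient _ N S p \<longleftrightarrow>
     (\<forall>\<tau> :: ('v, 's) dotted. dotted_triangulation S \<tau> \<longrightarrow>
        (\<forall>\<alpha>\<in>edges \<tau>. p (edges \<tau>) \<alpha> \<in> (if interior_edge S \<alpha> then fermat N else fermat_bar N))) \<and>
     (\<forall>(\<tau>1 :: ('v, 's) dotted) \<tau>2 v w \<kappa> \<kappa>'. dotted_flip S v w \<kappa> \<kappa>' \<tau>1 \<tau>2 \<longrightarrow>
        p (edges \<tau>2) \<kappa>' = prod.swap (p (edges \<tau>1) \<kappa>) \<and>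
        (\<forall>\<alpha> \<in> edges \<tau>1 - {\<kappa>}.
           yratio (p (edges \<tau>2) \<alpha>) =
             yratio (p (edges \<tau>1) \<alpha>) *
               (if eps \<tau>1 \<alpha> \<kappa> \<ge> 0 then fst (p (edges \<tau>1) \<kappa>) else snd (p (edges \<tau>1) \<kappa>))
                 powi eps \<tau>1 \<alpha> \<kappa>))"

abbreviation ycoord :: "'s coeff \<Rightarrow> ('v, 's) dotted \<Rightarrow> 's set \<Rightarrow> complex" where
  "ycoord p \<tau> \<alpha> \<equiv> yratio (p (edges \<tau>) \<alpha>)"

text \<open>
  The coordinate \<open>y\<^sub>\<alpha>\<close> vanishes exactly when \<open>p\<^sub>\<alpha> = (0,1)\<close>, which can only happen on a boundary
  edge.  Then \<open>X\<^sub>\<alpha>\<^sup>N = y\<^sub>\<alpha>\<^sup>N\<close> would be incompatible with the invertibility of \<open>X\<^sub>\<alpha>\<close>, and the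
  generator attached to \<open>\<alpha>\<close> is taken to be the normalised one, with \<open>N\<close>-th power \<open>1\<close>.
\<close>

definition gen_scale :: "'s coeff \<Rightarrow> ('v, 's) dotted \<Rightarrow> 's set \<Rightarrow> complex" where
  "gen_scale p \<tau> \<alpha> = (if ycoord p \<tau> \<alpha> = 0 then 1 else ycoord p \<tau> \<alpha>)"


section \<open>Algebras given by invertible generators and relations\<close>

datatype 'e letter = Gen 'e | Gen_inv 'e

datatype 'l free_word = Word (letters: "'l list")

instantiation free_word :: (type) monoid_add
begin

definition zero_free_word :: "'a free_word" where
  "zero_free_word = Word []"

definition plus_free_word :: "'a free_word \<Rightarrow> 'a free_word \<Rightarrow> 'a free_word" where
  "plus_free_word u v = Word (letters u @ letters v)"

instance
  by standard (auto simp: zero_free_word_def plus_free_word_def)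

end

text \<open>Addition of words is concatenation, so the product of finitely supported functions on
  words is the product of noncommutative polynomials.\<close>

type_synonym 'e free_alg = "'e letter free_word \<Rightarrow>\<^sub>0 complex"

definition free_const :: "complex \<Rightarrow> 'e free_alg" where
  "free_const c = Poly_Mapping.single 0 c"

definition free_var :: "'e letter \<Rightarrow> 'e free_alg" where
  "free_var l = Poly_Mapping.single (Word [l]) 1"

definition free_algebra :: "'e set \<Rightarrow> 'e free_alg ring" where
  "free_algebra E =
     \<lparr>carrier = {f. \<forall>u \<in> Poly_Mapping.keys f. set (letters u) \<subseteq> Gen ` E \<union> Gen_inv ` E},
      mult = (*), one = 1, zero = 0, add = (+)\<rparr>"

text \<open>The value of a noncommutative polynomial in a ring \<open>R\<close> with scalars \<open>s :: complex \<Rightarrow> _\<close>,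
  and the induced map on cosets of an ideal on which that value is zero.\<close>

definition letter_value :: "('a, 'b) ring_scheme \<Rightarrow> ('e \<Rightarrow> 'a) \<Rightarrow> 'e letter \<Rightarrow> 'a" where
  "letter_value R g l = (case l of Gen e \<Rightarrow> g e | Gen_inv e \<Rightarrow> inv\<^bsub>R\<^esub> (g e))"

definition free_eval ::
  "('a, 'b) ring_scheme \<Rightarrow> (complex \<Rightarrow> 'a) \<Rightarrow> ('e \<Rightarrow> 'a) \<Rightarrow> 'e free_alg \<Rightarrow> 'a" where
  "free_eval R s g f =
     (\<Oplus>\<^bsub>R\<^esub>u \<in> Poly_Mapping.keys f.
        s (Poly_Mapping.lookup f u) \<otimes>\<^bsub>R\<^esub>
          foldr (\<lambda>l x. letter_value R g l \<otimes>\<^bsub>R\<^esub> x) (letters u) \<one>\<^bsub>R\<^esub>)"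

definition induced_hom ::
  "('a, 'b) ring_scheme \<Rightarrow> (complex \<Rightarrow> 'a) \<Rightarrow> ('e \<Rightarrow> 'a) \<Rightarrow> 'e free_alg set \<Rightarrow> 'a" where
  "induced_hom R s g x = the_elem (free_eval R s g ` x)"


section \<open>Chekhov--Fock algebras and cluster Poisson transformations\<close>

definition CF_relations ::
  "nat \<Rightarrow> 's coeff \<Rightarrow> ('v::finite, 's) dotted \<Rightarrow> 's set free_alg set" where
  "CF_relations N p \<tau> =
     {free_var (Gen \<alpha>) * free_var (Gen_inv \<alpha>) - 1 | \<alpha>. \<alpha> \<in> edges \<tau>} \<union>
     {free_var (Gen_inv \<alpha>) * free_var (Gen \<alpha>) - 1 | \<alpha>. \<alpha> \<in> edges \<tau>} \<union>
     {free_var (Gen \<alpha>) * free_var (Gen \<beta>)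
        - free_const (qroot N powi (2 * eps \<tau> \<alpha> \<beta>)) * (free_var (Gen \<beta>) * free_var (Gen \<alpha>))
        | \<alpha> \<beta>. \<alpha> \<in> edges \<tau> \<and> \<beta> \<in> edges \<tau>} \<union>
     {free_var (Gen \<alpha>) ^ N - free_const (gen_scale p \<tau> \<alpha> ^ N) | \<alpha>. \<alpha> \<in> edges \<tau>}"

definition CF_ideal ::
  "nat \<Rightarrow> 's coeff \<Rightarrow> ('v::finite, 's) dotted \<Rightarrow> 's set free_alg set" where
  "CF_ideal N p \<tau> = Idl\<^bsub>free_algebra (edges \<tau>)\<^esub> (CF_relations N p \<tau>)"

definition CF ::
  "nat \<Rightarrow> 's coeff \<Rightarrow> ('v::finite, 's) dotted \<Rightarrow> 's set free_alg set ring" where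
  "CF N p \<tau> = free_algebra (edges \<tau>) Quot CF_ideal N p \<tau>"

definition CF_class ::
  "nat \<Rightarrow> 's coeff \<Rightarrow> ('v::finite, 's) dotted \<Rightarrow> 's set free_alg \<Rightarrow> 's set free_alg set" where
  "CF_class N p \<tau> f = CF_ideal N p \<tau> +>\<^bsub>free_algebra (edges \<tau>)\<^esub> f"

abbreviation CF_gen ::
  "nat \<Rightarrow> 's coeff \<Rightarrow> ('v::finite, 's) dotted \<Rightarrow> 's set \<Rightarrow> 's set free_alg set" where
  "CF_gen N p \<tau> \<alpha> \<equiv> CF_class N p \<tau> (free_var (Gen \<alpha>))"

abbreviation CF_scalar ::
  "nat \<Rightarrow> 's coeff \<Rightarrow> ('v::finite, 's) dotted \<Rightarrow> complex \<Rightarrow> 's set free_alg set" where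
  "CF_scalar N p \<tau> c \<equiv> CF_class N p \<tau> (free_const c)"

text \<open>
  \<open>mu_gen\<close> is the image of the generator \<open>X'\<^sub>\<alpha>\<close>.  Its leading scalar differs from \<open>1\<close> only for a
  boundary edge with \<open>y\<^sub>\<alpha> = 0\<close>, where it is the factor \<open>y\<^sub>\<alpha> / y'\<^sub>\<alpha> = (p\<^sub>\<kappa>\<^sup>\<plusminus>)\<^bsup>-\<epsilon>\<^esup>\<close> by which the
  transformation of the normalised generators differs from that of the \<open>X\<^sub>\<alpha>\<close>.
\<close>

definition mu_gen ::
  "nat \<Rightarrow> 's coeff \<Rightarrow> ('v::finite, 's) dotted \<Rightarrow> 's set \<Rightarrow> 's set \<Rightarrow> 's set \<Rightarrow>
     's set free_alg set" where
  "mu_gen N p \<tau>1 \<kappa> \<kappa>' \<alpha> =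
     (let R = CF N p \<tau>1; X = CF_gen N p \<tau>1; e = eps \<tau>1 \<alpha> \<kappa>; pk = p (edges \<tau>1) \<kappa>
      in if \<alpha> = \<kappa>' then inv\<^bsub>R\<^esub> X \<kappa>
         else CF_scalar N p \<tau>1
                (if ycoord p \<tau>1 \<alpha> = 0 then (if e \<ge> 0 then fst pk else snd pk) powi (- e) else 1)
              \<otimes>\<^bsub>R\<^esub> X \<alpha>
              \<otimes>\<^bsub>R\<^esub> foldr
                (\<lambda>j x. (\<one>\<^bsub>R\<^esub> \<oplus>\<^bsub>R\<^esub> CF_scalar N p \<tau>1 (qroot N ^ (2 * j - 1)) \<otimes>\<^bsub>R\<^esub> (X \<kappa> [^]\<^bsub>R\<^esub> (- sgn e)))
                          [^]\<^bsub>R\<^esub> (- sgn e) \<otimes>\<^bsub>R\<^esub> x)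
                [1..<Suc (nat \<bar>e\<bar>)] \<one>\<^bsub>R\<^esub>)"

text \<open>The quantum cluster Poisson transformation from \<open>CF N p \<tau>2\<close> to \<open>CF N p \<tau>1\<close>, for a flip
  from \<open>\<tau>1\<close> to \<open>\<tau>2\<close> replacing \<open>\<kappa>\<close> by \<open>\<kappa>'\<close>.\<close>

definition mu_star ::
  "nat \<Rightarrow> 's coeff \<Rightarrow> ('v::finite, 's) dotted \<Rightarrow> 's set \<Rightarrow> 's set \<Rightarrow>
     's set free_alg set \<Rightarrow> 's set free_alg set" where
  "mu_star N p \<tau>1 \<kappa> \<kappa>' = induced_hom (CF N p \<tau>1) (CF_scalar N p \<tau>1) (mu_gen N p \<tau>1 \<kappa> \<kappa>')"


section \<open>Operators on the tensor product of the spaces attached to triangles\<close>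

text \<open>
  The index set \<open>\<int>/N\<close> is \<open>'n mod_ring\<close> with \<open>N = CARD('n)\<close>; the tensor product over all triangles has
  the basis indexed by \<open>'v \<Rightarrow> 'n mod_ring\<close>.  Entry \<open>M $ m $ k\<close> is the coefficient of \<open>|m\<rangle>\<close> in
  \<open>M |k\<rangle>\<close>.  The \<open>q\<close>-Weyl algebra acts faithfully on this space, its Weyl monomials being a basis
  of the matrix algebra; it is identified with its image.
\<close>

type_synonym 'n local_operator = "complex ^ 'n mod_ring ^ 'n mod_ring"
type_synonym ('v, 'n) operator = "complex ^ ('v \<Rightarrow> 'n mod_ring) ^ ('v \<Rightarrow> 'n mod_ring)"

definition operators :: "(complex ^ 'b ^ 'b) ring" where
  "operators = \<lparr>carrier = UNIV, mult = (**), one = mat 1, zero = 0, add = (+)\<rparr>"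

definition conj_by :: "complex ^ 'b ^ 'b \<Rightarrow> complex ^ 'b ^ 'b \<Rightarrow> complex ^ 'b ^ 'b" where
  "conj_by Q x = Q ** x ** inv\<^bsub>operators\<^esub> Q"

definition act_on :: "'v::finite \<Rightarrow> 'n::finite local_operator \<Rightarrow> ('v, 'n) operator" where
  "act_on v M = (\<chi> m k. if \<forall>u. u \<noteq> v \<longrightarrow> m u = k u then M $ m v $ k v else 0)"

definition U1 :: "'n::finite local_operator" where
  "U1 = (\<chi> m k. if m = k then qroot CARD('n) powi (2 * to_int_mod_ring k) else 0)"

definition P1 :: "'n::finite local_operator" where
  "P1 = (\<chi> m k. if m = k + of_int_mod_ring 1 then 1 else 0)"

definition A1 :: "'n::finite local_operator" where
  "A1 = (\<chi> m k. of_real (real CARD('n) powr (- 1 / 2)) * cis (pi / 2 * ((1 - real CARD('n)) / 6)) *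
           inverse (gauss CARD('n) (to_int_mod_ring m)) *
           qroot CARD('n) powi (- 2 * to_int_mod_ring k * to_int_mod_ring m))"

abbreviation U_op :: "'v::finite \<Rightarrow> ('v, 'n::finite) operator" where
  "U_op v \<equiv> act_on v U1"

abbreviation P_op :: "'v::finite \<Rightarrow> ('v, 'n::finite) operator" where
  "P_op v \<equiv> act_on v P1"

abbreviation A_op :: "'v::finite \<Rightarrow> ('v, 'n::finite) operator" where
  "A_op v \<equiv> act_on v A1"

text \<open>The exponent \<open>\<epsilon>\<close> with \<open>X Y = q\<^bsup>2\<epsilon>\<^esup> Y X\<close> is determined modulo \<open>N\<close>, so \<open>q\<^sup>\<epsilon>\<close> is well defined.\<close>

definition comm_exp :: "nat \<Rightarrow> complex ^ 'b ^ 'b \<Rightarrow> complex ^ 'b ^ 'b \<Rightarrow> int" where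
  "comm_exp N X Y = (SOME e. X ** Y = mat (qroot N powi (2 * e)) ** (Y ** X))"

definition weyl_prod :: "nat \<Rightarrow> (complex ^ 'b ^ 'b) list \<Rightarrow> complex ^ 'b ^ 'b" where
  "weyl_prod N xs =
     mat (qroot N powi (- (\<Sum>j<length xs. \<Sum>i<j. comm_exp N (xs ! i) (xs ! j))))
       ** foldr (**) xs (mat 1)"

definition corner_weight :: "'v::finite \<Rightarrow> 3 \<Rightarrow> ('v, 'n::finite) operator" where
  "corner_weight v k =
     (if k = 0 then inv\<^bsub>operators\<^esub> (U_op v)
      else if k = 1 then weyl_prod CARD('n) [U_op v, inv\<^bsub>operators\<^esub> (P_op v)]
      else P_op v)"

text \<open>For an edge that is not the interior edge of a self-folded triangle, \<open>encircle \<tau> \<alpha> = \<alpha>\<close> and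
  the slots at \<open>\<alpha>\<close> lie in distinct triangles, so that their weights commute and the Weyl-ordered
  product is the product.\<close>

definition iota_bar :: "('v::finite, 's) dotted \<Rightarrow> 's set \<Rightarrow> ('v, 'n::finite) operator" where
  "iota_bar \<tau> \<alpha> =
     weyl_prod CARD('n)
       (map (\<lambda>(v, k). corner_weight v k)
          (SOME xs. distinct xs \<and> set xs = slots \<tau> \<alpha> \<union> slots \<tau> (encircle \<tau> \<alpha>)))"

text \<open>The generator \<open>X\<^sub>\<alpha>\<close> is \<open>gen_scale p \<tau> \<alpha>\<close> times its normalisation, and \<open>iota_bar\<close> is the value on
  the latter.\<close>

definition iota ::
  "'s coeff \<Rightarrow> ('v::finite, 's) dotted \<Rightarrow> 's set free_alg set \<Rightarrow> ('v, 'n::finite) operator" where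
  "iota p \<tau> = induced_hom operators mat (\<lambda>\<alpha>. mat (gen_scale p \<tau> \<alpha>) ** iota_bar \<tau> \<alpha>)"

definition S_op :: "'v::finite \<Rightarrow> 'v \<Rightarrow> ('v, 'n::finite) operator" where
  "S_op v w =
     mat (1 / of_nat CARD('n)) **
       (\<Sum>i<CARD('n). \<Sum>j<CARD('n).
          mat (qroot CARD('n) ^ (2 * i * j)) **
            (U_op w [^]\<^bsub>operators\<^esub> i ** P_op v [^]\<^bsub>operators\<^esub> j))"

definition spectral_apply ::
  "nat \<Rightarrow> (complex \<Rightarrow> complex) \<Rightarrow> complex ^ 'b ^ 'b \<Rightarrow> complex ^ 'b ^ 'b" where
  "spectral_apply N \<Psi> X =
     (THE F. \<forall>(k::int) x. X *v x = qroot N powi (2 * k) *s x \<longrightarrow>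
                           F *v x = \<Psi> (qroot N powi (2 * k)) *s x)"

definition T_op :: "(complex \<Rightarrow> complex) \<Rightarrow> 'v::finite \<Rightarrow> 'v \<Rightarrow> ('v, 'n::finite) operator" where
  "T_op \<Psi> v w =
     spectral_apply CARD('n) \<Psi>
       (weyl_prod CARD('n) [inv\<^bsub>operators\<^esub> (P_op v), U_op v, P_op w]) ** S_op v w"

end

theory Submission
  imports Defs
begin

text \<open>
  Every monomial in the operators \<open>U\<close>, \<open>P\<close> is, up to a scalar, a Weyl-ordered monomial \<open>W(x)\<close> with
  an exponent vector \<open>x\<close>, and \<open>W(x) W(y) = q\<^bsup>\<omega>(x,y)\<^esup> W(x + y)\<close> for a symplectic form \<open>\<omega>\<close>.  So
  \<open>\<iota>\<close> sends the normalised generator of \<open>\<alpha>\<close> to \<open>W(E(\<alpha>))\<close>; since the three weights of a triangle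
  have exponents with sum zero, \<open>\<omega>(E(\<alpha>), E(\<beta>)) = \<epsilon>\<^sub>\<alpha>\<^sub>\<beta>\<close>, also next to self-folded triangles.
  Conjugation by \<open>A\<^sub>v\<close> and by \<open>S\<^sub>v\<^sub>w\<close> acts on the exponents by symplectic maps.  The first rotates
  the weights of \<open>v\<close>, which is part (1).  The second sends \<open>E\<^sub>2(\<kappa>')\<close> to \<open>- E\<^sub>1(\<kappa>)\<close> and \<open>E\<^sub>2(\<alpha>)\<close> to
  \<open>E\<^sub>1(\<alpha>) + max 0 \<epsilon>\<^sub>\<alpha>\<^sub>\<kappa> E\<^sub>1(\<kappa>)\<close>, the monomial part of the cluster transformation.

  The other part is conjugation by \<open>\<Psi>(Y)\<close> with \<open>Y\<close> the normalised \<open>X\<^sub>\<kappa>\<close>: because the logarithms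
  that define \<open>\<Psi>\<close> are continuous along the path from \<open>(0, 1)\<close>, they are permuted by \<open>X \<mapsto> q\<^sup>2 X\<close>
  and add up to zero, hence \<open>\<Psi>(q\<^sup>2 X) = (p\<^sup>- + q p\<^sup>+ X) \<Psi>(X)\<close> at \<open>X\<^sup>N = 1\<close>, and moving
  \<open>\<Psi>(Y)\<close> past \<open>X\<^sub>\<alpha>\<close> produces the product in \<open>\<mu>\<^sub>\<kappa>\<^sup>*\<close>.  This computation takes place on the
  spectral idempotents of \<open>Y\<close> in the Chekhov--Fock algebra itself: \<open>\<iota>\<close> need not be injective, so
  that \<open>\<mu>\<^sub>\<kappa>\<^sup>*\<close> respects the defining relations cannot be read off in the representation.
\<close>

text \<open>Induced maps are defined through \<open>the_elem\<close> of the image of a coset, so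
  \<open>iota\<close> and \<open>mu_star\<close> mean nothing until the images of the generators are
  known to satisfy the relations. Checking this for \<open>mu_gen\<close> directly would involve
  products of noncommuting binomials. Instead \<open>mu_gen\<close> is written as the conjugate, by
  an invertible F representing \<Psi>(Y), of a monomial family t X_\<alpha> Y^c with c = max 0
  \<epsilon>. For monomials the relations are bookkeeping of exponents, and conjugation carries them
  over. The scalar t has two sources. One is the ratio of the new to the old y-coordinate, a power
  of p^+ or p^-. The other is q^(-c^2), from the sum of the first c odd numbers, which appears when
  the binomials in the inverse of X_\<kappa> are cleared of denominators; it cancels the factor from
  bringing X_\<alpha> Y^c into Weyl order. For negative \<epsilon> the binomials are polynomial in Y
  and no monomial is left over, hence the \<open>max\<close>. The abstract algebra comes without
  eigenvectors, so equalities in it are tested by multiplying from the right with the Fourier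
  projections of Y.\<close>

no_notation fps_nth (infixl "$" 75)

section \<open>Free algebras\<close>

text \<open>A complex algebra in carrier style: \<open>s\<close> maps the complex numbers into the
  centre. The quotient \<open>CF\<close> with the classes of constants and \<open>operators\<close>
  with \<open>mat\<close> are both instances, so the functional calculus is developed once and
  transported along homomorphisms.\<close>

locale scalar_ring = ring R for R (structure) +
  fixes s :: "complex \<Rightarrow> 'a"
  assumes s_closed [simp, intro]: "s c \<in> carrier R"
    and s_add: "s (c + d) = s c \<oplus> s d"
    and s_mult: "s (c * d) = s c \<otimes> s d"
    and s_one: "s 1 = \<one>"
    and s_comm: "x \<in> carrier R \<Longrightarrow> x \<otimes> s c = s c \<otimes> x"
begin

lemma s_zero: "s 0 = \<zero>"
proof -
  have "s 0 \<oplus> s 0 = s 0 \<oplus> \<zero>"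
    using s_add[of 0 0] by simp
  then show ?thesis
    by (simp add: add.l_cancel_one)
qed

lemma s_sum: "finite A \<Longrightarrow> s (sum f A) = (\<Oplus>i\<in>A. s (f i))"
  by (induction A rule: finite_induct) (auto simp: s_zero s_add Pi_def)

lemma s_prod_lcomm: "x \<in> carrier R \<Longrightarrow> y \<in> carrier R \<Longrightarrow> x \<otimes> (s c \<otimes> y) = s c \<otimes> (x \<otimes> y)"
  by (metis m_assoc s_closed s_comm)

lemma s_mult_mult:
  "x \<in> carrier R \<Longrightarrow> y \<in> carrier R \<Longrightarrow> (s c \<otimes> s d) \<otimes> (x \<otimes> y) = (s c \<otimes> x) \<otimes> (s d \<otimes> y)"
  by (metis m_assoc m_closed s_closed s_comm)

lemma s_s: "x \<in> carrier R \<Longrightarrow> s c \<otimes> (s d \<otimes> x) = s (c * d) \<otimes> x"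
  by (metis m_assoc s_closed s_mult)

lemma s_Units: "c \<noteq> 0 \<Longrightarrow> s c \<in> Units R"
  unfolding Units_def
  by (auto intro!: bexI[of _ "s (inverse c)"] simp: s_one simp flip: s_mult)

definition word_value :: "('e \<Rightarrow> 'a) \<Rightarrow> 'e letter list \<Rightarrow> 'a" where
  "word_value g ls = foldr (\<lambda>l x. letter_value R g l \<otimes> x) ls \<one>"

lemma free_eval_eq:
  "free_eval R s g f =
     (\<Oplus>u \<in> Poly_Mapping.keys f. s (Poly_Mapping.lookup f u) \<otimes> word_value g (letters u))"
  by (simp add: free_eval_def word_value_def)

end

definition letters_over :: "'e set \<Rightarrow> 'e letter set" where
  "letters_over E = Gen ` E \<union> Gen_inv ` E"

lemma carrier_free_algebra:
  "f \<in> carrier (free_algebra E) \<longleftrightarrow>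
     (\<forall>u \<in> Poly_Mapping.keys f. set (letters u) \<subseteq> letters_over E)"
  by (simp add: free_algebra_def letters_over_def)

lemma free_algebra_simps [simp]:
  "mult (free_algebra E) = (*)" "one (free_algebra E) = 1"
  "zero (free_algebra E) = 0" "add (free_algebra E) = (+)"
  by (simp_all add: free_algebra_def)

lemma letters_plus [simp]: "letters (u + w) = letters u @ letters w"
  by (simp add: plus_free_word_def)

lemma letters_zero [simp]: "letters 0 = []"
  by (simp add: zero_free_word_def)

lemma free_algebra_closed:
  shows free_zero_closed: "0 \<in> carrier (free_algebra E)"
    and free_one_closed: "1 \<in> carrier (free_algebra E)"
    and free_add_closed: "f \<in> carrier (free_algebra E) \<Longrightarrow> h \<in> carrier (free_algebra E) \<Longrightarrow>
           f + h \<in> carrier (free_algebra E)"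
    and free_mult_closed: "f \<in> carrier (free_algebra E) \<Longrightarrow> h \<in> carrier (free_algebra E) \<Longrightarrow>
           f * h \<in> carrier (free_algebra E)"
    and free_uminus_closed: "f \<in> carrier (free_algebra E) \<Longrightarrow> - f \<in> carrier (free_algebra E)"
    and free_diff_closed: "f \<in> carrier (free_algebra E) \<Longrightarrow> h \<in> carrier (free_algebra E) \<Longrightarrow>
           f - h \<in> carrier (free_algebra E)"
proof -
  show uminus: "- f \<in> carrier (free_algebra E)" if "f \<in> carrier (free_algebra E)" for f
    using that unfolding carrier_free_algebra by (auto simp: in_keys_iff)
  show add: "f + h \<in> carrier (free_algebra E)"
    if "f \<in> carrier (free_algebra E)" "h \<in> carrier (free_algebra E)" for f h
    using that keys_add[of f h] unfolding carrier_free_algebra by blast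
  show "f - h \<in> carrier (free_algebra E)"
    if "f \<in> carrier (free_algebra E)" "h \<in> carrier (free_algebra E)" for f h
    using add[OF that(1) uminus[OF that(2)]] by simp
  show "f * h \<in> carrier (free_algebra E)"
    if "f \<in> carrier (free_algebra E)" "h \<in> carrier (free_algebra E)"
    using that keys_mult[of f h] unfolding carrier_free_algebra by fastforce
qed (auto simp: carrier_free_algebra)

lemma ring_free_algebra: "ring (free_algebra E)"
proof (rule ringI)
  show "abelian_group (free_algebra E)"
  proof (rule abelian_groupI)
    fix x assume "x \<in> carrier (free_algebra E)"
    then show "\<exists>y\<in>carrier (free_algebra E). y \<oplus>\<^bsub>free_algebra E\<^esub> x = \<zero>\<^bsub>free_algebra E\<^esub>"
      using free_uminus_closed[of x E] by (auto intro!: bexI[of _ "- x"])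
  qed (auto intro: free_algebra_closed simp: algebra_simps)
  show "monoid (free_algebra E)"
    by (rule monoidI) (auto intro: free_algebra_closed simp: algebra_simps)
qed (auto simp: algebra_simps)

lemma free_single_closed:
  "set (letters u) \<subseteq> letters_over E \<Longrightarrow> Poly_Mapping.single u c \<in> carrier (free_algebra E)"
  by (auto simp: carrier_free_algebra)

lemma free_const_closed: "free_const c \<in> carrier (free_algebra E)"
  by (simp add: free_const_def free_single_closed)

lemma free_var_closed: "l \<in> letters_over E \<Longrightarrow> free_var l \<in> carrier (free_algebra E)"
  by (simp add: free_var_def free_single_closed)

lemma free_Gen_closed: "e \<in> E \<Longrightarrow> free_var (Gen e) \<in> carrier (free_algebra E)"
  and free_Gen_inv_closed: "e \<in> E \<Longrightarrow> free_var (Gen_inv e) \<in> carrier (free_algebra E)"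
  by (simp_all add: free_var_closed letters_over_def)

lemma poly_mapping_sum_single:
  "(\<Sum>u\<in>Poly_Mapping.keys f. Poly_Mapping.single u (Poly_Mapping.lookup f u)) = f"
  by (rule poly_mapping_eqI)
    (auto simp: lookup_sum lookup_single when_def in_keys_iff sum.If_cases)

text \<open>A constant sits on the empty word, which is neutral for concatenation on both
  sides.\<close>

lemma free_const_comm: "f * free_const c = free_const c * (f :: 'e free_alg)"
proof -
  have "Poly_Mapping.single u d * free_const c = free_const c * Poly_Mapping.single u d"
    for u :: "'e letter free_word" and d
    by (simp add: free_const_def mult_single mult.commute)
  then show ?thesis
    by (subst (1 2) poly_mapping_sum_single[of f, symmetric])
      (simp add: sum_distrib_left sum_distrib_right)
qed

context scalar_ring
begin

lemma letter_value_closed: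
  assumes "\<And>e. e \<in> E \<Longrightarrow> g e \<in> Units R" "l \<in> letters_over E"
  shows "letter_value R g l \<in> carrier R"
  using assms(1)[THEN Units_closed] assms(1)[THEN Units_inv_closed] assms(2)
  by (auto simp: letter_value_def letters_over_def)

lemma word_value_closed:
  assumes "\<And>e. e \<in> E \<Longrightarrow> g e \<in> Units R" "set ls \<subseteq> letters_over E"
  shows "word_value g ls \<in> carrier R"
  using assms(2) unfolding word_value_def
  by (induction ls) (auto intro: letter_value_closed[of E g] assms(1))

lemma word_value_append:
  assumes "\<And>e. e \<in> E \<Longrightarrow> g e \<in> Units R" "set ls \<subseteq> letters_over E" "set ls' \<subseteq> letters_over E"
  shows "word_value g (ls @ ls') = word_value g ls \<otimes> word_value g ls'"
  using assms(2)
proof (induction ls)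
  case Nil
  then show ?case
    using word_value_closed[of E g ls'] assms(1,3) by (simp add: word_value_def)
next
  case (Cons l ls)
  then have *: "set ls \<subseteq> letters_over E" "l \<in> letters_over E"
    by auto
  have "word_value g (l # ls @ ls') = letter_value R g l \<otimes> word_value g (ls @ ls')"
    "word_value g (l # ls) = letter_value R g l \<otimes> word_value g ls"
    by (simp_all add: word_value_def)
  then show ?case
    using Cons.IH[OF *(1)] letter_value_closed[of E g l] * assms
      word_value_closed[of E g ls] word_value_closed[of E g ls']
    by (simp add: m_assoc)
qed

context
  fixes E :: "'e set" and g :: "'e \<Rightarrow> 'a"
  assumes g: "\<And>e. e \<in> E \<Longrightarrow> g e \<in> Units R"
begin

lemma gen_closed: "e \<in> E \<Longrightarrow> g e \<in> carrier R"
  by (rule Units_closed[OF g])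

lemma word_closed: "set ls \<subseteq> letters_over E \<Longrightarrow> word_value g ls \<in> carrier R"
  by (rule word_value_closed) (use g in auto)

lemma word_append:
  "set ls \<subseteq> letters_over E \<Longrightarrow> set ls' \<subseteq> letters_over E \<Longrightarrow>
     word_value g (ls @ ls') = word_value g ls \<otimes> word_value g ls'"
  by (rule word_value_append) (use g in auto)

text \<open>The support of a sum can be smaller than the union of the supports. Evaluating over a
  common larger set of words removes this difficulty, because absent words enter with
  \<open>s 0\<close>.\<close>

lemma free_eval_superset:
  assumes "finite A" "Poly_Mapping.keys f \<subseteq> A" "\<And>u. u \<in> A \<Longrightarrow> set (letters u) \<subseteq> letters_over E"
  shows "free_eval R s g f = (\<Oplus>u\<in>A. s (Poly_Mapping.lookup f u) \<otimes> word_value g (letters u))"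
  unfolding free_eval_eq
proof (rule add.finprod_mono_neutral_cong_left)
  show "s (Poly_Mapping.lookup f u) \<otimes> word_value g (letters u) = \<zero>"
    if "u \<in> A - Poly_Mapping.keys f" for u
    using that word_closed[OF assms(3), of u] s_zero by (auto simp: in_keys_iff)
  show "(\<lambda>u. s (Poly_Mapping.lookup f u) \<otimes> word_value g (letters u)) \<in> A \<rightarrow> carrier R"
    using word_closed[OF assms(3)] by auto
qed (use assms in auto)

lemma free_eval_closed:
  assumes "f \<in> carrier (free_algebra E)"
  shows "free_eval R s g f \<in> carrier R"
  using assms unfolding free_eval_eq carrier_free_algebra
  by (intro finsum_closed) (auto intro!: word_closed)

lemma free_eval_single:
  assumes "set (letters u) \<subseteq> letters_over E"
  shows "free_eval R s g (Poly_Mapping.single u c) = s c \<otimes> word_value g (letters u)"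
proof -
  have "free_eval R s g (Poly_Mapping.single u c) =
      (\<Oplus>w\<in>{u}. s (Poly_Mapping.lookup (Poly_Mapping.single u c) w) \<otimes> word_value g (letters w))"
    using assms by (intro free_eval_superset) auto
  also have "\<dots> = s c \<otimes> word_value g (letters u)"
    using word_closed[OF assms] by (simp add: Pi_def)
  finally show ?thesis .
qed

lemma free_eval_add:
  assumes "f \<in> carrier (free_algebra E)" "h \<in> carrier (free_algebra E)"
  shows "free_eval R s g (f + h) = free_eval R s g f \<oplus> free_eval R s g h"
proof -
  let ?A = "Poly_Mapping.keys f \<union> Poly_Mapping.keys h"
  have A: "set (letters u) \<subseteq> letters_over E" if "u \<in> ?A" for u
    using assms that unfolding carrier_free_algebra by blast
  have cl: "word_value g (letters u) \<in> carrier R" if "u \<in> ?A" for u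
    using word_closed[OF A[OF that]] .
  have "free_eval R s g (f + h) =
      (\<Oplus>u\<in>?A. s (Poly_Mapping.lookup (f + h) u) \<otimes> word_value g (letters u))"
    using A keys_add[of f h] by (intro free_eval_superset) auto
  also have "\<dots> = (\<Oplus>u\<in>?A. s (Poly_Mapping.lookup f u) \<otimes> word_value g (letters u) \<oplus>
                         s (Poly_Mapping.lookup h u) \<otimes> word_value g (letters u))"
    using cl by (intro finsum_cong') (auto simp: lookup_add s_add l_distr)
  also have "\<dots> = free_eval R s g f \<oplus> free_eval R s g h"
    using cl A free_eval_superset[of ?A f] free_eval_superset[of ?A h]
    by (subst finsum_addf) auto
  finally show ?thesis .
qed

lemma free_eval_sum:
  assumes "finite I" "\<And>i. i \<in> I \<Longrightarrow> h i \<in> carrier (free_algebra E)"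
  shows "(\<Sum>i\<in>I. h i) \<in> carrier (free_algebra E) \<and>
         free_eval R s g (\<Sum>i\<in>I. h i) = (\<Oplus>i\<in>I. free_eval R s g (h i))"
  using assms
proof (induction I rule: finite_induct)
  case empty
  then show ?case
    by (simp add: free_zero_closed free_eval_eq)
next
  case (insert i I)
  then show ?case
    using free_eval_add[of "h i" "\<Sum>i\<in>I. h i"] free_eval_closed
    by (auto simp: finsum_insert free_add_closed Pi_def)
qed

text \<open>Both factors are expanded into single words before evaluating. Different pairs of words
  may concatenate to the same word, so this is easier than describing the coefficients of the
  product.\<close>

lemma free_eval_mult:
  assumes "f \<in> carrier (free_algebra E)" "h \<in> carrier (free_algebra E)"
  shows "free_eval R s g (f * h) = free_eval R s g f \<otimes> free_eval R s g h"
proof -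
  let ?m = "\<lambda>f u. Poly_Mapping.single u (Poly_Mapping.lookup f u)"
  let ?e = "\<lambda>f u. s (Poly_Mapping.lookup f u) \<otimes> word_value g (letters u)"
  let ?F = "Poly_Mapping.keys f" and ?H = "Poly_Mapping.keys h"
  have F: "set (letters u) \<subseteq> letters_over E" if "u \<in> ?F" for u
    using assms that unfolding carrier_free_algebra by blast
  have H: "set (letters u) \<subseteq> letters_over E" if "u \<in> ?H" for u
    using assms that unfolding carrier_free_algebra by blast
  note cl = word_closed[OF F] word_closed[OF H]
  have "f * h = (\<Sum>u\<in>?F. \<Sum>w\<in>?H. ?m f u * ?m h w)"
    by (subst (1 2) poly_mapping_sum_single[symmetric]) (simp add: sum_product)
  also have "free_eval R s g \<dots> = (\<Oplus>u\<in>?F. \<Oplus>w\<in>?H. ?e f u \<otimes> ?e h w)"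
  proof -
    have single: "free_eval R s g (?m f u * ?m h w) = ?e f u \<otimes> ?e h w"
      if "u \<in> ?F" "w \<in> ?H" for u w
    proof -
      have "free_eval R s g (?m f u * ?m h w) =
          s (Poly_Mapping.lookup f u * Poly_Mapping.lookup h w) \<otimes> word_value g (letters (u + w))"
        unfolding mult_single using F[OF that(1)] H[OF that(2)]
        by (intro free_eval_single) simp
      also have "\<dots> = (s (Poly_Mapping.lookup f u) \<otimes> s (Poly_Mapping.lookup h w)) \<otimes>
          (word_value g (letters u) \<otimes> word_value g (letters w))"
        using F[OF that(1)] H[OF that(2)] by (simp add: word_append s_mult)
      also have "\<dots> = ?e f u \<otimes> ?e h w"
        using cl(1)[OF that(1)] cl(2)[OF that(2)] by (rule s_mult_mult)
      finally show ?thesis .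
    qed
    have carr: "?m f u * ?m h w \<in> carrier (free_algebra E)" if "u \<in> ?F" "w \<in> ?H" for u w
      using F[OF that(1)] H[OF that(2)] by (intro free_mult_closed free_single_closed)
    have inner: "(\<Sum>w\<in>?H. ?m f u * ?m h w) \<in> carrier (free_algebra E) \<and>
        free_eval R s g (\<Sum>w\<in>?H. ?m f u * ?m h w) = (\<Oplus>w\<in>?H. ?e f u \<otimes> ?e h w)"
      if u: "u \<in> ?F" for u
    proof -
      have "(\<Oplus>w\<in>?H. free_eval R s g (?m f u * ?m h w)) = (\<Oplus>w\<in>?H. ?e f u \<otimes> ?e h w)"
        using single[OF u] cl(1)[OF u] cl(2) by (intro finsum_cong') auto
      then show ?thesis
        using free_eval_sum[of ?H "\<lambda>w. ?m f u * ?m h w"] carr[OF u] by simp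
    qed
    have "(\<Oplus>u\<in>?F. free_eval R s g (\<Sum>w\<in>?H. ?m f u * ?m h w)) =
        (\<Oplus>u\<in>?F. \<Oplus>w\<in>?H. ?e f u \<otimes> ?e h w)"
      using inner cl by (intro finsum_cong') (auto intro!: finsum_closed)
    then show ?thesis
      using free_eval_sum[of ?F "\<lambda>u. \<Sum>w\<in>?H. ?m f u * ?m h w"] inner by simp
  qed
  also have "\<dots> = (\<Oplus>u\<in>?F. ?e f u \<otimes> (\<Oplus>w\<in>?H. ?e h w))"
    using cl by (intro finsum_cong') (auto intro!: finsum_closed simp: finsum_rdistr Pi_def)
  also have "\<dots> = (\<Oplus>u\<in>?F. ?e f u) \<otimes> (\<Oplus>w\<in>?H. ?e h w)"
    using cl by (intro finsum_ldistr[symmetric]) (auto intro!: finsum_closed)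
  finally show ?thesis
    by (simp add: free_eval_eq)
qed

lemma free_eval_const: "free_eval R s g (free_const c) = s c"
  using free_eval_single[of 0 c] by (simp add: free_const_def word_value_def)

lemma free_eval_one: "free_eval R s g 1 = \<one>"
  using free_eval_const[of 1] by (simp add: free_const_def s_one)

lemma free_eval_Gen: "e \<in> E \<Longrightarrow> free_eval R s g (free_var (Gen e)) = g e"
  using free_eval_single[of "Word [Gen e]" 1] gen_closed[of e]
  by (simp add: free_var_def word_value_def letters_over_def letter_value_def s_one)

lemma free_eval_Gen_inv: "e \<in> E \<Longrightarrow> free_eval R s g (free_var (Gen_inv e)) = inv (g e)"
  using free_eval_single[of "Word [Gen_inv e]" 1] g[of e]
  by (simp add: free_var_def word_value_def letters_over_def letter_value_def s_one)

lemma free_eval_hom: "ring_hom_ring (free_algebra E) R (free_eval R s g)"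
  by (rule ring_hom_ringI2)
    (auto intro!: ring_hom_memI ring_free_algebra ring_axioms free_eval_closed
      simp: free_eval_add free_eval_mult free_eval_one)

lemma free_eval_diff:
  assumes "f \<in> carrier (free_algebra E)" "h \<in> carrier (free_algebra E)"
  shows "free_eval R s g (f - h) = free_eval R s g f \<ominus> free_eval R s g h"
proof -
  note cl = free_eval_closed[OF free_diff_closed[OF assms]] free_eval_closed[OF assms(1)]
    free_eval_closed[OF assms(2)]
  have "free_eval R s g f = free_eval R s g (f - h) \<oplus> free_eval R s g h"
    using free_eval_add[OF free_diff_closed[OF assms] assms(2)] by simp
  then show ?thesis
    using cl by (simp add: a_minus_def a_assoc r_neg)
qed

lemma free_eval_power:
  assumes "f \<in> carrier (free_algebra E)"
  shows "f ^ n \<in> carrier (free_algebra E)" "free_eval R s g (f ^ n) = free_eval R s g f [^] n"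
proof -
  have "f ^ n \<in> carrier (free_algebra E) \<and> free_eval R s g (f ^ n) = free_eval R s g f [^] n"
    using assms by (induction n)
      (auto simp: free_one_closed free_eval_one free_mult_closed free_eval_mult power_Suc2
        simp del: power_Suc)
  then show "f ^ n \<in> carrier (free_algebra E)" "free_eval R s g (f ^ n) = free_eval R s g f [^] n"
    by auto
qed

end

end

text \<open>Naturality of evaluation. Inverse letters cause no trouble because a ring homomorphism
  preserves inverses of units. This is what reduces both equivariance statements to the
  generators.\<close>

lemma hom_free_eval:
  assumes "scalar_ring R s" "scalar_ring R' s'" "h \<in> Ring.ring_hom R R'" "\<And>c. h (s c) = s' c"
    and g: "\<And>e. e \<in> E \<Longrightarrow> g e \<in> Units R"
    and g': "\<And>e. e \<in> E \<Longrightarrow> g' e = h (g e)"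
    and f: "f \<in> carrier (free_algebra E)"
  shows "free_eval R' s' g' f = h (free_eval R s g f)"
proof -
  interpret R: scalar_ring R s by fact
  interpret R': scalar_ring R' s' by fact
  interpret h: ring_hom_ring R R' h
    by (rule ring_hom_ringI2) (use assms R.ring_axioms R'.ring_axioms in auto)
  have unit: "h x \<in> Units R'" "h (inv\<^bsub>R\<^esub> x) = inv\<^bsub>R'\<^esub> (h x)" if "x \<in> Units R" for x
  proof -
    have x: "x \<in> carrier R" "inv\<^bsub>R\<^esub> x \<in> carrier R"
      using that by auto
    have "h x \<otimes>\<^bsub>R'\<^esub> h (inv\<^bsub>R\<^esub> x) = \<one>\<^bsub>R'\<^esub>" "h (inv\<^bsub>R\<^esub> x) \<otimes>\<^bsub>R'\<^esub> h x = \<one>\<^bsub>R'\<^esub>"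
      using that x by (simp_all flip: h.hom_mult)
    then show "h x \<in> Units R'" "h (inv\<^bsub>R\<^esub> x) = inv\<^bsub>R'\<^esub> (h x)"
      using x R'.inv_char[of "h x" "h (inv\<^bsub>R\<^esub> x)"] by (auto simp: Units_def)
  qed
  have letter: "letter_value R' g' l = h (letter_value R g l)" if "l \<in> letters_over E" for l
    using that unit g g' by (auto simp: letters_over_def letter_value_def)
  have letter_cl: "letter_value R g l \<in> carrier R" if "l \<in> letters_over E" for l
    by (rule R.letter_value_closed[of E]) (use g that in auto)
  have word_cl: "R.word_value g ls \<in> carrier R" if "set ls \<subseteq> letters_over E" for ls
    by (rule R.word_value_closed[of E]) (use g that in auto)
  have word: "R'.word_value g' ls = h (R.word_value g ls)" if "set ls \<subseteq> letters_over E" for ls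
    using that
  proof (induction ls)
    case (Cons l ls)
    then show ?case
      using letter[of l] letter_cl[of l] word_cl[of ls]
      by (simp add: R.word_value_def R'.word_value_def)
  qed (simp add: R.word_value_def R'.word_value_def)
  have u: "set (letters u) \<subseteq> letters_over E" if "u \<in> Poly_Mapping.keys f" for u
    using f that unfolding carrier_free_algebra by blast
  have hsum: "finite A \<Longrightarrow> k \<in> A \<rightarrow> carrier R \<Longrightarrow>
      h (\<Oplus>\<^bsub>R\<^esub>i\<in>A. k i) = (\<Oplus>\<^bsub>R'\<^esub>i\<in>A. h (k i))" for A and k :: "_ \<Rightarrow> 'a"
    by (induction A rule: finite_induct) (auto simp: Pi_def)
  have cl: "R.word_value g (letters u) \<in> carrier R" if "u \<in> Poly_Mapping.keys f" for u
    by (rule word_cl) (use u that in auto)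
  show ?thesis
    unfolding R.free_eval_eq R'.free_eval_eq
    using word[OF u] cl assms(4)
    by (subst hsum) (auto intro!: R'.finsum_cong')
qed

section \<open>The Chekhov--Fock algebra\<close>

text \<open>The relations lie in the kernel of the evaluation, hence so does the ideal they
  generate, and the evaluation is constant on each coset. The coset contains its representative, so
  \<open>the_elem\<close> picks that value.\<close>

lemma (in scalar_ring) induced_hom_eq:
  assumes g: "\<And>e. e \<in> E \<Longrightarrow> g e \<in> Units R"
    and rel: "A \<subseteq> carrier (free_algebra E)" "\<And>r. r \<in> A \<Longrightarrow> free_eval R s g r = \<zero>"
    and f: "f \<in> carrier (free_algebra E)"
  shows "induced_hom R s g (Idl\<^bsub>free_algebra E\<^esub> A +>\<^bsub>free_algebra E\<^esub> f) = free_eval R s g f"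
proof -
  let ?h = "free_eval R s g" and ?I = "Idl\<^bsub>free_algebra E\<^esub> A"
  interpret h: ring_hom_ring "free_algebra E" R ?h
    by (rule free_eval_hom) (fact g)
  have "?I \<subseteq> a_kernel (free_algebra E) R ?h"
  proof (rule ring.genideal_minimal[OF ring_free_algebra h.kernel_is_ideal])
    show "A \<subseteq> a_kernel (free_algebra E) R ?h"
      unfolding a_kernel_def' using rel by blast
  qed
  then have I: "i \<in> carrier (free_algebra E) \<and> ?h i = \<zero>" if "i \<in> ?I" for i
    using that unfolding a_kernel_def' by blast
  have "?h ` (?I +>\<^bsub>free_algebra E\<^esub> f) = {?h f}"
  proof
    have "?h (i + f) = ?h f" if "i \<in> ?I" for i
      using I[OF that] h.hom_add[of i f] f by simp
    then show "?h ` (?I +>\<^bsub>free_algebra E\<^esub> f) \<subseteq> {?h f}"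
      by (auto simp: a_r_coset_def')
    have "0 \<in> ?I"
      using additive_subgroup.zero_closed[OF ideal.axioms(1)[OF
          ring.genideal_ideal[OF ring_free_algebra rel(1)]]]
      by simp
    then have "f \<in> ?I +>\<^bsub>free_algebra E\<^esub> f"
      by (auto simp: a_r_coset_def' intro!: bexI[of _ 0])
    then show "{?h f} \<subseteq> ?h ` (?I +>\<^bsub>free_algebra E\<^esub> f)"
      by blast
  qed
  then show ?thesis
    by (simp add: induced_hom_def)
qed

lemma CF_relations_closed: "CF_relations N p \<tau> \<subseteq> carrier (free_algebra (edges \<tau>))"
proof -
  have "f ^ N \<in> carrier (free_algebra (edges \<tau>))" if "f \<in> carrier (free_algebra (edges \<tau>))" for f
    using that by (induction N) (auto intro: free_algebra_closed)
  then show ?thesis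
    unfolding CF_relations_def
    by (auto intro!: free_algebra_closed(3-) free_one_closed free_Gen_closed free_Gen_inv_closed
        free_const_closed simp flip: minus_add_distrib)
qed

lemma CF_ideal: "ideal (CF_ideal N p \<tau>) (free_algebra (edges \<tau>))"
  unfolding CF_ideal_def
  by (rule ring.genideal_ideal[OF ring_free_algebra CF_relations_closed])

lemma CF_class_hom: "ring_hom_ring (free_algebra (edges \<tau>)) (CF N p \<tau>) (CF_class N p \<tau>)"
  using ideal.rcos_ring_hom_ring[OF CF_ideal[of N p \<tau>]]
  by (simp add: CF_def CF_class_def[abs_def])

lemma CF_carrierE:
  assumes "x \<in> carrier (CF N p \<tau>)"
  obtains f where "f \<in> carrier (free_algebra (edges \<tau>))" "x = CF_class N p \<tau> f"
  using assms by (auto simp: CF_def FactRing_def A_RCOSETS_def' CF_class_def)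

lemma CF_class_relation:
  assumes "r \<in> CF_relations N p \<tau>"
  shows "CF_class N p \<tau> r = \<zero>\<^bsub>CF N p \<tau>\<^esub>"
proof -
  interpret ring "free_algebra (edges \<tau>)" by (rule ring_free_algebra)
  interpret ideal "CF_ideal N p \<tau>" "free_algebra (edges \<tau>)" by (rule CF_ideal)
  have "r \<in> CF_ideal N p \<tau>"
    using genideal_self[OF CF_relations_closed] assms unfolding CF_ideal_def by blast
  then show ?thesis
    by (simp add: CF_class_def CF_def FactRing_def a_rcos_const)
qed

lemma CF_scalar_ring: "scalar_ring (CF N p \<tau>) (CF_scalar N p \<tau>)"
proof -
  interpret h: ring_hom_ring "free_algebra (edges \<tau>)" "CF N p \<tau>" "CF_class N p \<tau>"
    by (rule CF_class_hom)
  show ?thesis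
  proof
    fix c d
    show "CF_scalar N p \<tau> c \<in> carrier (CF N p \<tau>)"
      by (simp add: free_const_closed)
    show "CF_scalar N p \<tau> (c + d) = CF_scalar N p \<tau> c \<oplus>\<^bsub>CF N p \<tau>\<^esub> CF_scalar N p \<tau> d"
      by (simp add: free_const_closed free_const_def[of "c + d"] single_add
          free_const_def[symmetric] flip: h.hom_add)
    show "CF_scalar N p \<tau> (c * d) = CF_scalar N p \<tau> c \<otimes>\<^bsub>CF N p \<tau>\<^esub> CF_scalar N p \<tau> d"
    proof -
      have "CF_scalar N p \<tau> (c * d) = CF_class N p \<tau> (free_const c * free_const d)"
        by (simp add: free_const_def mult_single)
      then show ?thesis
        using h.hom_mult[OF free_const_closed[of c] free_const_closed[of d]] by simp
    qed
    show "CF_scalar N p \<tau> 1 = \<one>\<^bsub>CF N p \<tau>\<^esub>"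
      using h.hom_one by (simp add: free_const_def)
  next
    fix x c assume "x \<in> carrier (CF N p \<tau>)"
    then obtain f where f: "f \<in> carrier (free_algebra (edges \<tau>))" "x = CF_class N p \<tau> f"
      by (rule CF_carrierE)
    then show "x \<otimes>\<^bsub>CF N p \<tau>\<^esub> CF_scalar N p \<tau> c = CF_scalar N p \<tau> c \<otimes>\<^bsub>CF N p \<tau>\<^esub> x"
      using h.hom_mult[OF f(1) free_const_closed[of c]] h.hom_mult[OF free_const_closed[of c] f(1)]
      by (simp add: free_const_comm)
  qed
qed

lemma CF_gen_relations:
  fixes p :: "'s coeff" and \<tau> :: "('v::finite, 's) dotted"
  assumes "\<alpha> \<in> edges \<tau>"
  shows CF_gen_Units: "CF_gen N p \<tau> \<alpha> \<in> Units (CF N p \<tau>)"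
    and CF_gen_commute: "\<beta> \<in> edges \<tau> \<Longrightarrow>
      CF_gen N p \<tau> \<alpha> \<otimes>\<^bsub>CF N p \<tau>\<^esub> CF_gen N p \<tau> \<beta> =
        CF_scalar N p \<tau> (qroot N powi (2 * eps \<tau> \<alpha> \<beta>)) \<otimes>\<^bsub>CF N p \<tau>\<^esub>
          (CF_gen N p \<tau> \<beta> \<otimes>\<^bsub>CF N p \<tau>\<^esub> CF_gen N p \<tau> \<alpha>)"
    and CF_gen_power: "CF_gen N p \<tau> \<alpha> [^]\<^bsub>CF N p \<tau>\<^esub> N = CF_scalar N p \<tau> (gen_scale p \<tau> \<alpha> ^ N)"
proof -
  interpret h: ring_hom_ring "free_algebra (edges \<tau>)" "CF N p \<tau>" "CF_class N p \<tau>"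
    by (rule CF_class_hom)
  have eqI: "CF_class N p \<tau> f = CF_class N p \<tau> k"
    if "f - k \<in> CF_relations N p \<tau>" "f \<in> carrier (free_algebra (edges \<tau>))"
      "k \<in> carrier (free_algebra (edges \<tau>))" for f k
  proof -
    have "CF_class N p \<tau> f = CF_class N p \<tau> ((f - k) + k)"
      by simp
    also have "\<dots> = CF_class N p \<tau> (f - k) \<oplus>\<^bsub>CF N p \<tau>\<^esub> CF_class N p \<tau> k"
      using h.hom_add[OF free_diff_closed[OF that(2,3)] that(3)] by simp
    also have "\<dots> = CF_class N p \<tau> k"
      using that by (simp add: CF_class_relation)
    finally show ?thesis .
  qed
  note gens = free_Gen_closed free_Gen_inv_closed free_const_closed
  have 1: "CF_class N p \<tau> (free_var (Gen \<alpha>) * free_var (Gen_inv \<alpha>)) = \<one>\<^bsub>CF N p \<tau>\<^esub>"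
  proof -
    have "free_var (Gen \<alpha>) * free_var (Gen_inv \<alpha>) - 1 \<in> CF_relations N p \<tau>"
      unfolding CF_relations_def using assms by blast
    then have "CF_class N p \<tau> (free_var (Gen \<alpha>) * free_var (Gen_inv \<alpha>)) = CF_class N p \<tau> 1"
      using assms by (intro eqI) (simp_all add: gens free_one_closed free_mult_closed)
    then show ?thesis
      using h.hom_one by simp
  qed
  have 2: "CF_class N p \<tau> (free_var (Gen_inv \<alpha>) * free_var (Gen \<alpha>)) = \<one>\<^bsub>CF N p \<tau>\<^esub>"
  proof -
    have "free_var (Gen_inv \<alpha>) * free_var (Gen \<alpha>) - 1 \<in> CF_relations N p \<tau>"
      unfolding CF_relations_def using assms by blast
    then have "CF_class N p \<tau> (free_var (Gen_inv \<alpha>) * free_var (Gen \<alpha>)) = CF_class N p \<tau> 1"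
      using assms by (intro eqI) (simp_all add: gens free_one_closed free_mult_closed)
    then show ?thesis
      using h.hom_one by simp
  qed
  show "CF_gen N p \<tau> \<alpha> \<in> Units (CF N p \<tau>)"
    using 1 2 assms h.hom_mult[of "free_var (Gen \<alpha>)" "free_var (Gen_inv \<alpha>)"]
      h.hom_mult[of "free_var (Gen_inv \<alpha>)" "free_var (Gen \<alpha>)"]
    by (auto simp: Units_def gens intro!: bexI[of _ "CF_class N p \<tau> (free_var (Gen_inv \<alpha>))"])
  show "CF_gen N p \<tau> \<alpha> \<otimes>\<^bsub>CF N p \<tau>\<^esub> CF_gen N p \<tau> \<beta> =
        CF_scalar N p \<tau> (qroot N powi (2 * eps \<tau> \<alpha> \<beta>)) \<otimes>\<^bsub>CF N p \<tau>\<^esub>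
          (CF_gen N p \<tau> \<beta> \<otimes>\<^bsub>CF N p \<tau>\<^esub> CF_gen N p \<tau> \<alpha>)" if \<beta>: "\<beta> \<in> edges \<tau>"
  proof -
    let ?a = "free_var (Gen \<alpha>)" and ?b = "free_var (Gen \<beta>)"
    let ?c = "free_const (qroot N powi (2 * eps \<tau> \<alpha> \<beta>))"
    have "?a * ?b - ?c * (?b * ?a) \<in> CF_relations N p \<tau>"
      unfolding CF_relations_def using assms \<beta> by blast
    then have "CF_class N p \<tau> (?a * ?b) = CF_class N p \<tau> (?c * (?b * ?a))"
      using assms \<beta> by (intro eqI) (auto simp: gens free_mult_closed)
    then show ?thesis
      using h.hom_mult[of ?a ?b] h.hom_mult[of ?b ?a] h.hom_mult[of ?c "?b * ?a"] assms \<beta>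
      by (simp add: gens free_mult_closed)
  qed
  have pow: "free_var (Gen \<alpha>) ^ n \<in> carrier (free_algebra (edges \<tau>)) \<and>
      CF_class N p \<tau> (free_var (Gen \<alpha>) ^ n) = CF_gen N p \<tau> \<alpha> [^]\<^bsub>CF N p \<tau>\<^esub> n" for n
    using assms h.hom_mult[of _ "free_var (Gen \<alpha>)"] h.hom_one
    by (induction n) (auto simp: gens free_one_closed free_mult_closed power_Suc2 simp del: power_Suc)
  have "free_var (Gen \<alpha>) ^ N - free_const (gen_scale p \<tau> \<alpha> ^ N) \<in> CF_relations N p \<tau>"
    unfolding CF_relations_def using assms by blast
  then show "CF_gen N p \<tau> \<alpha> [^]\<^bsub>CF N p \<tau>\<^esub> N = CF_scalar N p \<tau> (gen_scale p \<tau> \<alpha> ^ N)"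
    using pow[of N] eqI by (metis free_const_closed)
qed

context scalar_ring
begin

context
  fixes N :: nat and p :: "'s coeff" and \<tau> :: "('v::finite, 's) dotted" and g :: "'s set \<Rightarrow> 'a"
  assumes unit: "\<And>\<alpha>. \<alpha> \<in> edges \<tau> \<Longrightarrow> g \<alpha> \<in> Units R"
    and commute: "\<And>\<alpha> \<beta>. \<alpha> \<in> edges \<tau> \<Longrightarrow> \<beta> \<in> edges \<tau> \<Longrightarrow>
      g \<alpha> \<otimes> g \<beta> = s (qroot N powi (2 * eps \<tau> \<alpha> \<beta>)) \<otimes> (g \<beta> \<otimes> g \<alpha>)"
    and power: "\<And>\<alpha>. \<alpha> \<in> edges \<tau> \<Longrightarrow> g \<alpha> [^] N = s (gen_scale p \<tau> \<alpha> ^ N)"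
begin

text \<open>The universal property of the presentation: units of any algebra that satisfy the
  exchange and power relations may be substituted for the generators.\<close>

lemma induced_hom_CF:
  assumes f: "f \<in> carrier (free_algebra (edges \<tau>))"
  shows "induced_hom R s g (CF_class N p \<tau> f) = free_eval R s g f"
  unfolding CF_class_def CF_ideal_def
proof (rule induced_hom_eq[OF unit CF_relations_closed _ f])
  note ev = free_eval_diff[of "edges \<tau>" g] free_eval_mult[of "edges \<tau>" g]
    free_eval_Gen[of "edges \<tau>" g] free_eval_Gen_inv[of "edges \<tau>" g] free_eval_one[of "edges \<tau>" g]
    free_eval_const[of "edges \<tau>" g] free_eval_power[of "edges \<tau>" g]
  note cl = free_mult_closed free_Gen_closed free_Gen_inv_closed free_const_closed free_one_closed
  fix r assume "r \<in> CF_relations N p \<tau>"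
  then consider
    \<alpha> where "\<alpha> \<in> edges \<tau>" "r = free_var (Gen \<alpha>) * free_var (Gen_inv \<alpha>) - 1"
    | \<alpha> where "\<alpha> \<in> edges \<tau>" "r = free_var (Gen_inv \<alpha>) * free_var (Gen \<alpha>) - 1"
    | \<alpha> \<beta> where "\<alpha> \<in> edges \<tau>" "\<beta> \<in> edges \<tau>" "r = free_var (Gen \<alpha>) * free_var (Gen \<beta>) -
        free_const (qroot N powi (2 * eps \<tau> \<alpha> \<beta>)) * (free_var (Gen \<beta>) * free_var (Gen \<alpha>))"
    | \<alpha> where "\<alpha> \<in> edges \<tau>" "r = free_var (Gen \<alpha>) ^ N - free_const (gen_scale p \<tau> \<alpha> ^ N)"
    unfolding CF_relations_def by blast
  then show "free_eval R s g r = \<zero>"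
  proof cases
    case (3 \<alpha> \<beta>)
    have "free_eval R s g r = g \<alpha> \<otimes> g \<beta> \<ominus> s (qroot N powi (2 * eps \<tau> \<alpha> \<beta>)) \<otimes> (g \<beta> \<otimes> g \<alpha>)"
      using 3 unit by (simp add: ev cl)
    also have "\<dots> = \<zero>"
      using 3 unit[THEN Units_closed] by (subst commute) (simp_all add: r_neg a_minus_def)
    finally show ?thesis .
  qed (use unit unit[THEN Units_closed] in \<open>simp_all add: ev cl power r_neg a_minus_def\<close>)
qed

lemma induced_hom_CF_hom:
  "induced_hom R s g \<in> Ring.ring_hom (CF N p \<tau>) R"
  "induced_hom R s g (CF_scalar N p \<tau> c) = s c"
  "\<alpha> \<in> edges \<tau> \<Longrightarrow> induced_hom R s g (CF_gen N p \<tau> \<alpha>) = g \<alpha>"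
proof -
  interpret h: ring_hom_ring "free_algebra (edges \<tau>)" "CF N p \<tau>" "CF_class N p \<tau>"
    by (rule CF_class_hom)
  interpret e: ring_hom_ring "free_algebra (edges \<tau>)" R "free_eval R s g"
    by (rule free_eval_hom) (fact unit)
  show "induced_hom R s g \<in> Ring.ring_hom (CF N p \<tau>) R"
  proof (rule ring_hom_memI)
    fix x assume "x \<in> carrier (CF N p \<tau>)"
    then obtain f where f: "f \<in> carrier (free_algebra (edges \<tau>))" "x = CF_class N p \<tau> f"
      by (rule CF_carrierE)
    then show "induced_hom R s g x \<in> carrier R"
      by (simp add: induced_hom_CF)
    fix y assume "y \<in> carrier (CF N p \<tau>)"
    then obtain k where k: "k \<in> carrier (free_algebra (edges \<tau>))" "y = CF_class N p \<tau> k"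
      by (rule CF_carrierE)
    show "induced_hom R s g (x \<otimes>\<^bsub>CF N p \<tau>\<^esub> y) = induced_hom R s g x \<otimes> induced_hom R s g y"
      "induced_hom R s g (x \<oplus>\<^bsub>CF N p \<tau>\<^esub> y) = induced_hom R s g x \<oplus> induced_hom R s g y"
      using f k h.hom_mult[of f k] h.hom_add[of f k] e.hom_mult[of f k] e.hom_add[of f k]
        induced_hom_CF[of "f * k"] induced_hom_CF[of "f + k"]
      by (simp_all add: induced_hom_CF free_mult_closed free_add_closed flip: h.hom_mult h.hom_add)
  next
    show "induced_hom R s g \<one>\<^bsub>CF N p \<tau>\<^esub> = \<one>"
      using h.hom_one induced_hom_CF[of 1] e.hom_one by (simp add: free_one_closed)
  qed
  show "induced_hom R s g (CF_scalar N p \<tau> c) = s c"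
    by (simp add: induced_hom_CF free_const_closed free_eval_const[of "edges \<tau>"] unit)
  show "induced_hom R s g (CF_gen N p \<tau> \<alpha>) = g \<alpha>" if "\<alpha> \<in> edges \<tau>"
    using that by (simp add: induced_hom_CF free_Gen_closed free_eval_Gen[of "edges \<tau>"] unit)
qed

end

end

section \<open>Powers of \<open>q\<close>\<close>

lemma qroot_nonzero [simp]: "qroot N \<noteq> 0"
  by (simp add: qroot_def)

text \<open>The sign in the definition of \<open>qroot\<close> and the value cis pi = -1 cancel for
  odd exponents only.\<close>

lemma qroot_power_eq_one:
  assumes "odd N"
  shows "qroot N ^ N = 1"
proof -
  have "N > 0"
    using assms by (cases N) auto
  then show ?thesis
    using assms by (simp add: qroot_def power_minus_odd Complex.DeMoivre)
qed

lemma qroot_powi_cong: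
  assumes "odd N" "[a = b] (mod int N)"
  shows "qroot N powi a = qroot N powi b"
proof -
  obtain d where "b = a + int N * d"
    using assms(2) by (metis cong_iff_lin)
  then show ?thesis
    using qroot_power_eq_one[OF assms(1)] by (simp add: power_int_add power_int_mult)
qed

text \<open>The square of \<open>qroot N\<close> is the standard primitive N-th root of unity. Even
  powers therefore separate residues modulo N.\<close>

lemma qroot_powi_double: "qroot N powi (2 * d) = cis (2 * pi * real_of_int d / real N)"
proof -
  have "qroot N ^ 2 = cis (2 * pi / real N)"
    by (simp add: qroot_def power2_eq_square cis_mult)
  then show ?thesis
    by (simp add: power_int_mult cis_power_int)
       (simp add: field_simps)
qed

lemma qroot_powi_double_eq_one_iff:
  assumes "N > 0"
  shows "qroot N powi (2 * d) = 1 \<longleftrightarrow> int N dvd d"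
proof
  assume "qroot N powi (2 * d) = 1"
  then have "cos (2 * pi * real_of_int d / real N) = 1"
    by (simp add: qroot_powi_double complex_eq_iff)
  then obtain m :: int where "2 * pi * real_of_int d / real N = 2 * pi * m"
    by (metis cos_one_2pi_int mult.commute mult.left_commute)
  then have "real_of_int d = real_of_int (int N * m)"
    using assms by (simp add: field_simps)
  then show "int N dvd d"
    by (metis dvd_triv_left of_int_eq_iff)
next
  assume "int N dvd d"
  then obtain m where "d = int N * m"
    by blast
  then have "qroot N powi (2 * d) = cis (2 * pi * of_int m)"
    using assms by (simp add: qroot_powi_double mult.assoc)
  also have "\<dots> = 1"
    by (rule cis_multiple_2pi) simp
  finally show "qroot N powi (2 * d) = 1" .
qed

lemma qroot_sum:
  assumes "odd N"
  shows "(\<Sum>j<N. qroot N powi (2 * d * int j)) = (if int N dvd d then of_nat N else 0)"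
proof -
  have N: "N > 0"
    using assms by (cases N) auto
  let ?z = "qroot N powi (2 * d)"
  have "(\<Sum>j<N. qroot N powi (2 * d * int j)) = (\<Sum>j<N. ?z ^ j)"
    by (simp only: power_int_mult power_int_of_nat)
  moreover have "?z ^ N = 1"
    using qroot_powi_cong[OF assms, of "2 * d * int N" 0]
    by (simp add: cong_mult_self_right power_int_mult)
  ultimately show ?thesis
    using qroot_powi_double_eq_one_iff[OF N, of d] geometric_sum[of ?z N] by auto
qed

lemma qroot_powi_eq_iff:
  assumes "odd N"
  shows "qroot N powi (2 * a) = qroot N powi (2 * b) \<longleftrightarrow> [a = b] (mod int N)"
proof -
  have "N > 0"
    using assms by (cases N) auto
  have "qroot N powi (2 * (a - b)) = qroot N powi (2 * a) / qroot N powi (2 * b)"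
    by (simp add: power_int_diff right_diff_distrib)
  then show ?thesis
    using qroot_powi_double_eq_one_iff[OF \<open>N > 0\<close>, of "a - b"]
    by (auto simp: cong_iff_dvd_diff simp del: power_int_mult_distrib)
qed

section \<open>Functional calculus for elements of finite order\<close>

context scalar_ring
begin

definition power_poly :: "nat \<Rightarrow> 'a \<Rightarrow> (nat \<Rightarrow> complex) \<Rightarrow> 'a" where
  "power_poly N Y c = (\<Oplus>j\<in>{..<N}. s (c j) \<otimes> Y [^] j)"

text \<open>The discrete Fourier formula for the projection onto the part where Y acts as q^(2k).
  Powers below N suffice because Y^N = 1 wherever this is used.\<close>

definition eigen_proj :: "nat \<Rightarrow> 'a \<Rightarrow> int \<Rightarrow> 'a" where
  "eigen_proj N Y k = power_poly N Y (\<lambda>j. qroot N powi (- 2 * k * int j) / of_nat N)"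

text \<open>The polynomial in \<open>Y\<close> that interpolates \<open>\<Psi>\<close> at the \<open>N\<close>-th roots of unity.\<close>

definition functional_calc :: "nat \<Rightarrow> 'a \<Rightarrow> (complex \<Rightarrow> complex) \<Rightarrow> 'a" where
  "functional_calc N Y \<Psi> = power_poly N Y
     (\<lambda>j. (\<Sum>k<N. \<Psi> (qroot N powi (2 * int k)) * qroot N powi (- 2 * int k * int j)) / of_nat N)"

lemma eigen_mult:
  assumes "a \<in> carrier R" "b \<in> carrier R" "x \<in> carrier R"
    and "a \<otimes> x = s c \<otimes> x" "b \<otimes> x = s d \<otimes> x"
  shows "a \<otimes> b \<otimes> x = s (c * d) \<otimes> x"
proof -
  have "a \<otimes> b \<otimes> x = a \<otimes> (s d \<otimes> x)"
    using assms by (simp add: m_assoc)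
  also have "\<dots> = s d \<otimes> (a \<otimes> x)"
    by (rule s_prod_lcomm) (use assms in auto)
  also have "\<dots> = s d \<otimes> (s c \<otimes> x)"
    unfolding assms(4) ..
  finally show ?thesis
    using assms by (simp add: s_s mult.commute)
qed

context
  fixes N :: nat and Y :: 'a
  assumes odd: "odd N" and Y [simp, intro]: "Y \<in> carrier R" and Y_pow: "Y [^] N = \<one>"
begin

lemma N_pos: "N > 0"
  using odd by (cases N) auto

lemma power_poly_closed [simp, intro]: "power_poly N Y c \<in> carrier R"
  unfolding power_poly_def by (intro finsum_closed) auto

lemma power_poly_add: "power_poly N Y (\<lambda>j. c j + d j) = power_poly N Y c \<oplus> power_poly N Y d"
  unfolding power_poly_def
  by (subst finsum_addf[symmetric]) (auto simp: s_add l_distr intro!: finsum_cong')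

lemma power_poly_sum:
  "finite A \<Longrightarrow> power_poly N Y (\<lambda>j. \<Sum>k\<in>A. c k j) = (\<Oplus>k\<in>A. power_poly N Y (c k))"
proof (induction A rule: finite_induct)
  case empty
  have "power_poly N Y (\<lambda>j. 0) = (\<Oplus>j\<in>{..<N}. \<zero>)"
    unfolding power_poly_def by (intro finsum_cong') (auto simp: s_zero)
  then show ?case
    by simp
next
  case (insert k A)
  then show ?case
    by (simp add: power_poly_add Pi_def)
qed

lemma pow_comm_scalar:
  assumes "X \<in> carrier R" "Y \<otimes> X = s r \<otimes> (X \<otimes> Y)"
  shows "Y [^] j \<otimes> X = s (r ^ j) \<otimes> (X \<otimes> Y [^] (j :: nat))"
proof (induction j)
  case 0
  then show ?case
    using assms by (simp add: s_one)
next
  case (Suc j)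
  have "Y [^] Suc j \<otimes> X = Y [^] j \<otimes> (s r \<otimes> (X \<otimes> Y))"
    using assms by (simp add: m_assoc)
  also have "\<dots> = s r \<otimes> (Y [^] j \<otimes> X \<otimes> Y)"
    using assms(1) by (simp add: s_prod_lcomm m_assoc)
  also have "\<dots> = s r \<otimes> (s (r ^ j) \<otimes> (X \<otimes> Y [^] Suc j))"
    using assms(1) by (simp add: Suc.IH m_assoc)
  finally show ?case
    using assms(1) by (simp add: s_s)
qed

lemma power_poly_comm:
  assumes "X \<in> carrier R" "Y \<otimes> X = s r \<otimes> (X \<otimes> Y)"
  shows "power_poly N Y c \<otimes> X = X \<otimes> power_poly N Y (\<lambda>j. c j * r ^ j)"
proof -
  have "power_poly N Y c \<otimes> X = (\<Oplus>j\<in>{..<N}. s (c j) \<otimes> Y [^] j \<otimes> X)"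
    unfolding power_poly_def using assms by (intro finsum_ldistr) auto
  also have "\<dots> = (\<Oplus>j\<in>{..<N}. X \<otimes> (s (c j * r ^ j) \<otimes> Y [^] j))"
  proof (rule finsum_cong')
    fix j
    have "s (c j) \<otimes> Y [^] j \<otimes> X = s (c j) \<otimes> (Y [^] j \<otimes> X)"
      using assms(1) by (simp add: m_assoc)
    also have "\<dots> = s (c j * r ^ j) \<otimes> (X \<otimes> Y [^] j)"
      using assms(1) by (simp add: pow_comm_scalar[OF assms] s_s)
    also have "\<dots> = X \<otimes> (s (c j * r ^ j) \<otimes> Y [^] j)"
      by (rule s_prod_lcomm[symmetric]) (use assms(1) in auto)
    finally show "s (c j) \<otimes> Y [^] j \<otimes> X = X \<otimes> (s (c j * r ^ j) \<otimes> Y [^] j)" .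
  qed (use assms in auto)
  also have "\<dots> = X \<otimes> power_poly N Y (\<lambda>j. c j * r ^ j)"
    unfolding power_poly_def using assms by (intro finsum_rdistr[symmetric]) auto
  finally show ?thesis .
qed

lemma power_poly_eigen:
  assumes "x \<in> carrier R" "Y \<otimes> x = s r \<otimes> x"
  shows "power_poly N Y c \<otimes> x = s (\<Sum>j<N. c j * r ^ j) \<otimes> x"
proof -
  have pow: "Y [^] j \<otimes> x = s (r ^ j) \<otimes> x" for j :: nat
  proof (induction j)
    case 0
    then show ?case using assms by (simp add: s_one)
  next
    case (Suc j)
    have "Y [^] Suc j \<otimes> x = Y [^] j \<otimes> (s r \<otimes> x)"
      using assms by (simp add: m_assoc)
    also have "\<dots> = s r \<otimes> (Y [^] j \<otimes> x)"
      using assms(1) by (simp add: s_prod_lcomm)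
    finally show ?case
      using assms(1) by (simp add: Suc.IH s_s)
  qed
  have "power_poly N Y c \<otimes> x = (\<Oplus>j\<in>{..<N}. s (c j) \<otimes> Y [^] j \<otimes> x)"
    unfolding power_poly_def using assms by (intro finsum_ldistr) auto
  also have "\<dots> = (\<Oplus>j\<in>{..<N}. s (c j * r ^ j) \<otimes> x)"
    using assms(1) by (intro finsum_cong') (auto simp: m_assoc pow s_s)
  also have "\<dots> = (\<Oplus>j\<in>{..<N}. s (c j * r ^ j)) \<otimes> x"
    using assms by (intro finsum_ldistr[symmetric]) auto
  finally show ?thesis
    by (simp add: s_sum)
qed

lemma eigen_proj_closed [simp, intro]: "eigen_proj N Y k \<in> carrier R"
  by (simp add: eigen_proj_def)

lemma functional_calc_closed [simp, intro]: "functional_calc N Y \<Psi> \<in> carrier R"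
  by (simp add: functional_calc_def)

text \<open>Multiplication by Y moves each term of the Fourier sum to the next one, up to the factor
  q^(2k). The sum is cyclic, because Y^N and q^N are both 1.\<close>

lemma eigen_proj_eigen: "Y \<otimes> eigen_proj N Y k = s (qroot N powi (2 * k)) \<otimes> eigen_proj N Y k"
proof -
  let ?c = "\<lambda>j. qroot N powi (- 2 * k * int j) / of_nat N"
  let ?a = "\<lambda>j. s (?c j) \<otimes> Y [^] j"
  obtain n where n: "N = Suc n"
    using N_pos by (cases N) auto
  have a: "?a j \<in> carrier R" for j
    by simp
  have shift: "Y \<otimes> ?a j = s (qroot N powi (2 * k)) \<otimes> ?a (Suc j)" for j
  proof -
    have c: "?c j = qroot N powi (2 * k) * ?c (Suc j)"
      by (simp add: power_int_add[symmetric] algebra_simps)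
    have "Y \<otimes> ?a j = s (?c j) \<otimes> Y [^] Suc j"
      by (metis Y a nat_pow_Suc2 nat_pow_closed s_prod_lcomm)
    also have "\<dots> = s (qroot N powi (2 * k) * ?c (Suc j)) \<otimes> Y [^] Suc j"
      by (simp only: c)
    finally show ?thesis
      by (simp only: s_s nat_pow_closed Y)
  qed
  have "?a N = ?a 0"
  proof -
    have "qroot N powi (- 2 * k * int N) = qroot N powi 0"
      by (rule qroot_powi_cong[OF odd]) (simp add: cong_def)
    then show ?thesis
      by (simp add: Y_pow)
  qed
  then have wrap: "?a (Suc n) = ?a 0"
    by (simp only: n)
  \<comment> \<open>Both sums differ from the sum over \<open>{..Suc n}\<close> by one end term, and
    the two end terms agree by \<open>wrap\<close>.\<close>
  have "(\<Oplus>j\<in>{..<N}. ?a (Suc j)) = (\<Oplus>j\<in>{..<N}. ?a j)"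
  proof -
    let ?S = "\<Oplus>j\<in>{..n}. ?a (Suc j)" and ?T = "\<Oplus>j\<in>{..n}. ?a j"
    have "?S \<oplus> ?a 0 = finsum R ?a {..Suc n}"
      by (rule finsum_Suc2[symmetric]) (use a in blast)
    also have "\<dots> = ?a (Suc n) \<oplus> ?T"
      by (rule finsum_Suc) (use a in blast)
    also have "\<dots> = ?T \<oplus> ?a 0"
      unfolding wrap by (intro a_comm finsum_closed) (use a in blast)+
    finally have "?S = ?T"
      by (subst (asm) add.right_cancel) (use a in \<open>auto intro!: finsum_closed\<close>)
    then show ?thesis
      by (simp only: n lessThan_Suc_atMost)
  qed
  moreover have "Y \<otimes> eigen_proj N Y k = (\<Oplus>j\<in>{..<N}. Y \<otimes> ?a j)"
    unfolding eigen_proj_def power_poly_def by (intro finsum_rdistr) auto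
  moreover have "\<dots> = (\<Oplus>j\<in>{..<N}. s (qroot N powi (2 * k)) \<otimes> ?a (Suc j))"
    unfolding shift ..
  moreover have "\<dots> = s (qroot N powi (2 * k)) \<otimes> (\<Oplus>j\<in>{..<N}. ?a (Suc j))"
    by (intro finsum_rdistr[symmetric]) auto
  ultimately show ?thesis
    unfolding eigen_proj_def power_poly_def by argo
qed

text \<open>Interchanging the sums, the coefficient of Y^j is an average of N-th roots of unity,
  which vanishes unless j = 0.\<close>

lemma eigen_proj_sum: "(\<Oplus>k\<in>{..<N}. eigen_proj N Y (int k)) = \<one>"
proof -
  obtain n where n: "N = Suc n"
    using N_pos by (cases N) auto
  have coeff: "(\<Sum>k<N. qroot N powi (- 2 * int k * int j) / of_nat N) = (if j = 0 then 1 else 0)"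
    if "j < N" for j
  proof -
    have "(\<Sum>k<N. qroot N powi (- 2 * int k * int j)) = (\<Sum>k<N. qroot N powi (2 * (- int j) * int k))"
      by (intro sum.cong refl arg_cong[where f = "power_int _"]) (simp add: algebra_simps)
    also have "\<dots> = (if j = 0 then of_nat N else 0)"
      using qroot_sum[OF odd, of "- int j"] that by (auto dest: zdvd_imp_le)
    finally show ?thesis
      using N_pos by (simp flip: sum_divide_distrib)
  qed
  have "(\<Oplus>k\<in>{..<N}. eigen_proj N Y (int k)) =
      power_poly N Y (\<lambda>j. \<Sum>k<N. qroot N powi (- 2 * int k * int j) / of_nat N)"
    unfolding eigen_proj_def by (rule power_poly_sum[symmetric]) simp
  also have "\<dots> = (\<Oplus>j\<in>{..<N}. if j = 0 then \<one> else \<zero>)"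
    unfolding power_poly_def
  proof (rule finsum_cong')
    fix j assume "j \<in> {..<N}"
    then have "(\<Sum>k<N. qroot N powi (- 2 * int k * int j) / of_nat N) = (if j = 0 then 1 else 0)"
      by (intro coeff) simp
    then show "s (\<Sum>k<N. qroot N powi (- 2 * int k * int j) / of_nat N) \<otimes> Y [^] j =
        (if j = 0 then \<one> else \<zero>)"
      by (simp only:) (simp add: s_one s_zero)
  qed auto
  also have "\<dots> = \<one>"
    using add.finprod_singleton[of 0 "{..<N}" "\<lambda>_. \<one>"] N_pos by (simp add: eq_commute)
  finally show ?thesis .
qed

text \<open>The substitute for comparing operators on an eigenbasis: the projections resolve the
  identity, so an element is determined by its products with them.\<close>

lemma eq_if_eq_on_eigen_proj:
  assumes "x \<in> carrier R" "y \<in> carrier R"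
    and "\<And>k. x \<otimes> eigen_proj N Y k = y \<otimes> eigen_proj N Y k"
  shows "x = y"
proof -
  have "x = x \<otimes> (\<Oplus>k\<in>{..<N}. eigen_proj N Y (int k))"
    using assms by (simp add: eigen_proj_sum)
  also have "\<dots> = (\<Oplus>k\<in>{..<N}. x \<otimes> eigen_proj N Y (int k))"
    using assms by (intro finsum_rdistr) auto
  also have "\<dots> = (\<Oplus>k\<in>{..<N}. y \<otimes> eigen_proj N Y (int k))"
    unfolding assms(3) ..
  also have "\<dots> = y \<otimes> (\<Oplus>k\<in>{..<N}. eigen_proj N Y (int k))"
    using assms by (intro finsum_rdistr[symmetric]) auto
  also have "\<dots> = y"
    using assms by (simp add: eigen_proj_sum)
  finally show ?thesis .
qed

lemma fourier_inversion:
  "(\<Sum>j<N. (\<Sum>k<N. \<Psi> (qroot N powi (2 * int k)) * qroot N powi (- 2 * int k * int j)) / of_nat N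
      * (qroot N powi (2 * l)) ^ j) = \<Psi> (qroot N powi (2 * l))" (is "?L = _")
proof -
  \<comment> \<open>The outer sum runs over 0..N-1 only, so the arbitrary integer \<open>l\<close>
    is replaced by its residue.\<close>
  define m where "m = nat (l mod int N)"
  have m: "m < N" "[int m = l] (mod int N)"
    using N_pos by (simp_all add: m_def cong_def nat_less_iff)
  have "?L = (\<Sum>j<N. \<Sum>k<N. \<Psi> (qroot N powi (2 * int k)) / of_nat N *
      (qroot N powi (2 * (l - int k) * int j)))"
  proof (intro sum.cong refl)
    fix j
    have 1: "(qroot N powi (2 * l)) ^ j = qroot N powi (2 * l * int j)"
      by (simp only: power_int_mult power_int_of_nat)
    have 2: "qroot N powi (2 * (l - int k) * int j) =
        qroot N powi (- 2 * int k * int j) * qroot N powi (2 * l * int j)" for k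
      by (simp add: power_int_add[symmetric] algebra_simps)
    show "(\<Sum>k<N. \<Psi> (qroot N powi (2 * int k)) * qroot N powi (- 2 * int k * int j)) / of_nat N
        * (qroot N powi (2 * l)) ^ j =
        (\<Sum>k<N. \<Psi> (qroot N powi (2 * int k)) / of_nat N *
          (qroot N powi (2 * (l - int k) * int j)))"
      unfolding 1 2 sum_divide_distrib sum_distrib_right by (simp add: mult_ac)
  qed
  also have "\<dots> = (\<Sum>k<N. \<Psi> (qroot N powi (2 * int k)) / of_nat N *
      (\<Sum>j<N. qroot N powi (2 * (l - int k) * int j)))"
    by (subst sum.swap) (simp add: sum_distrib_left)
  also have "\<dots> = (\<Sum>k<N. if k = m then \<Psi> (qroot N powi (2 * int k)) else 0)"
  proof (intro sum.cong refl)
    fix k assume "k \<in> {..<N}"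
    then have "k < N"
      by simp
    have "int N dvd l - int k \<longleftrightarrow> [l = int k] (mod int N)"
      by (simp add: cong_iff_dvd_diff)
    also have "\<dots> \<longleftrightarrow> [int m = int k] (mod int N)"
      using m(2) cong_trans cong_sym by blast
    also have "\<dots> \<longleftrightarrow> [m = k] (mod N)"
      by (simp add: cong_int_iff)
    also have "\<dots> \<longleftrightarrow> k = m"
      using m(1) \<open>k < N\<close> by (auto simp: cong_def)
    finally have "int N dvd l - int k \<longleftrightarrow> k = m" .
    then show "\<Psi> (qroot N powi (2 * int k)) / of_nat N *
        (\<Sum>j<N. qroot N powi (2 * (l - int k) * int j)) =
        (if k = m then \<Psi> (qroot N powi (2 * int k)) else 0)"
      unfolding qroot_sum[OF odd] using N_pos by auto
  qed
  also have "\<dots> = \<Psi> (qroot N powi (2 * int m))"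
    using m by simp
  also have "qroot N powi (2 * int m) = qroot N powi (2 * l)"
    using m(2) by (simp add: qroot_powi_eq_iff[OF odd])
  finally show ?thesis .
qed

lemma functional_calc_eigen:
  assumes "x \<in> carrier R" "Y \<otimes> x = s (qroot N powi (2 * l)) \<otimes> x"
  shows "functional_calc N Y \<Psi> \<otimes> x = s (\<Psi> (qroot N powi (2 * l))) \<otimes> x"
  unfolding functional_calc_def power_poly_eigen[OF assms] fourier_inversion ..

lemma functional_calc_eigen_proj:
  "functional_calc N Y \<Psi> \<otimes> eigen_proj N Y k = s (\<Psi> (qroot N powi (2 * k))) \<otimes> eigen_proj N Y k"
  by (intro functional_calc_eigen eigen_proj_closed eigen_proj_eigen)

text \<open>The inverse is the functional calculus of 1/C; both products with it are 1 on every
  projection. The second conclusion records how this inverse acts.\<close>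

lemma Units_if_eigen:
  assumes u: "u \<in> carrier R"
    and eig: "\<And>k. u \<otimes> eigen_proj N Y k = s (C (qroot N powi (2 * k))) \<otimes> eigen_proj N Y k"
    and nz: "\<And>k. C (qroot N powi (2 * k)) \<noteq> 0"
  shows "u \<in> Units R"
    and "inv u \<otimes> eigen_proj N Y k = s (inverse (C (qroot N powi (2 * k)))) \<otimes> eigen_proj N Y k"
proof -
  let ?v = "functional_calc N Y (\<lambda>z. inverse (C z))"
  have "u \<otimes> ?v = \<one>"
  proof (rule eq_if_eq_on_eigen_proj)
    fix k
    show "u \<otimes> ?v \<otimes> eigen_proj N Y k = \<one> \<otimes> eigen_proj N Y k"
      using eigen_mult[OF u functional_calc_closed eigen_proj_closed eig functional_calc_eigen_proj] nz[of k] u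
      by (simp add: s_one)
  qed (use u in auto)
  moreover have "?v \<otimes> u = \<one>"
  proof (rule eq_if_eq_on_eigen_proj)
    fix k
    show "?v \<otimes> u \<otimes> eigen_proj N Y k = \<one> \<otimes> eigen_proj N Y k"
      using eigen_mult[OF functional_calc_closed u eigen_proj_closed functional_calc_eigen_proj eig] nz[of k] u
      by (simp add: s_one)
  qed (use u in auto)
  ultimately have uv: "u \<otimes> ?v = \<one>" "?v \<otimes> u = \<one>"
    by auto
  then show "u \<in> Units R"
    using u unfolding Units_def by blast
  have "inv u = ?v"
    using uv u by (intro inv_char) auto
  then show "inv u \<otimes> eigen_proj N Y k = s (inverse (C (qroot N powi (2 * k)))) \<otimes> eigen_proj N Y k"
    by (simp add: functional_calc_eigen_proj)
qed

end

end

section \<open>Conjugation by the dilogarithm\<close>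

text \<open>A telescoping product. With r = q^(2(k-j)+1), the j-th factor is the inverse of (b + a
  r)/(a r), and b + a r is the ratio of f(k-j+1) to f(k-j). Each factor thus lowers the argument of
  f by one and leaves a r; the exponents of the r add up to 2kn - n^2.\<close>

lemma dilog_ratio_pos:
  fixes f :: "int \<Rightarrow> complex"
  assumes rec: "\<And>k. f (k + 1) = (b + a * qroot N powi (2 * k + 1)) * f k"
    and nz: "\<And>k. f k \<noteq> 0" and ab: "a \<noteq> 0" "b \<noteq> 0"
  shows "prod_list (map (\<lambda>j. inverse (1 + qroot N ^ (2 * j - 1) * inverse (a / b * qroot N powi (2 * k))))
           [1..<Suc n]) * f k = f (k - int n) * (a ^ n * qroot N powi (2 * k * int n - (int n)\<^sup>2))"
proof (induction n)
  case (Suc n)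
  let ?q = "qroot N" and ?m = "k - int n - 1"
  let ?P = "prod_list (map (\<lambda>j. inverse (1 + ?q ^ (2 * j - 1) * inverse (a / b * ?q powi (2 * k)))) [1..<Suc n])"
  define r where "r = ?q powi (2 * ?m + 1)"
  have r: "?q ^ (2 * Suc n - 1) * inverse (?q powi (2 * k)) = inverse r"
  proof -
    have "?q ^ (2 * Suc n - 1) = ?q powi (2 * int n + 1)"
      by (simp add: power_int_add power_int_mult power_mult)
    then show ?thesis
      by (simp add: r_def power_int_add[symmetric] power_int_minus[symmetric] algebra_simps)
  qed
  have rnz: "r \<noteq> 0"
    by (simp add: r_def)
  have f: "f (k - int n) = (b + a * r) * f ?m"
    using rec[of ?m] by (simp add: r_def)
  then have "b + a * r \<noteq> 0"
    using nz[of "k - int n"] by auto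
  then have step: "inverse (1 + ?q ^ (2 * Suc n - 1) * inverse (a / b * ?q powi (2 * k))) * f (k - int n) =
      f ?m * (a * r)"
  proof -
    have "1 + ?q ^ (2 * Suc n - 1) * inverse (a / b * ?q powi (2 * k)) =
        1 + (?q ^ (2 * Suc n - 1) * inverse (?q powi (2 * k))) * (b / a)"
      by (simp add: field_simps)
    also have "\<dots> = (b + a * r) / (a * r)"
      unfolding r using ab rnz by (simp add: field_simps)
    finally show ?thesis
      unfolding f using ab rnz \<open>b + a * r \<noteq> 0\<close> by simp
  qed
  have "prod_list (map (\<lambda>j. inverse (1 + ?q ^ (2 * j - 1) * inverse (a / b * ?q powi (2 * k)))) [1..<Suc (Suc n)]) * f k
      = inverse (1 + ?q ^ (2 * Suc n - 1) * inverse (a / b * ?q powi (2 * k))) * (?P * f k)"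
    by (simp add: mult_ac)
  also have "\<dots> = inverse (1 + ?q ^ (2 * Suc n - 1) * inverse (a / b * ?q powi (2 * k))) * f (k - int n) *
      (a ^ n * ?q powi (2 * k * int n - (int n)\<^sup>2))"
    unfolding Suc.IH by (simp only: mult_ac)
  also have "\<dots> = f ?m * (a ^ Suc n * (r * ?q powi (2 * k * int n - (int n)\<^sup>2)))"
    unfolding step by (simp add: mult_ac)
  also have "r * ?q powi (2 * k * int n - (int n)\<^sup>2) = ?q powi (2 * k * int (Suc n) - (int (Suc n))\<^sup>2)"
    by (simp add: r_def power_int_add[symmetric] power2_eq_square algebra_simps)
  finally show ?case
    by (simp add: algebra_simps)
qed simp

text \<open>Here each factor is (b + a r)/b with r = q^(2(k+j-1)+1). The argument of f moves upwards
  and only a power of b remains, with no power of q.\<close>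

lemma dilog_ratio_neg:
  fixes f :: "int \<Rightarrow> complex"
  assumes rec: "\<And>k. f (k + 1) = (b + a * qroot N powi (2 * k + 1)) * f k"
    and b: "b \<noteq> 0"
  shows "prod_list (map (\<lambda>j. 1 + qroot N ^ (2 * j - 1) * (a / b * qroot N powi (2 * k))) [1..<Suc n]) * f k =
           f (k + int n) * inverse (b ^ n)"
proof (induction n)
  case (Suc n)
  let ?q = "qroot N"
  let ?P = "prod_list (map (\<lambda>j. 1 + ?q ^ (2 * j - 1) * (a / b * ?q powi (2 * k))) [1..<Suc n])"
  define r where "r = ?q powi (2 * (k + int n) + 1)"
  have r: "?q ^ (2 * Suc n - 1) * ?q powi (2 * k) = r"
  proof -
    have "?q ^ (2 * Suc n - 1) = ?q powi (2 * int n + 1)"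
      by (simp add: power_int_add power_int_mult power_mult)
    then show ?thesis
      by (simp add: r_def power_int_add[symmetric] algebra_simps)
  qed
  have f: "f (k + int (Suc n)) = (b + a * r) * f (k + int n)"
    using rec[of "k + int n"] by (simp add: r_def algebra_simps)
  have "prod_list (map (\<lambda>j. 1 + ?q ^ (2 * j - 1) * (a / b * ?q powi (2 * k))) [1..<Suc (Suc n)]) * f k
      = (1 + ?q ^ (2 * Suc n - 1) * (a / b * ?q powi (2 * k))) * (?P * f k)"
    by (simp add: mult_ac)
  also have "\<dots> = (1 + (?q ^ (2 * Suc n - 1) * ?q powi (2 * k)) * (a / b)) * (f (k + int n) * inverse (b ^ n))"
    unfolding Suc.IH by (simp only: mult_ac times_divide_eq_right)
  also have "\<dots> = f (k + int (Suc n)) * inverse (b ^ Suc n)"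
    unfolding r f using b by (simp add: field_simps)
  finally show ?case .
qed simp

context scalar_ring
begin

context
  fixes N :: nat and Y :: 'a
  assumes odd: "odd N" and Y [simp, intro]: "Y \<in> carrier R" and Y_pow: "Y [^] N = \<one>"
begin

private abbreviation "E \<equiv> eigen_proj N Y"

lemmas [simp, intro] = eigen_proj_closed[OF odd Y Y_pow] functional_calc_closed[OF odd Y Y_pow]

lemma foldr_eigen:
  assumes "\<And>j. j \<in> set js \<Longrightarrow> h j \<in> carrier R"
    and "\<And>j. j \<in> set js \<Longrightarrow> h j \<otimes> E k = s (d j) \<otimes> E k"
  shows "foldr (\<lambda>j x. h j \<otimes> x) js \<one> \<in> carrier R"
    and "foldr (\<lambda>j x. h j \<otimes> x) js \<one> \<otimes> E k = s (prod_list (map d js)) \<otimes> E k"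
proof -
  have "foldr (\<lambda>j x. h j \<otimes> x) js \<one> \<in> carrier R \<and>
      foldr (\<lambda>j x. h j \<otimes> x) js \<one> \<otimes> E k = s (prod_list (map d js)) \<otimes> E k"
    using assms
  proof (induction js)
    case Nil
    then show ?case
      by (simp add: s_one)
  next
    case (Cons j js)
    then show ?case
      using eigen_mult[of "h j" "foldr (\<lambda>j x. h j \<otimes> x) js \<one>" "E k"] by simp
  qed
  then show "foldr (\<lambda>j x. h j \<otimes> x) js \<one> \<in> carrier R"
    "foldr (\<lambda>j x. h j \<otimes> x) js \<one> \<otimes> E k = s (prod_list (map d js)) \<otimes> E k"
    by auto
qed

lemma functional_calc_Units:
  assumes "\<And>k. \<Psi> (qroot N powi (2 * k)) \<noteq> 0"
  shows "functional_calc N Y \<Psi> \<in> Units R"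
  by (rule Units_if_eigen(1)[OF odd Y Y_pow _ functional_calc_eigen_proj[OF odd Y Y_pow]])
    (use assms in auto)

text \<open>Left multiplication by X carries the part of eigenvalue q^(2k) into that of eigenvalue
  q^(2(k-e)). Conjugating X by \<Psi>(Y) therefore produces the ratio of \<Psi> at these two
  points.\<close>

lemma mult_eigen_proj:
  assumes X: "X \<in> carrier R" and comm: "Y \<otimes> X = s (qroot N powi (- 2 * e)) \<otimes> (X \<otimes> Y)"
  shows "Y \<otimes> (X \<otimes> E k) = s (qroot N powi (2 * (k - e))) \<otimes> (X \<otimes> E k)"
proof -
  have "Y \<otimes> (X \<otimes> E k) = s (qroot N powi (- 2 * e)) \<otimes> (X \<otimes> Y) \<otimes> E k"
    using X by (simp add: comm flip: m_assoc)
  also have "\<dots> = s (qroot N powi (- 2 * e)) \<otimes> (X \<otimes> (Y \<otimes> E k))"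
    using X by (simp add: m_assoc)
  also have "\<dots> = s (qroot N powi (- 2 * e)) \<otimes> (s (qroot N powi (2 * k)) \<otimes> (X \<otimes> E k))"
    unfolding eigen_proj_eigen[OF odd Y Y_pow] by (subst s_prod_lcomm) (use X in auto)
  also have "\<dots> = s (qroot N powi (- 2 * e) * qroot N powi (2 * k)) \<otimes> (X \<otimes> E k)"
    using X by (intro s_s) auto
  also have "qroot N powi (- 2 * e) * qroot N powi (2 * k) = qroot N powi (2 * (k - e))"
    by (simp add: power_int_add[symmetric] algebra_simps)
  finally show ?thesis .
qed

text \<open>Multiplied from the right by F = \<Psi>(Y) and by a projection, the identity becomes
  scalar: if G acts on the k-th part by d, then d f(k) must equal f(k-e) times the scalar factor and
  q^(2kc). This is \<open>dilog_ratio_pos\<close> or \<open>dilog_ratio_neg\<close>. For positive e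
  the factors contain the inverse of Y and clearing denominators leaves a^e q^(-c^2) Y^c; for
  negative e only b^e is left and c = 0.\<close>

lemma
  fixes e :: int and a b :: complex
  defines "c \<equiv> nat e"
  defines "G \<equiv> foldr (\<lambda>j x. (\<one> \<oplus> s (qroot N ^ (2 * j - 1)) \<otimes> ((s (a / b) \<otimes> Y) [^] (- sgn e))) [^] (- sgn e) \<otimes> x)
      [1..<Suc (nat \<bar>e\<bar>)] \<one>"
  assumes X: "X \<in> carrier R" and comm: "Y \<otimes> X = s (qroot N powi (- 2 * e)) \<otimes> (X \<otimes> Y)"
    and ab: "a \<noteq> 0" "b \<noteq> 0"
    and rec: "\<And>k. \<Psi> (qroot N powi (2 * (k + 1))) = (b + a * qroot N powi (2 * k + 1)) * \<Psi> (qroot N powi (2 * k))"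
    and nz: "\<And>k. \<Psi> (qroot N powi (2 * k)) \<noteq> 0"
  shows dilog_product_closed: "G \<in> carrier R" and dilog_conjugation: "X \<otimes> G = functional_calc N Y \<Psi> \<otimes>
      (s ((if e \<ge> 0 then a else b) powi e * qroot N powi (- (int c)\<^sup>2)) \<otimes> (X \<otimes> Y [^] c)) \<otimes>
      inv (functional_calc N Y \<Psi>)"
proof -
  let ?q = "qroot N" and ?F = "functional_calc N Y \<Psi>" and ?y = "s (a / b) \<otimes> Y"
  let ?t = "(if e \<ge> 0 then a else b) powi e * ?q powi (- (int c)\<^sup>2)"
  define f where "f k = \<Psi> (?q powi (2 * k))" for k
  have f_rec: "f (k + 1) = (b + a * ?q powi (2 * k + 1)) * f k" for k
    unfolding f_def by (rule rec)
  have f_nz: "f k \<noteq> 0" for k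
    unfolding f_def by (rule nz)
  have fac: "b + a * ?q powi (2 * k + 1) \<noteq> 0" for k
    using f_rec[of k] f_nz[of "k + 1"] by auto
  have y: "?y \<in> carrier R"
    by simp
  have y_eig: "?y \<otimes> E k = s (a / b * ?q powi (2 * k)) \<otimes> E k" for k
    by (rule eigen_mult) (simp_all add: eigen_proj_eigen[OF odd Y Y_pow])
  have one_plus: "\<one> \<oplus> s c \<otimes> u \<in> carrier R"
      "(\<one> \<oplus> s c \<otimes> u) \<otimes> E k = s (1 + c * r) \<otimes> E k"
    if "u \<in> carrier R" "u \<otimes> E k = s r \<otimes> E k" for u c r k
  proof -
    have "s c \<otimes> u \<otimes> E k = s (c * r) \<otimes> E k"
      by (rule eigen_mult) (use that in auto)
    then show "(\<one> \<oplus> s c \<otimes> u) \<otimes> E k = s (1 + c * r) \<otimes> E k"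
      using that by (simp add: l_distr s_add s_one)
  qed (use that in auto)
  have G: "G \<in> carrier R \<and> (\<exists>d. G \<otimes> E k = s d \<otimes> E k \<and>
      d * f k = f (k - e) * (?t * (?q powi (2 * k)) ^ c))" for k
  proof (cases "e \<ge> 0")
    case True
    then consider "e = 0" | "e > 0" by linarith
    then show ?thesis
    proof cases
      case 1
      then show ?thesis
        by (intro conjI exI[of _ 1]) (simp_all add: G_def c_def s_one)
    next
      case 2
      define h where "h j = inv (\<one> \<oplus> s (?q ^ (2 * j - 1)) \<otimes> inv ?y)" for j
      define d where "d j k = inverse (1 + ?q ^ (2 * j - 1) * inverse (a / b * ?q powi (2 * k)))" for j k
      have yU: "?y \<in> Units R" "inv ?y \<otimes> E k = s (inverse (a / b * ?q powi (2 * k))) \<otimes> E k" for k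
        using Units_if_eigen[OF odd Y Y_pow y, of "\<lambda>z. a / b * z"] y_eig ab by auto
      \<comment> \<open>The bound \<open>j \<ge> 1\<close> matters: for \<open>j = 0\<close> the
        truncated subtraction in \<open>2 * j - 1\<close> would give exponent 0 instead of
        -1.\<close>
      have h: "\<one> \<oplus> s (?q ^ (2 * j - 1)) \<otimes> inv ?y \<in> Units R"
        "h j \<otimes> E k = s (d j k) \<otimes> E k" if "j \<ge> 1" for j k
      proof -
        let ?C = "\<lambda>z. 1 + ?q ^ (2 * j - 1) * inverse (a / b * z)"
        let ?u = "\<one> \<oplus> s (?q ^ (2 * j - 1)) \<otimes> inv ?y"
        \<comment> \<open>After multiplication by a r this eigenvalue becomes a factor of the
          recursion for \<open>f\<close>, which cannot vanish because \<open>f\<close> has no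
          zeros.\<close>
        have C: "?C (?q powi (2 * k)) \<noteq> 0" for k
        proof -
          define r where "r = ?q powi (2 * (k - int j) + 1)"
          have "?q ^ (2 * j - 1) = ?q powi (2 * int j - 1)"
            using that by (simp add: of_nat_diff flip: power_int_of_nat)
          then have "?q ^ (2 * j - 1) * inverse (?q powi (2 * k)) = inverse r"
            by (simp add: r_def power_int_add[symmetric] power_int_minus[symmetric] algebra_simps)
          then have "?C (?q powi (2 * k)) = 1 + inverse r * (b / a)"
            by (simp add: field_simps)
          moreover have "r \<noteq> 0"
            by (simp add: r_def)
          ultimately have "?C (?q powi (2 * k)) * (a * r) = b + a * r"
            using ab by (simp add: field_simps)
          then show ?thesis
            using fac[of "k - int j"] by (auto simp: r_def)
        qed
        have u: "?u \<in> carrier R" "?u \<otimes> E k = s (?C (?q powi (2 * k))) \<otimes> E k" for k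
          by (rule one_plus[OF Units_inv_closed[OF yU(1)] yU(2)])+
        show "?u \<in> Units R" "h j \<otimes> E k = s (d j k) \<otimes> E k"
          unfolding h_def d_def using Units_if_eigen[OF odd Y Y_pow u(1), of ?C] u(2) C by auto
      qed
      have G_eq: "G = foldr (\<lambda>j x. h j \<otimes> x) [1..<Suc c] \<one>"
      proof -
        have "(\<one> \<oplus> s (?q ^ (2 * j - 1)) \<otimes> (?y [^] (- sgn e))) [^] (- sgn e) = h j" if "j \<ge> 1" for j
          using 2 yU(1) h(1)[OF that] Units_closed[OF h(1)[OF that]]
          by (simp add: int_pow_def2 h_def)
        then show ?thesis
          unfolding G_def c_def using 2 by (intro foldr_cong) auto
      qed
      have cl: "h j \<in> carrier R" if "j \<ge> 1" for j
        unfolding h_def by (rule Units_inv_closed[OF h(1)[OF that]])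
      have "prod_list (map (\<lambda>j. d j k) [1..<Suc c]) * f k = f (k - e) * (?t * (?q powi (2 * k)) ^ c)"
      proof -
        have "int c = e"
          using 2 by (simp add: c_def)
        moreover have "(?q powi (2 * k)) ^ c = ?q powi (2 * k * int c)"
          by (simp only: power_int_mult power_int_of_nat)
        moreover have "?q powi (2 * k * int c - (int c)\<^sup>2) = ?q powi (- (int c)\<^sup>2) * ?q powi (2 * k * int c)"
          by (simp add: power_int_add[symmetric] algebra_simps)
        moreover have "a powi e = a ^ c"
          using 2 by (simp add: power_int_def c_def)
        ultimately show ?thesis
          using dilog_ratio_pos[of f b a N k c, OF f_rec f_nz ab] 2 by (simp add: d_def mult_ac)
      qed
      moreover have "foldr (\<lambda>j x. h j \<otimes> x) [1..<Suc c] \<one> \<in> carrier R"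
        "foldr (\<lambda>j x. h j \<otimes> x) [1..<Suc c] \<one> \<otimes> E k = s (prod_list (map (\<lambda>j. d j k) [1..<Suc c])) \<otimes> E k"
        by (rule foldr_eigen[where k = k]; use cl h(2) in force)+
      ultimately show ?thesis
        unfolding G_eq by blast
    qed
  next
    case False
    define n where "n = nat (- e)"
    define h where "h j = \<one> \<oplus> s (?q ^ (2 * j - 1)) \<otimes> ?y" for j
    define d where "d j k = 1 + ?q ^ (2 * j - 1) * (a / b * ?q powi (2 * k))" for j k
    have h: "h j \<in> carrier R" "h j \<otimes> E k = s (d j k) \<otimes> E k" for j k
      unfolding h_def d_def by (rule one_plus[OF y y_eig])+
    have G_eq: "G = foldr (\<lambda>j x. h j \<otimes> x) [1..<Suc n] \<one>"
    proof -
      have "(\<one> \<oplus> s (?q ^ (2 * j - 1)) \<otimes> (?y [^] (- sgn e))) [^] (- sgn e) = h j" for j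
        using False h(1)[of j] y by (simp add: int_pow_def2 h_def)
      then show ?thesis
        unfolding G_def n_def using False by (intro foldr_cong) auto
    qed
    have "prod_list (map (\<lambda>j. d j k) [1..<Suc n]) * f k = f (k - e) * (?t * (?q powi (2 * k)) ^ c)"
    proof -
      have "e = - int n" "c = 0"
        using False by (simp_all add: n_def c_def)
      then show ?thesis
        using dilog_ratio_neg[of f b a N k n, OF f_rec ab(2)] False
        by (simp add: d_def power_int_minus)
    qed
    moreover have "foldr (\<lambda>j x. h j \<otimes> x) [1..<Suc n] \<one> \<in> carrier R"
        "foldr (\<lambda>j x. h j \<otimes> x) [1..<Suc n] \<one> \<otimes> E k = s (prod_list (map (\<lambda>j. d j k) [1..<Suc n])) \<otimes> E k"
        by (rule foldr_eigen[where k = k]; use h in force)+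
      ultimately show ?thesis
        unfolding G_eq by blast
  qed
  show Gc: "G \<in> carrier R"
    using G by blast
  have FU: "?F \<in> Units R"
    by (rule functional_calc_Units) (rule nz)
  \<comment> \<open>The inverse of \<open>?F\<close> is moved to the other side, so that every
    factor acts on the projections by a known scalar.\<close>
  have "X \<otimes> G \<otimes> ?F = ?F \<otimes> (s ?t \<otimes> (X \<otimes> Y [^] c))"
  proof (rule eq_if_eq_on_eigen_proj[OF odd Y Y_pow])
    fix k
    obtain d where d: "G \<otimes> E k = s d \<otimes> E k" "d * f k = f (k - e) * (?t * (?q powi (2 * k)) ^ c)"
      using G[of k] by blast
    have x: "X \<otimes> E k \<in> carrier R"
      using X by simp
    have "G \<otimes> ?F \<otimes> E k = s (d * f k) \<otimes> E k"
      by (rule eigen_mult)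
        (use Gc d(1) in \<open>auto simp: f_def functional_calc_eigen_proj[OF odd Y Y_pow]\<close>)
    then have "X \<otimes> G \<otimes> ?F \<otimes> E k = X \<otimes> (s (d * f k) \<otimes> E k)"
      using X Gc by (simp add: m_assoc)
    also have "\<dots> = s (d * f k) \<otimes> (X \<otimes> E k)"
      by (rule s_prod_lcomm) (use X in auto)
    finally have lhs: "X \<otimes> G \<otimes> ?F \<otimes> E k = s (d * f k) \<otimes> (X \<otimes> E k)" .
    have Yc: "Y [^] c \<otimes> E k = s ((?q powi (2 * k)) ^ c) \<otimes> E k"
    proof (induction c)
      case (Suc c)
      have "Y [^] c \<otimes> Y \<otimes> E k = s ((?q powi (2 * k)) ^ c * ?q powi (2 * k)) \<otimes> E k"
        by (rule eigen_mult) (use Suc in \<open>auto simp: eigen_proj_eigen[OF odd Y Y_pow]\<close>)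
      then show ?case
        by (simp add: mult.commute)
    qed (simp add: s_one)
    have "?F \<otimes> (s ?t \<otimes> (X \<otimes> Y [^] c)) \<otimes> E k = ?F \<otimes> (s ?t \<otimes> (X \<otimes> (Y [^] c \<otimes> E k)))"
      using X by (simp add: m_assoc)
    also have "X \<otimes> (Y [^] c \<otimes> E k) = s ((?q powi (2 * k)) ^ c) \<otimes> (X \<otimes> E k)"
      unfolding Yc by (rule s_prod_lcomm) (use X in auto)
    also have "s ?t \<otimes> \<dots> = s (?t * (?q powi (2 * k)) ^ c) \<otimes> (X \<otimes> E k)"
      by (rule s_s[OF x])
    also have "?F \<otimes> \<dots> = s (?t * (?q powi (2 * k)) ^ c) \<otimes> (?F \<otimes> (X \<otimes> E k))"
      by (rule s_prod_lcomm) (use x in auto)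
    also have "?F \<otimes> (X \<otimes> E k) = s (f (k - e)) \<otimes> (X \<otimes> E k)"
      unfolding f_def
      by (rule functional_calc_eigen[OF odd Y Y_pow x mult_eigen_proj[OF X comm]])
    also have "s (?t * (?q powi (2 * k)) ^ c) \<otimes> \<dots> =
        s (?t * (?q powi (2 * k)) ^ c * f (k - e)) \<otimes> (X \<otimes> E k)"
      by (rule s_s[OF x])
    also have "?t * (?q powi (2 * k)) ^ c * f (k - e) = d * f k"
      unfolding d(2) by (simp only: mult_ac)
    finally show "X \<otimes> G \<otimes> ?F \<otimes> E k = ?F \<otimes> (s ?t \<otimes> (X \<otimes> Y [^] c)) \<otimes> E k"
      unfolding lhs by (rule sym)
  qed (use X Gc in auto)
  then have "?F \<otimes> (s ?t \<otimes> (X \<otimes> Y [^] c)) \<otimes> inv ?F = X \<otimes> G \<otimes> ?F \<otimes> inv ?F"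
    by (simp only:)
  also have "\<dots> = X \<otimes> G"
    using X Gc FU by (simp add: m_assoc)
  finally show "X \<otimes> G = ?F \<otimes> (s ?t \<otimes> (X \<otimes> Y [^] c)) \<otimes> inv ?F"
    by (rule sym)
qed

end

end

section \<open>Solutions of the Chekhov--Fock relations\<close>

lemma ring_hom_Units:
  assumes "ring R" "ring R'" "h \<in> Ring.ring_hom R R'" "x \<in> Units R"
  shows "h x \<in> Units R'" "h (inv\<^bsub>R\<^esub> x) = inv\<^bsub>R'\<^esub> (h x)"
proof -
  interpret R: ring R by fact
  interpret R': ring R' by fact
  interpret h: ring_hom_ring R R' h
    by (rule ring_hom_ringI2[OF assms(1-3)])
  have x: "x \<in> carrier R" "inv\<^bsub>R\<^esub> x \<in> carrier R"
    using assms(4) by auto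
  have "h x \<otimes>\<^bsub>R'\<^esub> h (inv\<^bsub>R\<^esub> x) = \<one>\<^bsub>R'\<^esub>" "h (inv\<^bsub>R\<^esub> x) \<otimes>\<^bsub>R'\<^esub> h x = \<one>\<^bsub>R'\<^esub>"
    using assms(4) x by (simp_all flip: h.hom_mult)
  then show "h x \<in> Units R'" "h (inv\<^bsub>R\<^esub> x) = inv\<^bsub>R'\<^esub> (h x)"
    using x R'.inv_char[of "h x" "h (inv\<^bsub>R\<^esub> x)"] by (auto simp: Units_def)
qed

lemma ring_hom_nat_pow:
  assumes "ring R" "ring R'" "h \<in> Ring.ring_hom R R'" "x \<in> carrier R"
  shows "h (x [^]\<^bsub>R\<^esub> (n::nat)) = h x [^]\<^bsub>R'\<^esub> n"
proof -
  interpret h: ring_hom_ring R R' h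
    by (rule ring_hom_ringI2[OF assms(1-3)])
  show ?thesis
    using assms(4) by (rule h.hom_nat_pow)
qed

lemma ring_hom_functional_calc:
  assumes "scalar_ring R s" "scalar_ring R' s'" "h \<in> Ring.ring_hom R R'" "\<And>c. h (s c) = s' c"
    and Y: "Y \<in> carrier R"
  shows "h (scalar_ring.functional_calc R s N Y \<Psi>) = scalar_ring.functional_calc R' s' N (h Y) \<Psi>"
proof -
  interpret R: scalar_ring R s by fact
  interpret R': scalar_ring R' s' by fact
  interpret h: ring_hom_ring R R' h
    by (rule ring_hom_ringI2[OF R.ring_axioms R'.ring_axioms assms(3)])
  have hsum: "finite A \<Longrightarrow> k \<in> A \<rightarrow> carrier R \<Longrightarrow>
      h (\<Oplus>\<^bsub>R\<^esub>i\<in>A. k i) = (\<Oplus>\<^bsub>R'\<^esub>i\<in>A. h (k i))" for A :: "nat set" and k :: "nat \<Rightarrow> 'a"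
    by (induction A rule: finite_induct) (auto simp: Pi_def)
  have "h (R.power_poly N Y c) = R'.power_poly N (h Y) c" for c
    unfolding R.power_poly_def R'.power_poly_def using Y
    by (subst hsum) (auto intro!: R'.finsum_cong' simp: assms(4) h.hom_nat_pow)
  then show ?thesis
    by (simp add: R.functional_calc_def R'.functional_calc_def)
qed

text \<open>The points of the presentation of \<open>CF\<close> with values in R. Keeping R
  arbitrary allows the same relations to be stated in \<open>CF\<close> of another triangulation and
  among operators.\<close>

definition CF_solution ::
  "('a, 'b) ring_scheme \<Rightarrow> (complex \<Rightarrow> 'a) \<Rightarrow> nat \<Rightarrow> 's coeff \<Rightarrow> ('v::finite, 's) dotted \<Rightarrow> ('s set \<Rightarrow> 'a) \<Rightarrow> bool"
  where
  "CF_solution R s N p \<tau> g \<longleftrightarrow> (\<forall>\<alpha>\<in>edges \<tau>.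
     g \<alpha> \<in> Units R \<and> g \<alpha> [^]\<^bsub>R\<^esub> N = s (gen_scale p \<tau> \<alpha> ^ N) \<and>
     (\<forall>\<beta>\<in>edges \<tau>. g \<alpha> \<otimes>\<^bsub>R\<^esub> g \<beta> = s (qroot N powi (2 * eps \<tau> \<alpha> \<beta>)) \<otimes>\<^bsub>R\<^esub> (g \<beta> \<otimes>\<^bsub>R\<^esub> g \<alpha>)))"

text \<open>Applied to conjugations, this gives the relations for conjugated families without
  computing with them.\<close>

lemma CF_solution_hom:
  assumes R: "scalar_ring R s" "scalar_ring R' s'" and h: "h \<in> Ring.ring_hom R R'" "\<And>c. h (s c) = s' c"
    and g: "CF_solution R s N p \<tau> g" and g': "\<And>\<alpha>. \<alpha> \<in> edges \<tau> \<Longrightarrow> g' \<alpha> = h (g \<alpha>)"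
  shows "CF_solution R' s' N p \<tau> g'"
proof -
  interpret R: scalar_ring R s by fact
  interpret R': scalar_ring R' s' by fact
  interpret h: ring_hom_ring R R' h
    by (rule ring_hom_ringI2[OF R.ring_axioms R'.ring_axioms h(1)])
  have unit: "g \<alpha> \<in> Units R" and pow: "g \<alpha> [^]\<^bsub>R\<^esub> N = s (gen_scale p \<tau> \<alpha> ^ N)"
    if "\<alpha> \<in> edges \<tau>" for \<alpha>
    using g that unfolding CF_solution_def by blast+
  have cl: "g \<alpha> \<in> carrier R" if "\<alpha> \<in> edges \<tau>" for \<alpha>
    by (rule R.Units_closed[OF unit[OF that]])
  show ?thesis
    unfolding CF_solution_def
  proof (intro ballI conjI)
    fix \<alpha> assume \<alpha>: "\<alpha> \<in> edges \<tau>"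
    show "g' \<alpha> \<in> Units R'"
      unfolding g'[OF \<alpha>] by (rule ring_hom_Units(1)[OF R.ring_axioms R'.ring_axioms h(1) unit[OF \<alpha>]])
    show "g' \<alpha> [^]\<^bsub>R'\<^esub> N = s' (gen_scale p \<tau> \<alpha> ^ N)"
      unfolding g'[OF \<alpha>] h.hom_nat_pow[OF cl[OF \<alpha>], symmetric] pow[OF \<alpha>] by (rule h(2))
    fix \<beta> assume \<beta>: "\<beta> \<in> edges \<tau>"
    let ?r = "qroot N powi (2 * eps \<tau> \<alpha> \<beta>)"
    have "h (g \<alpha> \<otimes>\<^bsub>R\<^esub> g \<beta>) = h (s ?r \<otimes>\<^bsub>R\<^esub> (g \<beta> \<otimes>\<^bsub>R\<^esub> g \<alpha>))"
      by (rule arg_cong[where f = h]) (use g \<alpha> \<beta> in \<open>unfold CF_solution_def, blast\<close>)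
    then show "g' \<alpha> \<otimes>\<^bsub>R'\<^esub> g' \<beta> = s' ?r \<otimes>\<^bsub>R'\<^esub> (g' \<beta> \<otimes>\<^bsub>R'\<^esub> g' \<alpha>)"
      unfolding g'[OF \<alpha>] g'[OF \<beta>] h(2)[symmetric]
      using cl[OF \<alpha>] cl[OF \<beta>] by (simp only: h.hom_mult R.m_closed R.s_closed)
  qed
qed

lemma CF_solution_induced_hom:
  fixes R (structure)
  assumes "scalar_ring R s" and g: "CF_solution R s N p \<tau> g"
  shows "f \<in> carrier (free_algebra (edges \<tau>)) \<Longrightarrow> induced_hom R s g (CF_class N p \<tau> f) = free_eval R s g f"
    and "induced_hom R s g \<in> Ring.ring_hom (CF N p \<tau>) R"
    and "induced_hom R s g (CF_scalar N p \<tau> c) = s c"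
    and "\<alpha> \<in> edges \<tau> \<Longrightarrow> induced_hom R s g (CF_gen N p \<tau> \<alpha>) = g \<alpha>"
proof -
  interpret scalar_ring R s by fact
  have *: "\<And>\<alpha>. \<alpha> \<in> edges \<tau> \<Longrightarrow> g \<alpha> \<in> Units R"
    "\<And>\<alpha> \<beta>. \<alpha> \<in> edges \<tau> \<Longrightarrow> \<beta> \<in> edges \<tau> \<Longrightarrow>
      g \<alpha> \<otimes> g \<beta> = s (qroot N powi (2 * eps \<tau> \<alpha> \<beta>)) \<otimes> (g \<beta> \<otimes> g \<alpha>)"
    "\<And>\<alpha>. \<alpha> \<in> edges \<tau> \<Longrightarrow> g \<alpha> [^] N = s (gen_scale p \<tau> \<alpha> ^ N)"
    using g unfolding CF_solution_def by blast+
  show "f \<in> carrier (free_algebra (edges \<tau>)) \<Longrightarrow> induced_hom R s g (CF_class N p \<tau> f) = free_eval R s g f"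
    by (rule induced_hom_CF[OF *])
  show "induced_hom R s g \<in> Ring.ring_hom (CF N p \<tau>) R"
    by (rule induced_hom_CF_hom(1)[OF *])
  show "induced_hom R s g (CF_scalar N p \<tau> c) = s c"
    by (rule induced_hom_CF_hom(2)[OF *])
  show "\<alpha> \<in> edges \<tau> \<Longrightarrow> induced_hom R s g (CF_gen N p \<tau> \<alpha>) = g \<alpha>"
    by (rule induced_hom_CF_hom(3)[OF *])
qed

context scalar_ring
begin

lemma s_mult_pow:
  assumes "x \<in> carrier R"
  shows "(s c \<otimes> x) [^] (n::nat) = s (c ^ n) \<otimes> x [^] n"
proof (induction n)
  case (Suc n)
  have "(s c \<otimes> x) [^] Suc n = (s (c ^ n) \<otimes> x [^] n) \<otimes> (s c \<otimes> x)"
    by (simp add: Suc)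
  also have "\<dots> = (s (c ^ n) \<otimes> s c) \<otimes> (x [^] n \<otimes> x)"
    by (rule s_mult_mult[symmetric]) (use assms in auto)
  finally show ?case
    using assms by (simp add: mult.commute flip: s_mult)
qed (simp add: s_one)

lemma conj_hom:
  assumes P: "P \<in> Units R"
  shows "(\<lambda>x. P \<otimes> x \<otimes> inv P) \<in> Ring.ring_hom R R" "P \<otimes> s c \<otimes> inv P = s c"
proof -
  have P': "P \<in> carrier R" "inv P \<in> carrier R"
    using P by auto
  show s: "P \<otimes> s c \<otimes> inv P = s c" for c
  proof -
    have "P \<otimes> s c \<otimes> inv P = s c \<otimes> (P \<otimes> inv P)"
      unfolding s_comm[OF P'(1)] using P' by (simp add: m_assoc)
    then show ?thesis
      using P by simp
  qed
  show "(\<lambda>x. P \<otimes> x \<otimes> inv P) \<in> Ring.ring_hom R R"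
  proof (rule ring_hom_memI)
    fix x y assume xy: "x \<in> carrier R" "y \<in> carrier R"
    have "P \<otimes> x \<otimes> inv P \<otimes> (P \<otimes> y \<otimes> inv P) = P \<otimes> x \<otimes> (inv P \<otimes> P) \<otimes> y \<otimes> inv P"
      using xy P' by (simp only: m_assoc m_closed)
    then show "P \<otimes> (x \<otimes> y) \<otimes> inv P = P \<otimes> x \<otimes> inv P \<otimes> (P \<otimes> y \<otimes> inv P)"
      using xy P P' by (simp add: m_assoc)
  qed (use P P' s[of 1] in \<open>auto simp: l_distr r_distr s_one\<close>)
qed

text \<open>The exponent is carried as an integer argument, so commutation exponents behave like a
  bilinear form and can be matched with \<open>weyl_form\<close>.\<close>

definition q_commute :: "nat \<Rightarrow> int \<Rightarrow> 'a \<Rightarrow> 'a \<Rightarrow> bool" where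
  "q_commute N e x y \<longleftrightarrow> x \<otimes> y = s (qroot N powi (2 * e)) \<otimes> (y \<otimes> x)"

lemma q_commute_sym:
  assumes "q_commute N e x y" "x \<in> carrier R" "y \<in> carrier R"
  shows "q_commute N (- e) y x"
proof -
  have "s (qroot N powi (2 * - e)) \<otimes> (x \<otimes> y) =
      s (qroot N powi (2 * - e) * qroot N powi (2 * e)) \<otimes> (y \<otimes> x)"
    using assms by (simp only: q_commute_def s_s m_closed)
  also have "qroot N powi (2 * - e) * qroot N powi (2 * e) = 1"
    by (simp add: power_int_add[symmetric])
  finally show ?thesis
    using assms by (simp add: q_commute_def s_one)
qed

lemma q_commute_mult:
  assumes "q_commute N e x z" "q_commute N e' y z" "x \<in> carrier R" "y \<in> carrier R" "z \<in> carrier R"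
  shows "q_commute N (e + e') (x \<otimes> y) z"
proof -
  let ?r = "qroot N powi (2 * e)" and ?r' = "qroot N powi (2 * e')"
  have "x \<otimes> y \<otimes> z = x \<otimes> (y \<otimes> z)"
    using assms(3-5) by (simp add: m_assoc)
  also have "y \<otimes> z = s ?r' \<otimes> (z \<otimes> y)"
    using assms(2) by (simp only: q_commute_def)
  also have "x \<otimes> (s ?r' \<otimes> (z \<otimes> y)) = s ?r' \<otimes> (x \<otimes> (z \<otimes> y))"
    by (rule s_prod_lcomm) (use assms(3-5) in auto)
  also have "x \<otimes> (z \<otimes> y) = s ?r \<otimes> (z \<otimes> x) \<otimes> y"
    using assms(3-5) assms(1)[unfolded q_commute_def] by (simp only: m_assoc[symmetric])
  also have "s ?r' \<otimes> (s ?r \<otimes> (z \<otimes> x) \<otimes> y) = s ?r' \<otimes> (s ?r \<otimes> (z \<otimes> (x \<otimes> y)))"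
    using assms(3-5) by (simp add: m_assoc)
  also have "\<dots> = s (?r' * ?r) \<otimes> (z \<otimes> (x \<otimes> y))"
    using assms by (intro s_s) auto
  finally show ?thesis
    by (simp add: q_commute_def power_int_add[symmetric] algebra_simps)
qed

lemma q_commute_scalar:
  assumes "q_commute N e x y" "x \<in> carrier R" "y \<in> carrier R"
  shows "q_commute N e (s c \<otimes> x) y"
proof -
  have "q_commute N 0 (s c) y"
    using assms by (simp add: q_commute_def s_one s_comm)
  from q_commute_mult[OF this assms(1)] show ?thesis
    using assms(2,3) by simp
qed

lemma q_commute_pow:
  assumes "q_commute N e x y" "x \<in> carrier R" "y \<in> carrier R"
  shows "q_commute N (int n * e) (x [^] n) y"
proof (induction n)
  case 0
  then show ?case
    using assms by (simp add: q_commute_def s_one)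
next
  case (Suc n)
  then show ?case
    using q_commute_mult[OF Suc assms(1)] assms(2,3) by (simp add: algebra_simps)
qed

lemma q_commute_inv:
  assumes "q_commute N e x y" "x \<in> Units R" "y \<in> carrier R"
  shows "q_commute N (- e) (inv x) y"
proof -
  have x: "x \<in> carrier R" "inv x \<in> carrier R"
    using assms(2) by auto
  have "y \<otimes> x = s (qroot N powi (2 * - e)) \<otimes> (x \<otimes> y)"
    using q_commute_sym[OF assms(1) x(1) assms(3)] by (simp add: q_commute_def)
  then have "inv x \<otimes> (y \<otimes> x) \<otimes> inv x = inv x \<otimes> (s (qroot N powi (2 * - e)) \<otimes> (x \<otimes> y)) \<otimes> inv x"
    by simp
  also have "inv x \<otimes> (s (qroot N powi (2 * - e)) \<otimes> (x \<otimes> y)) = s (qroot N powi (2 * - e)) \<otimes> (inv x \<otimes> (x \<otimes> y))"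
    using x assms(3) by (intro s_prod_lcomm) auto
  also have "inv x \<otimes> (x \<otimes> y) = y"
    using x assms(2,3) by (simp add: m_assoc[symmetric])
  finally show ?thesis
    using x assms(2,3) by (simp add: q_commute_def m_assoc)
qed

text \<open>Sorting the word (xy)^n takes n(n-1)/2 exchanges of y with x, each contributing
  q^(-2e).\<close>

lemma pow_q_commute:
  assumes "q_commute N e x y" "x \<in> carrier R" "y \<in> carrier R"
  shows "(x \<otimes> y) [^] n = s (qroot N powi (- e * int n * (int n - 1))) \<otimes> (x [^] n \<otimes> y [^] (n::nat))"
proof (induction n)
  case 0
  then show ?case
    by (simp add: s_one)
next
  case (Suc n)
  let ?c = "qroot N powi (- e * int n * (int n - 1))" and ?d = "qroot N powi (2 * (int n * - e))"
  have yx: "y [^] n \<otimes> x = s ?d \<otimes> (x \<otimes> y [^] n)"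
    using q_commute_pow[OF q_commute_sym[OF assms] assms(3,2), of n] by (simp add: q_commute_def)
  have "(x \<otimes> y) [^] Suc n = s ?c \<otimes> (x [^] n \<otimes> y [^] n) \<otimes> (x \<otimes> y)"
    by (simp add: Suc)
  also have "\<dots> = s ?c \<otimes> (x [^] n \<otimes> ((y [^] n \<otimes> x) \<otimes> y))"
    using assms(2,3) by (simp add: m_assoc)
  also have "(y [^] n \<otimes> x) \<otimes> y = s ?d \<otimes> (x \<otimes> y [^] Suc n)"
    unfolding yx using assms(2,3) by (simp add: m_assoc)
  also have "x [^] n \<otimes> (s ?d \<otimes> (x \<otimes> y [^] Suc n)) = s ?d \<otimes> (x [^] n \<otimes> (x \<otimes> y [^] Suc n))"
    by (rule s_prod_lcomm) (use assms(2,3) in auto)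
  also have "x [^] n \<otimes> (x \<otimes> y [^] Suc n) = x [^] Suc n \<otimes> y [^] Suc n"
    using assms(2,3) by (simp add: m_assoc)
  also have "s ?c \<otimes> (s ?d \<otimes> (x [^] Suc n \<otimes> y [^] Suc n)) = s (?c * ?d) \<otimes> (x [^] Suc n \<otimes> y [^] Suc n)"
    using assms(2,3) by (intro s_s) auto
  also have "?c * ?d = qroot N powi (- e * int (Suc n) * (int (Suc n) - 1))"
    by (simp add: power_int_add[symmetric] algebra_simps)
  finally show ?case .
qed

lemma functional_calc_comm:
  assumes "odd N" "Y \<in> carrier R" "Y [^] N = \<one>"
  shows "functional_calc N Y \<Psi> \<otimes> Y = Y \<otimes> functional_calc N Y \<Psi>"
  unfolding functional_calc_def
  by (subst power_poly_comm[OF assms, of Y 1]) (use assms in \<open>simp_all add: s_one\<close>)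

end

section \<open>The dilogarithm at roots of unity\<close>

text \<open>The values lie in the multiples of 2 pi i, which are 2 pi apart, so continuity forces a
  constant. This makes the continuous logarithm of a path unique.\<close>

lemma continuous_exp_eq_one:
  fixes f :: "real \<Rightarrow> complex"
  assumes "continuous_on {0..1} f" "f 0 = 0" "\<And>t. t \<in> {0..1} \<Longrightarrow> exp (f t) = 1" "t \<in> {0..1}"
  shows "f t = 0"
proof -
  have "f constant_on {0..1}"
  proof (rule continuous_discrete_range_constant)
    fix x :: real assume x: "x \<in> {0..1}"
    show "\<exists>e>0. \<forall>y. y \<in> {0..1} \<and> f y \<noteq> f x \<longrightarrow> e \<le> norm (f y - f x)"
    proof (intro exI[of _ "2 * pi"] conjI allI impI)
      fix y assume y: "y \<in> {0..1} \<and> f y \<noteq> f x"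
      then have "exp (f y - f x) = 1"
        using assms(3) x by (simp add: exp_diff)
      then obtain n :: int where n: "Re (f y - f x) = 0" "Im (f y - f x) = of_int (2 * n) * pi"
        using exp_eq_1 by blast
      then have "n \<noteq> 0"
        using y by (auto simp: complex_eq_iff)
      then have "2 * pi * 1 \<le> 2 * pi * \<bar>real_of_int n\<bar>"
        by (intro mult_left_mono) auto
      also have "\<dots> = \<bar>Im (f y - f x)\<bar>"
        unfolding n by (simp add: abs_mult)
      also have "\<dots> \<le> norm (f y - f x)"
        by (rule abs_Im_le_cmod)
      finally show "2 * pi \<le> norm (f y - f x)"
        by simp
    qed simp
  qed (use assms(1) in auto)
  then show ?thesis
    using assms(2,4) unfolding constant_on_def by (metis atLeastAtMost_iff order_refl zero_le_one)
qed

text \<open>As polynomials in a, both sides are monic of degree N with the same N distinct roots,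
  since the q^(2j+1) run through all N-th roots of unity. For c = 0 the roots coincide, hence the
  separate case.\<close>

lemma prod_qroot:
  assumes "odd N"
  shows "(\<Prod>j<N. a + qroot N ^ (2 * j + 1) * c) = a ^ N + c ^ N"
proof (cases "c = 0")
  case True
  then show ?thesis
    using assms by (cases N) auto
next
  case False
  have N: "N > 0"
    using assms by (cases N) auto
  let ?z = "\<lambda>j. - (qroot N ^ (2 * j + 1) * c)"
  let ?P = "\<Prod>j<N. [:- ?z j, 1:]" and ?R = "Polynomial.monom 1 N + [:c ^ N:]"
  have inj: "inj_on ?z {..<N}"
  proof (rule inj_onI)
    fix i j assume ij: "i \<in> {..<N}" "j \<in> {..<N}" "?z i = ?z j"
    then have "qroot N powi (2 * int i) = qroot N powi (2 * int j)"
      using False by (simp add: power_int_mult power_mult)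
    then have "[i = j] (mod N)"
      by (simp add: qroot_powi_eq_iff[OF assms] cong_int_iff)
    then show "i = j"
      using ij by (simp add: cong_def)
  qed
  have deg_P: "Polynomial.degree ?P = N"
    by (subst degree_prod_eq_sum_degree) auto
  have deg_R: "Polynomial.degree ?R = N"
    using N by (subst degree_add_eq_left) (auto simp: degree_monom_eq)
  have "?P = ?R"
  proof (rule poly_eqI_degree_lead_coeff[where A = "?z ` {..<N}" and n = N])
    have "Polynomial.lead_coeff ?P = 1"
      by (simp add: lead_coeff_prod)
    then show "poly.coeff ?P N = poly.coeff ?R N"
      using N deg_P by (simp add: coeff_pCons split: nat.split)
  next
    fix z assume "z \<in> ?z ` {..<N}"
    then obtain j where j: "j < N" "z = ?z j"
      by auto
    have "poly ?P z = 0"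
      using j by (auto simp: poly_prod)
    moreover have "z ^ N = - (c ^ N)"
    proof -
      have "(qroot N ^ (2 * j + 1)) ^ N = 1"
        using qroot_power_eq_one[OF assms] by (metis mult.commute power_mult power_one)
      then show ?thesis
        using assms by (simp add: j(2) power_mult_distrib)
    qed
    ultimately show "poly ?P z = poly ?R z"
      by (simp add: poly_monom)
  qed (use deg_P deg_R inj in \<open>auto simp: card_image\<close>)
  then have "poly ?P a = poly ?R a"
    by simp
  then show ?thesis
    by (simp add: poly_prod poly_monom add.commute)
qed

text \<open>The cyclic shift of the logarithms lowers each weight j/N with j > 0 by 1/N, which
  changes the weighted sum by L_0 / N because the total is zero. The logarithm L_0 moves to the last
  position and gets weight (N-1)/N. Together this is L_0, the logarithm of p^- + q p^+ X.\<close>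

lemma dilog_branch_recursion:
  assumes N: "odd N" and branch: "dilog_branch N p \<Psi>" and X: "X ^ N = 1"
  shows "\<Psi> (qroot N ^ 2 * X) = (snd p + qroot N * fst p * X) * \<Psi> X" "\<Psi> X \<noteq> 0"
proof -
  let ?q = "qroot N"
  have N_pos: "N > 0"
    using N by (cases N) auto
  obtain g where g: "path g" "path_image g \<subseteq> fermat_bar N" "pathstart g = (0, 1)" "pathfinish g = p"
    and branch': "\<And>X. X ^ N = 1 \<Longrightarrow> \<exists>L :: nat \<Rightarrow> real \<Rightarrow> complex.
       (\<forall>j<N. continuous_on {0..1} (L j) \<and> L j 0 = 0 \<and>
          (\<forall>t\<in>{0..1}. exp (L j t) = snd (g t) + ?q ^ (2 * j + 1) * fst (g t) * X)) \<and>
       \<Psi> X = (\<Prod>j<N. exp (of_nat j / of_nat N * L j 1))"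
    using branch unfolding dilog_branch_def by blast
  have "(?q ^ 2 * X) ^ N = 1"
    using X qroot_power_eq_one[OF N] by (simp add: power_mult_distrib flip: power_mult) (simp add: mult.commute[of 2] power_mult)
  then obtain L' where L': "\<And>j. j < N \<Longrightarrow> continuous_on {0..1} (L' j)" "\<And>j. j < N \<Longrightarrow> L' j 0 = 0"
      "\<And>j t. j < N \<Longrightarrow> t \<in> {0..1} \<Longrightarrow> exp (L' j t) = snd (g t) + ?q ^ (2 * j + 1) * fst (g t) * (?q ^ 2 * X)"
      "\<Psi> (?q ^ 2 * X) = (\<Prod>j<N. exp (of_nat j / of_nat N * L' j 1))"
    using branch'[of "?q ^ 2 * X"] by blast
  obtain L where L: "\<And>j. j < N \<Longrightarrow> continuous_on {0..1} (L j)" "\<And>j. j < N \<Longrightarrow> L j 0 = 0"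
      "\<And>j t. j < N \<Longrightarrow> t \<in> {0..1} \<Longrightarrow> exp (L j t) = snd (g t) + ?q ^ (2 * j + 1) * fst (g t) * X"
      "\<Psi> X = (\<Prod>j<N. exp (of_nat j / of_nat N * L j 1))"
    using branch'[OF X] by blast
  show "\<Psi> X \<noteq> 0"
    unfolding L(4) by simp
  \<comment> \<open>Two continuous logarithms of the same factor, both starting at 0, agree at the
    end of the path. It matters that the path is the same for X and q^2 X.\<close>
  have same: "L' i 1 = L j 1"
    if ij: "i < N" "j < N" and eq: "?q ^ (2 * i + 1) * ?q ^ 2 = ?q ^ (2 * j + 1)" for i j
  proof -
    have "L' i 1 - L j 1 = 0"
    proof (rule continuous_exp_eq_one[where f = "\<lambda>t. L' i t - L j t"])
      fix t :: real assume t: "t \<in> {0..1}"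
      have "exp (L' i t) = exp (L j t)"
      proof -
        have "exp (L' i t) = snd (g t) + (?q ^ (2 * i + 1) * ?q ^ 2) * fst (g t) * X"
          by (simp add: L'(3)[OF ij(1) t] mult_ac)
        then show ?thesis
          unfolding eq by (simp only: L(3)[OF ij(2) t])
      qed
      then show "exp (L' i t - L j t) = 1"
        by (simp add: exp_diff)
    qed (use L L' ij in \<open>auto intro!: continuous_intros\<close>)
    then show ?thesis
      by simp
  qed
  have total: "(\<Sum>j<N. L j 1) = 0"
  proof (rule continuous_exp_eq_one[where f = "\<lambda>t. \<Sum>j<N. L j t"])
    fix t :: real assume t: "t \<in> {0..1}"
    have "exp (\<Sum>j<N. L j t) = (\<Prod>j<N. snd (g t) + ?q ^ (2 * j + 1) * (fst (g t) * X))"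
      using t by (simp add: exp_sum L(3) mult.assoc)
    also have "\<dots> = snd (g t) ^ N + fst (g t) ^ N"
      unfolding prod_qroot[OF N] by (simp add: power_mult_distrib X)
    also have "\<dots> = 1"
    proof -
      have "g t \<in> fermat_bar N"
        using g(2) t by (auto simp: path_image_def)
      then show ?thesis
        using N_pos by (auto simp: fermat_bar_def fermat_def add.commute)
    qed
    finally show "exp (\<Sum>j<N. L j t) = 1" .
  qed (use L in \<open>auto intro!: continuous_intros sum.neutral\<close>)
  obtain n where n: "N = Suc n"
    using N_pos by (cases N) auto
  have L'_eq: "L' j 1 = L (Suc j) 1" if "j < n" for j
    using that by (intro same) (auto simp: n simp flip: power_add)
  \<comment> \<open>The last factor wraps around to the one with index 0, since q^(2N) = 1.\<close>
  have L'_last: "L' n 1 = L 0 1"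
  proof (rule same)
    have "?q ^ (2 * n + 1) * ?q ^ 2 = (?q ^ N) ^ 2 * ?q"
      unfolding n by (simp add: power_add power_mult mult_ac power2_eq_square)
    then show "?q ^ (2 * n + 1) * ?q ^ 2 = ?q ^ (2 * 0 + 1)"
      by (simp add: qroot_power_eq_one[OF N])
  qed (simp_all add: n)
  have "(\<Sum>j<N. of_nat j / of_nat N * L' j 1) =
      (\<Sum>j<n. of_nat j / of_nat N * L (Suc j) 1) + of_nat n / of_nat N * L 0 1"
    by (simp add: n L'_eq L'_last)
  moreover have "(\<Sum>j<N. of_nat j / of_nat N * L j 1) =
      (\<Sum>j<n. of_nat j / of_nat N * L (Suc j) 1) + (\<Sum>j<n. L (Suc j) 1) / of_nat N"
    unfolding n by (subst sum.lessThan_Suc_shift)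
      (simp add: sum.distrib[symmetric] add_divide_distrib ring_distribs sum_divide_distrib add.commute)
  moreover have "(\<Sum>j<n. L (Suc j) 1) = - L 0 1"
    using total unfolding n by (subst (asm) sum.lessThan_Suc_shift) (simp add: eq_neg_iff_add_eq_0 add.commute)
  ultimately have "(\<Sum>j<N. of_nat j / of_nat N * L' j 1) =
      (\<Sum>j<N. of_nat j / of_nat N * L j 1) + (of_nat n / of_nat N * L 0 1 + L 0 1 / of_nat N)"
    by simp
  also have "of_nat n / of_nat N * L 0 1 + L 0 1 / of_nat N = L 0 1"
  proof -
    have "of_nat n / of_nat N * L 0 1 + L 0 1 / of_nat N = (of_nat n + 1) / of_nat N * L 0 1"
      by (simp add: add_divide_distrib ring_distribs)
    also have "(of_nat n + 1 :: complex) = of_nat N"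
      by (simp add: n)
    finally show ?thesis
      using N_pos by simp
  qed
  finally have "exp (\<Sum>j<N. of_nat j / of_nat N * L' j 1) =
      exp (\<Sum>j<N. of_nat j / of_nat N * L j 1) * exp (L 0 1)"
    by (simp add: exp_add)
  then have "\<Psi> (?q ^ 2 * X) = \<Psi> X * exp (L 0 1)"
    by (simp add: L(4) L'(4) exp_sum)
  also have "exp (L 0 1) = snd p + ?q * fst p * X"
    using L(3)[of 0 1] N_pos g(4) by (simp add: pathfinish_def)
  finally show "\<Psi> (?q ^ 2 * X) = (snd p + ?q * fst p * X) * \<Psi> X"
    by simp
qed

section \<open>Matrices\<close>

lemma operators_simps [simp]:
  "carrier operators = UNIV" "mult operators = (**)" "one operators = mat 1"
  "zero operators = 0" "add operators = (+)"
  by (simp_all add: operators_def)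

lemma mat_mult_component: "(mat c ** A) $ i $ j = c * (A :: complex ^ 'b::finite ^ 'b) $ i $ j"
  by (simp add: matrix_matrix_mult_def mat_def if_distrib if_distribR cong: if_cong)

lemma mult_mat_component: "(A ** mat c) $ i $ j = (A :: complex ^ 'b::finite ^ 'b) $ i $ j * c"
  by (simp add: matrix_matrix_mult_def mat_def if_distrib if_distribR cong: if_cong)

lemma matrix_mult_add_left: "(A + B) ** C = A ** C + B ** (C :: complex ^ 'b::finite ^ 'b)"
  by (simp add: vec_eq_iff matrix_matrix_mult_def ring_distribs sum.distrib)

lemma operators_scalar_ring: "scalar_ring (operators :: (complex ^ 'b::finite ^ 'b) ring) mat"
proof -
  interpret ring "operators :: (complex ^ 'b::finite ^ 'b) ring"
  proof (rule ringI)
    show "abelian_group (operators :: (complex ^ 'b ^ 'b) ring)"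
    proof (rule abelian_groupI)
      fix x :: "complex ^ 'b ^ 'b"
      show "\<exists>y\<in>carrier operators. y \<oplus>\<^bsub>operators\<^esub> x = \<zero>\<^bsub>operators\<^esub>"
        by (auto intro!: exI[of _ "- x"])
    qed (auto simp: algebra_simps)
    show "monoid (operators :: (complex ^ 'b ^ 'b) ring)"
      by (rule monoidI) (auto simp: matrix_mul_assoc)
  qed (auto simp: matrix_add_ldistrib matrix_mult_add_left)
  show ?thesis
  proof
    fix c d :: complex and x :: "complex ^ 'b ^ 'b"
    show "mat (c + d) = mat c \<oplus>\<^bsub>operators\<^esub> (mat d :: complex ^ 'b ^ 'b)"
      by (simp add: vec_eq_iff mat_def)
    show "mat (c * d) = mat c \<otimes>\<^bsub>operators\<^esub> (mat d :: complex ^ 'b ^ 'b)"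
      by (simp add: vec_eq_iff mat_mult_component) (simp add: mat_def)
    show "x \<otimes>\<^bsub>operators\<^esub> mat c = mat c \<otimes>\<^bsub>operators\<^esub> x"
      by (simp add: vec_eq_iff mat_mult_component mult_mat_component)
  qed auto
qed

lemma mat_mult_mat: "mat c ** mat d = (mat (c * d) :: complex ^ 'b::finite ^ 'b)"
  by (simp add: vec_eq_iff mat_mult_component) (simp add: mat_def)

lemma mat_commute: "A ** mat c = mat c ** (A :: complex ^ 'b::finite ^ 'b)"
  by (simp add: vec_eq_iff mat_mult_component mult_mat_component)

lemma mat_mult_lcomm: "A ** (mat c ** B) = mat c ** (A ** B)" for A B :: "complex ^ 'b::finite ^ 'b"
  by (simp add: matrix_mul_assoc mat_commute[of A])

lemma operators_Units_iff: "Q \<in> Units operators \<longleftrightarrow> (\<exists>Q'. Q ** Q' = mat 1 \<and> Q' ** Q = mat 1)"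
  by (auto simp: Units_def)

lemma operators_UnitsI: "Q ** Q' = mat 1 \<Longrightarrow> Q \<in> Units operators"
  for Q :: "complex ^ 'b::finite ^ 'b"
  unfolding operators_Units_iff using matrix_left_right_inverse[of Q Q'] by (intro exI[of _ Q']) simp

lemma operators_inv_eq:
  fixes Q :: "complex ^ 'b::finite ^ 'b"
  assumes "Q ** Q' = mat 1"
  shows "inv\<^bsub>operators\<^esub> Q = Q'"
proof -
  interpret scalar_ring "operators :: (complex ^ 'b ^ 'b) ring" mat
    by (rule operators_scalar_ring)
  show ?thesis
    using assms matrix_left_right_inverse[of Q Q'] by (intro inv_char) auto
qed

lemma operators_inv:
  fixes Q :: "complex ^ 'b::finite ^ 'b"
  assumes "Q \<in> Units operators"
  shows "Q ** inv\<^bsub>operators\<^esub> Q = mat 1" "inv\<^bsub>operators\<^esub> Q ** Q = mat 1"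
proof -
  obtain Q' where "Q ** Q' = mat 1" "Q' ** Q = mat 1"
    using assms unfolding operators_Units_iff by blast
  then show "Q ** inv\<^bsub>operators\<^esub> Q = mat 1" "inv\<^bsub>operators\<^esub> Q ** Q = mat 1"
    by (simp_all add: operators_inv_eq)
qed

lemma conj_by_eq:
  fixes Q :: "complex ^ 'b::finite ^ 'b"
  assumes "Q \<in> Units operators" "Q ** X = X' ** Q"
  shows "conj_by Q X = X'"
proof -
  have "conj_by Q X = X' ** (Q ** inv\<^bsub>operators\<^esub> Q)"
    unfolding conj_by_def assms(2) by (rule matrix_mul_assoc[symmetric])
  then show ?thesis
    by (simp add: operators_inv(1)[OF assms(1)])
qed

lemma conj_by_hom:
  fixes Q :: "complex ^ 'b::finite ^ 'b"
  assumes "Q \<in> Units operators"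
  shows "conj_by Q \<in> Ring.ring_hom operators operators" "conj_by Q (mat c) = mat c"
proof -
  show mat: "conj_by Q (mat c) = mat c" for c
    by (rule conj_by_eq[OF assms]) (rule mat_commute)
  have "conj_by Q (x ** y) = conj_by Q x ** conj_by Q y" for x y
  proof -
    have "conj_by Q x ** conj_by Q y = Q ** x ** (inv\<^bsub>operators\<^esub> Q ** Q) ** y ** inv\<^bsub>operators\<^esub> Q"
      by (simp add: conj_by_def matrix_mul_assoc)
    then show ?thesis
      by (simp add: operators_inv(2)[OF assms] conj_by_def matrix_mul_assoc)
  qed
  then show "conj_by Q \<in> Ring.ring_hom operators operators"
    using mat[of 1]
    by (intro ring_hom_memI) (auto simp: conj_by_def matrix_add_ldistrib matrix_mult_add_left)
qed

text \<open>Column k has the single entry \<phi> k in row \<pi> k. Weyl operators and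
  \<open>S_op\<close> have this form, so their products amount to composing maps of basis
  labels.\<close>

definition monomial_matrix :: "('b \<Rightarrow> 'b) \<Rightarrow> ('b \<Rightarrow> complex) \<Rightarrow> complex ^ 'b ^ 'b" where
  "monomial_matrix \<pi> \<phi> = (\<chi> m k. if m = \<pi> k then \<phi> k else 0)"

lemma mult_monomial_matrix:
  fixes A :: "complex ^ 'b::finite ^ 'b"
  shows "(A ** monomial_matrix \<pi> \<phi>) $ m $ k = A $ m $ \<pi> k * \<phi> k"
  by (simp add: monomial_matrix_def matrix_matrix_mult_def if_distrib cong: if_cong)

lemma monomial_matrix_mult:
  fixes A :: "complex ^ 'b::finite ^ 'b"
  assumes "\<And>m k. m = \<pi> k \<longleftrightarrow> k = \<pi>' m"
  shows "(monomial_matrix \<pi> \<phi> ** A) $ m $ k = \<phi> (\<pi>' m) * A $ \<pi>' m $ k"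
  by (simp add: monomial_matrix_def matrix_matrix_mult_def assms if_distrib[of "\<lambda>x. x * _"] cong: if_cong)

lemma monomial_matrix_mult_monomial_matrix:
  "monomial_matrix \<pi> \<phi> ** monomial_matrix \<pi>' \<phi>' =
     monomial_matrix (\<lambda>k. \<pi> (\<pi>' k)) (\<lambda>k. \<phi> (\<pi>' k) * \<phi>' (k :: 'b::finite))"
  by (simp add: vec_eq_iff mult_monomial_matrix) (simp add: monomial_matrix_def)

lemma mat_eq_monomial_matrix: "mat c = monomial_matrix (\<lambda>k. k) (\<lambda>_. c)"
  by (simp add: vec_eq_iff mat_def monomial_matrix_def)

lemma of_int_mod_ring_add:
  "(of_int_mod_ring (a + b) :: 'n::finite mod_ring) = of_int_mod_ring a + of_int_mod_ring b"
  by transfer (simp add: mod_add_eq)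

lemma of_int_mod_ring_uminus: "(of_int_mod_ring (- a) :: 'n::finite mod_ring) = - of_int_mod_ring a"
proof -
  have "of_int_mod_ring (- a) + of_int_mod_ring a = (0 :: 'n mod_ring)"
    by (simp flip: of_int_mod_ring_add)
  then show ?thesis
    by (simp add: eq_neg_iff_add_eq_0)
qed

lemma of_int_mod_ring_diff:
  "(of_int_mod_ring (a - b) :: 'n::finite mod_ring) = of_int_mod_ring a - of_int_mod_ring b"
  using of_int_mod_ring_add[of a "- b", where 'n = 'n] by (simp add: of_int_mod_ring_uminus)

lemma of_int_mod_ring_eq_iff:
  "(of_int_mod_ring a :: 'n::finite mod_ring) = of_int_mod_ring b \<longleftrightarrow> [a = b] (mod int CARD('n))"
  by transfer (simp add: cong_def)

text \<open>Representatives in 0..N-1 add only modulo N. This is enough, because they occur only in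
  exponents of q.\<close>

lemma to_int_mod_ring_add_cong:
  fixes k l :: "'n::finite mod_ring"
  shows "[to_int_mod_ring (k + l) = to_int_mod_ring k + to_int_mod_ring l] (mod int CARD('n))"
proof -
  have "of_int_mod_ring (to_int_mod_ring (k + l)) =
      (of_int_mod_ring (to_int_mod_ring k + to_int_mod_ring l) :: 'n mod_ring)"
    by (simp add: of_int_mod_ring_add)
  then show ?thesis
    by (simp only: of_int_mod_ring_eq_iff)
qed

lemma to_int_of_int_mod_ring_cong:
  "[to_int_mod_ring (of_int_mod_ring a :: 'n::finite mod_ring) = a] (mod int CARD('n))"
proof -
  have "of_int_mod_ring (to_int_mod_ring (of_int_mod_ring a :: 'n mod_ring)) =
      (of_int_mod_ring a :: 'n mod_ring)"
    by simp
  then show ?thesis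
    by (simp only: of_int_mod_ring_eq_iff)
qed

lemma bij_to_int_mod_ring:
  "bij_betw (\<lambda>k :: 'n::finite mod_ring. nat (to_int_mod_ring k)) UNIV {..<CARD('n)}"
proof (rule bij_betw_byWitness[where f' = "\<lambda>j. of_int_mod_ring (int j)"])
  have "to_int_mod_ring k \<in> {0..<int CARD('n)}" for k :: "'n mod_ring"
    using range_to_int_mod_ring by blast
  then have rng: "0 \<le> to_int_mod_ring k" "to_int_mod_ring k < int CARD('n)" for k :: "'n mod_ring"
    by auto
  then show "\<forall>a\<in>UNIV. of_int_mod_ring (int (nat (to_int_mod_ring a))) = (a :: 'n mod_ring)"
    "(\<lambda>k :: 'n mod_ring. nat (to_int_mod_ring k)) ` UNIV \<subseteq> {..<CARD('n)}"
    by (auto simp: nat_less_iff)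
qed auto

lemma to_int_mod_ring_nonneg: "0 \<le> to_int_mod_ring (k :: 'n::finite mod_ring)"
proof -
  have "to_int_mod_ring k \<in> {0..<int CARD('n)}"
    using range_to_int_mod_ring by blast
  then show ?thesis
    by simp
qed

lemma sum_mod_ring:
  "(\<Sum>k\<in>(UNIV :: 'n::finite mod_ring set). f (to_int_mod_ring k)) = (\<Sum>j<CARD('n). f (int j))"
proof -
  have "(\<Sum>j<CARD('n). f (int j)) =
      (\<Sum>k\<in>(UNIV :: 'n mod_ring set). f (int (nat (to_int_mod_ring k))))"
    by (rule sum.reindex_bij_betw[OF bij_to_int_mod_ring, symmetric])
  then show ?thesis
    by (simp add: to_int_mod_ring_nonneg)
qed

section \<open>Weyl operators\<close>

text \<open>For each triangle, the exponents of U and of P. They are integers rather than residues,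
  so that \<open>weyl_form\<close> can reproduce the integer matrix \<open>eps\<close>
  exactly.\<close>

type_synonym 'v weyl_exponent = "(int \<times> int) ^ 'v"

definition weyl_form :: "'v::finite weyl_exponent \<Rightarrow> 'v weyl_exponent \<Rightarrow> int" where
  "weyl_form x y = (\<Sum>u\<in>UNIV. fst (x $ u) * snd (y $ u) - snd (x $ u) * fst (y $ u))"

definition weyl_scale :: "int \<Rightarrow> 'v::finite weyl_exponent \<Rightarrow> 'v weyl_exponent" where
  "weyl_scale c x = (\<chi> u. (c * fst (x $ u), c * snd (x $ u)))"

definition weyl_shift :: "'v::finite weyl_exponent \<Rightarrow> ('v \<Rightarrow> 'n::finite mod_ring) \<Rightarrow> 'v \<Rightarrow> 'n mod_ring" where
  "weyl_shift x k = (\<lambda>u. k u + of_int_mod_ring (snd (x $ u)))"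

text \<open>At one site, U^a P^b sends |k> to q^(2a(k+b)) |k+b>. The Weyl factor q^(-ab) turns the
  exponent into 2ak + ab.\<close>

definition weyl_phase :: "'v::finite weyl_exponent \<Rightarrow> ('v \<Rightarrow> 'n::finite mod_ring) \<Rightarrow> complex" where
  "weyl_phase x k =
     (\<Prod>u\<in>UNIV. qroot CARD('n) powi (2 * fst (x $ u) * to_int_mod_ring (k u) + fst (x $ u) * snd (x $ u)))"

definition weyl :: "'v::finite weyl_exponent \<Rightarrow> ('v, 'n::finite) operator" where
  "weyl x = monomial_matrix (weyl_shift x) (weyl_phase x)"

lemma qroot_powi_sum: "finite A \<Longrightarrow> qroot N powi (sum f A) = (\<Prod>i\<in>A. qroot N powi (f i))"
  by (induction A rule: finite_induct) (simp_all add: power_int_add)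

lemma weyl_form_add_left: "weyl_form (x + x') y = weyl_form x y + weyl_form x' y"
  unfolding weyl_form_def sum.distrib[symmetric]
  by (intro sum.cong refl) (simp add: algebra_simps)

lemma weyl_form_scale_left: "weyl_form (weyl_scale c x) y = c * weyl_form x y"
  unfolding weyl_form_def weyl_scale_def sum_distrib_left
  by (intro sum.cong refl) (simp add: algebra_simps)

lemma weyl_form_swap: "weyl_form y x = - weyl_form x y"
  unfolding weyl_form_def sum_negf[symmetric] by (intro sum.cong refl) simp

lemma weyl_form_add_right: "weyl_form x (y + y') = weyl_form x y + weyl_form x y'"
  by (simp add: weyl_form_swap[of x "y + y'"] weyl_form_swap[of x y] weyl_form_swap[of x y'] weyl_form_add_left)

lemma weyl_form_scale_right: "weyl_form x (weyl_scale c y) = c * weyl_form x y"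
  by (simp add: weyl_form_swap[of x "weyl_scale c y"] weyl_form_swap[of x y] weyl_form_scale_left)

lemma weyl_form_self: "weyl_form x x = 0"
  by (simp add: weyl_form_def mult.commute)

lemma weyl_form_zero: "weyl_form 0 y = 0" "weyl_form x 0 = 0"
  by (simp_all add: weyl_form_def)

lemma weyl_form_uminus: "weyl_form (- x) y = - weyl_form x y" "weyl_form x (- y) = - weyl_form x y"
  unfolding weyl_form_def sum_negf[symmetric] by (intro sum.cong refl; simp)+

lemmas weyl_form_simps = weyl_form_add_left weyl_form_add_right weyl_form_scale_left
  weyl_form_scale_right weyl_form_self weyl_form_zero weyl_form_uminus

text \<open>The exponents agree as integers at each site once the representative of k + b' is
  replaced by the representative of k plus b', which changes the exponent by a multiple of
  N.\<close>

lemma weyl_mult: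
  fixes x y :: "'v::finite weyl_exponent"
  assumes "odd CARD('n::finite)"
  shows "weyl x ** weyl y = mat (qroot CARD('n) powi weyl_form x y) ** (weyl (x + y) :: ('v, 'n) operator)"
proof -
  let ?q = "qroot CARD('n)"
  have shift: "weyl_shift x (weyl_shift y k) = weyl_shift (x + y) k" for k :: "'v \<Rightarrow> 'n mod_ring"
    by (auto simp: weyl_shift_def of_int_mod_ring_add fun_eq_iff add_ac)
  have phase: "weyl_phase x (weyl_shift y k) * weyl_phase y k =
      ?q powi weyl_form x y * weyl_phase (x + y) k" for k :: "'v \<Rightarrow> 'n mod_ring"
  proof -
    have "?q powi (2 * a * to_int_mod_ring (k u + of_int_mod_ring b') + a * b) *
        ?q powi (2 * a' * to_int_mod_ring (k u) + a' * b') =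
        ?q powi (a * b' - b * a') * ?q powi (2 * (a + a') * to_int_mod_ring (k u) + (a + a') * (b + b'))"
      for a b a' b' u
    proof -
      have "[to_int_mod_ring (k u + of_int_mod_ring b') = to_int_mod_ring (k u) + b'] (mod int CARD('n))"
        using to_int_mod_ring_add_cong to_int_of_int_mod_ring_cong by (metis cong_add_lcancel cong_trans)
      then have "?q powi (2 * a * to_int_mod_ring (k u + of_int_mod_ring b') + a * b) =
          ?q powi (2 * a * (to_int_mod_ring (k u) + b') + a * b)"
        by (intro qroot_powi_cong assms cong_add cong_mult cong_refl)
      then show ?thesis
        by (simp add: power_int_add[symmetric] algebra_simps)
    qed
    then show ?thesis
      by (simp add: weyl_phase_def weyl_shift_def weyl_form_def qroot_powi_sum flip: prod.distrib)
  qed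
  show ?thesis
    by (simp add: weyl_def monomial_matrix_mult_monomial_matrix shift phase vec_eq_iff
        mat_mult_component) (simp add: monomial_matrix_def)
qed

lemma weyl_zero: "weyl 0 = mat 1"
  by (simp add: weyl_def mat_eq_monomial_matrix weyl_shift_def[abs_def] weyl_phase_def[abs_def])

lemma weyl_commute:
  assumes "odd CARD('n::finite)"
  shows "weyl x ** weyl y =
      mat (qroot CARD('n) powi (2 * weyl_form x y)) ** (weyl y ** (weyl x :: ('v::finite, 'n) operator))"
proof -
  have "mat (qroot CARD('n) powi (2 * weyl_form x y)) ** (weyl y ** (weyl x :: ('v, 'n) operator)) =
      mat (qroot CARD('n) powi (2 * weyl_form x y) * qroot CARD('n) powi (weyl_form y x)) ** weyl (y + x)"
    by (simp add: weyl_mult[OF assms] matrix_mul_assoc mat_mult_mat)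
  also have "qroot CARD('n) powi (2 * weyl_form x y) * qroot CARD('n) powi (weyl_form y x) =
      qroot CARD('n) powi weyl_form x y"
    by (simp add: weyl_form_swap[of y x] power_int_add[symmetric])
  finally show ?thesis
    by (simp add: weyl_mult[OF assms] add.commute)
qed

lemma weyl_uminus:
  assumes "odd CARD('n::finite)"
  shows "weyl x ** weyl (- x) = (mat 1 :: ('v::finite, 'n) operator)"
  by (simp add: weyl_mult[OF assms] weyl_form_simps weyl_zero)

lemma weyl_Units:
  assumes "odd CARD('n::finite)"
  shows "(weyl x :: ('v::finite, 'n) operator) \<in> Units operators"
    and "inv\<^bsub>operators\<^esub> (weyl x) = (weyl (- x) :: ('v, 'n) operator)"
proof -
  note inv = weyl_uminus[OF assms, of x]
  show "(weyl x :: ('v, 'n) operator) \<in> Units operators"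
    by (rule operators_UnitsI[OF inv])
  show "inv\<^bsub>operators\<^esub> (weyl x) = (weyl (- x) :: ('v, 'n) operator)"
    by (rule operators_inv_eq[OF inv])
qed

lemma weyl_pow:
  assumes "odd CARD('n::finite)"
  shows "weyl x [^]\<^bsub>operators\<^esub> (m::nat) = (weyl (weyl_scale (int m) x) :: ('v::finite, 'n) operator)"
proof (induction m)
  case 0
  have "weyl_scale 0 x = 0"
    by (simp add: weyl_scale_def vec_eq_iff zero_prod_def)
  then show ?case
    by (simp add: weyl_zero)
next
  case (Suc m)
  have "weyl_scale (int m) x + x = weyl_scale (int (Suc m)) x"
    by (simp add: weyl_scale_def vec_eq_iff prod_eq_iff algebra_simps)
  then show ?case
    by (simp add: Suc weyl_mult[OF assms] weyl_form_simps)
qed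

lemma weyl_pow_card:
  assumes "odd CARD('n::finite)"
  shows "weyl x [^]\<^bsub>operators\<^esub> CARD('n) = (mat 1 :: ('v::finite, 'n) operator)"
proof -
  let ?N = "int CARD('n)"
  have "(of_int_mod_ring (?N * b) :: 'n mod_ring) = of_int_mod_ring 0" for b
    unfolding of_int_mod_ring_eq_iff by (simp add: cong_def)
  then have shift: "weyl_shift (weyl_scale ?N x) = (\<lambda>k :: 'v \<Rightarrow> 'n mod_ring. k)"
    by (simp add: weyl_shift_def weyl_scale_def fun_eq_iff)
  have "qroot CARD('n) powi (2 * (?N * a) * k + ?N * a * (?N * b)) = qroot CARD('n) powi 0" for a b k
    by (rule qroot_powi_cong[OF assms]) (simp add: cong_0_iff)
  then have "weyl_phase (weyl_scale ?N x) = (\<lambda>k :: 'v \<Rightarrow> 'n mod_ring. 1)"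
    by (simp add: weyl_phase_def weyl_scale_def fun_eq_iff)
  then show ?thesis
    unfolding weyl_pow[OF assms] unfolding weyl_def shift mat_eq_monomial_matrix by simp
qed

lemma weyl_scalar_cancel:
  assumes "odd CARD('n::finite)" "mat c ** weyl x = mat d ** (weyl x :: ('v::finite, 'n) operator)"
  shows "c = d"
proof -
  have "mat c ** (weyl x ** weyl (- x)) = mat d ** (weyl x ** (weyl (- x) :: ('v, 'n) operator))"
    using assms(2) by (simp add: matrix_mul_assoc)
  then have "(mat c :: ('v, 'n) operator) $ k $ k = mat d $ k $ k" for k
    by (simp add: weyl_uminus[OF assms(1)])
  then show ?thesis
    by (simp add: mat_def)
qed

text \<open>\<open>comm_exp\<close> is an arbitrary choice of exponent. Since q^2 has order exactly
  N, any two choices agree modulo N.\<close>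

lemma qroot_comm_exp_weyl:
  fixes x y :: "'v::finite weyl_exponent"
  assumes "odd CARD('n::finite)"
  shows "[comm_exp CARD('n) (weyl x) (weyl y :: ('v, 'n) operator) = weyl_form x y] (mod int CARD('n))"
proof -
  let ?q = "qroot CARD('n)" and ?W = "weyl :: _ \<Rightarrow> ('v, 'n) operator"
  let ?e = "comm_exp CARD('n) (?W x) (?W y)"
  have "?W x ** ?W y = mat (?q powi (2 * ?e)) ** (?W y ** ?W x)"
    unfolding comm_exp_def
    by (rule someI[of "\<lambda>e. ?W x ** ?W y = mat (?q powi (2 * e)) ** (?W y ** ?W x)"])
      (rule weyl_commute[OF assms])
  then have "mat (?q powi (2 * weyl_form x y)) ** (?W y ** ?W x) = mat (?q powi (2 * ?e)) ** (?W y ** ?W x)"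
    unfolding weyl_commute[OF assms, of x y, symmetric] .
  then have "mat (?q powi (2 * weyl_form x y) * ?q powi weyl_form y x) ** ?W (y + x) =
      mat (?q powi (2 * ?e) * ?q powi weyl_form y x) ** ?W (y + x)"
    by (simp add: weyl_mult[OF assms] matrix_mul_assoc mat_mult_mat)
  then have "?q powi (2 * weyl_form x y) = ?q powi (2 * ?e)"
    by (auto dest!: weyl_scalar_cancel[OF assms])
  then show ?thesis
    using qroot_powi_eq_iff[OF assms] cong_sym by blast
qed

text \<open>Multiplying out Weyl operators produces q to the sum of \<open>weyl_form\<close> over
  all pairs i < j, which is what the normalisation removes. Weyl-ordered products thus become sums
  of exponents, independent of the order.\<close>

lemma weyl_prod_weyl:
  assumes "odd CARD('n::finite)"
  shows "weyl_prod CARD('n) (map weyl xs) = (weyl (sum_list xs) :: ('v::finite, 'n) operator)"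
proof -
  let ?q = "qroot CARD('n)" and ?W = "weyl :: _ \<Rightarrow> ('v, 'n) operator"
  let ?e = "\<lambda>xs. \<Sum>j<length xs. \<Sum>i<j. weyl_form (xs ! i) (xs ! j)"
  have foldr: "foldr (**) (map ?W xs) (mat 1) = mat (?q powi ?e xs) ** ?W (sum_list xs)"
  proof (induction xs)
    case Nil
    then show ?case
      by (simp add: weyl_zero)
  next
    case (Cons x xs)
    have "?e (x # xs) = (\<Sum>j<length xs. weyl_form x (xs ! j)) + ?e xs"
      by (simp add: sum.lessThan_Suc_shift sum.distrib del: sum.lessThan_Suc)
    also have "(\<Sum>j<length xs. weyl_form x (xs ! j)) = weyl_form x (sum_list xs)"
    proof -
      have "weyl_form x (\<Sum>j\<in>A. f j) = (\<Sum>j\<in>A. weyl_form x (f j))" if "finite A" for A and f :: "nat \<Rightarrow> _"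
        using that by (induction A rule: finite_induct) (simp_all add: weyl_form_simps)
      then show ?thesis
        by (simp add: sum_list_sum_nth atLeast0LessThan)
    qed
    finally have e: "?e (x # xs) = weyl_form x (sum_list xs) + ?e xs" .
    have "foldr (**) (map ?W (x # xs)) (mat 1) = ?W x ** (mat (?q powi ?e xs) ** ?W (sum_list xs))"
      by (simp add: Cons.IH)
    also have "\<dots> = mat (?q powi ?e xs) ** (?W x ** ?W (sum_list xs))"
      by (rule mat_mult_lcomm)
    also have "\<dots> = mat (?q powi ?e xs * ?q powi weyl_form x (sum_list xs)) ** ?W (sum_list (x # xs))"
      by (simp add: weyl_mult[OF assms] matrix_mul_assoc mat_mult_mat)
    also have "?q powi ?e xs * ?q powi weyl_form x (sum_list xs) = ?q powi ?e (x # xs)"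
      unfolding e by (simp add: power_int_add mult.commute)
    finally show ?case .
  qed
  have "[(\<Sum>j<length xs. \<Sum>i<j. comm_exp CARD('n) (?W (xs ! i)) (?W (xs ! j))) = ?e xs] (mod int CARD('n))"
    by (intro cong_sum qroot_comm_exp_weyl[OF assms])
  moreover have "(\<Sum>j<length (map ?W xs). \<Sum>i<j. comm_exp CARD('n) (map ?W xs ! i) (map ?W xs ! j)) =
      (\<Sum>j<length xs. \<Sum>i<j. comm_exp CARD('n) (?W (xs ! i)) (?W (xs ! j)))"
    by (intro sum.cong) auto
  ultimately have "?q powi - (\<Sum>j<length (map ?W xs). \<Sum>i<j. comm_exp CARD('n) (map ?W xs ! i) (map ?W xs ! j))
      = ?q powi - ?e xs"
    by (intro qroot_powi_cong[OF assms]) (simp add: cong_minus_minus_iff)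
  then have "weyl_prod CARD('n) (map ?W xs) = mat (?q powi - ?e xs) ** (mat (?q powi ?e xs) ** ?W (sum_list xs))"
    unfolding weyl_prod_def foldr by (simp only:)
  also have "\<dots> = mat (?q powi - ?e xs * ?q powi ?e xs) ** ?W (sum_list xs)"
    by (simp add: matrix_mul_assoc mat_mult_mat)
  also have "?q powi - ?e xs * ?q powi ?e xs = 1"
    by (simp add: power_int_add[symmetric])
  finally show ?thesis
    by simp
qed

lemma U_op_eq: "U_op v = (weyl (axis v (1, 0)) :: ('v::finite, 'n::finite) operator)"
proof -
  have shift: "weyl_shift (axis v (1, 0)) k = k" for k :: "'v \<Rightarrow> 'n mod_ring"
  proof
    show "weyl_shift (axis v (1, 0)) k u = k u" for u
      by (cases "u = v") (simp_all add: weyl_shift_def axis_def)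
  qed
  have phase: "weyl_phase (axis v (1, 0)) k = qroot CARD('n) powi (2 * to_int_mod_ring (k v))"
    for k :: "'v \<Rightarrow> 'n mod_ring"
  proof -
    have "weyl_phase (axis v (1, 0)) k =
        (\<Prod>u\<in>UNIV. if u = v then qroot CARD('n) powi (2 * to_int_mod_ring (k v)) else 1)"
      unfolding weyl_phase_def
    proof (intro prod.cong refl)
      fix u
      show "qroot CARD('n) powi (2 * fst (axis v (1, 0) $ u) * to_int_mod_ring (k u) +
          fst (axis v (1, 0) $ u) * snd (axis v (1, 0) $ u)) =
        (if u = v then qroot CARD('n) powi (2 * to_int_mod_ring (k v)) else 1)"
        by (cases "u = v") (simp_all add: axis_def)
    qed
    then show ?thesis
      by simp
  qed
  show ?thesis
  proof (intro vec_eq_iff[THEN iffD2] allI)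
    fix m k :: "'v \<Rightarrow> 'n mod_ring"
    have "(\<forall>u. u \<noteq> v \<longrightarrow> m u = k u) \<and> m v = k v \<longleftrightarrow> m = k"
      unfolding fun_eq_iff by metis
    then show "(U_op v :: ('v, 'n) operator) $ m $ k = weyl (axis v (1, 0)) $ m $ k"
      by (cases "m = k") (auto simp: act_on_def U1_def weyl_def monomial_matrix_def shift phase)
  qed
qed

lemma P_op_eq: "P_op v = (weyl (axis v (0, 1)) :: ('v::finite, 'n::finite) operator)"
proof -
  have phase: "weyl_phase (axis v (0, 1)) k = 1" for k :: "'v \<Rightarrow> 'n mod_ring"
    unfolding weyl_phase_def
  proof (intro prod.neutral ballI)
    show "qroot CARD('n) powi (2 * fst (axis v (0, 1) $ u) * to_int_mod_ring (k u) +
        fst (axis v (0, 1) $ u) * snd (axis v (0, 1) $ u)) = 1" for u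
      by (cases "u = v") (simp_all add: axis_def)
  qed
  have shift: "weyl_shift (axis v (0, 1)) k = k(v := k v + of_int_mod_ring 1)"
    for k :: "'v \<Rightarrow> 'n mod_ring"
  proof
    show "weyl_shift (axis v (0, 1)) k u = (k(v := k v + of_int_mod_ring 1)) u" for u
      by (cases "u = v") (simp_all add: weyl_shift_def axis_def)
  qed
  show ?thesis
  proof (intro vec_eq_iff[THEN iffD2] allI)
    fix m k :: "'v \<Rightarrow> 'n mod_ring"
    let ?k = "k(v := k v + of_int_mod_ring 1)"
    have "(\<forall>u. u \<noteq> v \<longrightarrow> m u = k u) \<and> m v = k v + of_int_mod_ring 1 \<longleftrightarrow> m = ?k"
      unfolding fun_eq_iff fun_upd_apply by metis
    then show "(P_op v :: ('v, 'n) operator) $ m $ k = weyl (axis v (0, 1)) $ m $ k"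
      by (cases "m = ?k") (auto simp: act_on_def P1_def weyl_def monomial_matrix_def shift phase)
  qed
qed

section \<open>Exponents of corners and edges\<close>

definition corner_exponent :: "3 \<Rightarrow> int \<times> int" where
  "corner_exponent k = (if k = 0 then (- 1, 0) else if k = 1 then (1, - 1) else (0, 1))"

lemma corner_weight_eq:
  assumes "odd CARD('n::finite)"
  shows "corner_weight v k = (weyl (axis v (corner_exponent k)) :: ('v::finite, 'n) operator)"
proof -
  have "axis v (a :: int \<times> int) + axis v b = axis v (a + b)" "- axis v a = axis v (- a)" for a b
    by (auto simp: vec_eq_iff axis_def)
  then show ?thesis
    using weyl_prod_weyl[OF assms, of "[axis v (1, 0), axis v (0, - 1)]"]
    by (auto simp: corner_weight_def corner_exponent_def U_op_eq P_op_eq weyl_Units[OF assms])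
qed

definition edge_exponent :: "('v::finite, 's) dotted \<Rightarrow> 's set \<Rightarrow> 'v weyl_exponent" where
  "edge_exponent \<tau> \<alpha> = (\<Sum>(u, k) \<in> slots \<tau> \<alpha> \<union> slots \<tau> (encircle \<tau> \<alpha>). axis u (corner_exponent k))"

text \<open>The order in which \<open>SOME\<close> lists the slots is irrelevant, because a
  Weyl-ordered product depends only on the sum of the exponents.\<close>

lemma iota_bar_eq:
  assumes "odd CARD('n::finite)"
  shows "iota_bar \<tau> \<alpha> = (weyl (edge_exponent \<tau> \<alpha>) :: ('v::finite, 'n) operator)"
proof -
  let ?A = "slots \<tau> \<alpha> \<union> slots \<tau> (encircle \<tau> \<alpha>)"
  define xs where "xs = (SOME xs. distinct xs \<and> set xs = ?A)"
  have "distinct xs \<and> set xs = ?A"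
    unfolding xs_def by (rule someI_ex) (use finite_distinct_list[of ?A] in auto)
  then have "edge_exponent \<tau> \<alpha> = sum_list (map (\<lambda>(u, k). axis u (corner_exponent k)) xs)"
    unfolding edge_exponent_def by (metis sum_list_distinct_conv_sum_set)
  moreover have "map (\<lambda>(v, k). corner_weight v k) xs =
      (map weyl (map (\<lambda>(u, k). axis u (corner_exponent k)) xs :: 'v weyl_exponent list)
        :: ('v, 'n) operator list)"
    by (simp add: corner_weight_eq[OF assms] split_beta)
  ultimately show ?thesis
    unfolding iota_bar_def xs_def[symmetric] by (simp only: weyl_prod_weyl[OF assms])
qed

section \<open>The exchange form in terms of edge exponents\<close>

lemma three_cases: "(k :: 3) = 0 \<or> k = 1 \<or> k = 2"
  using exhaust_3[of k] by auto

lemma ex_three: "(\<exists>k :: 3. P k) \<longleftrightarrow> P 0 \<or> P 1 \<or> P 2"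
  using three_cases by metis

lemma UNIV_three: "(UNIV :: 3 set) = {0, 1, 2}"
  using three_cases by auto

lemma three_arith: "(0 :: 3) + 1 = 1" "(1 :: 3) + 1 = 2" "(2 :: 3) + 1 = 0"
  "(0 :: 3) + 2 = 2" "(1 :: 3) + 2 = 0" "(2 :: 3) + 2 = 1"
  "(0 :: 3) \<noteq> 1" "(0 :: 3) \<noteq> 2" "(1 :: 3) \<noteq> 2" "(1 :: 3) \<noteq> 0" "(2 :: 3) \<noteq> 0" "(2 :: 3) \<noteq> 1"
  by simp_all

lemma sum_three: "(\<Sum>k\<in>(UNIV :: 3 set). f k) = f 0 + (f 1 + f 2)"
  unfolding UNIV_three by (simp add: three_arith)

lemma sum_three_shift: "(\<Sum>j\<in>(UNIV :: 3 set). f j) = f k + (f (k + 1) + f (k + 2))"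
proof -
  consider "k = 0" | "k = 1" | "k = 2"
    using three_cases by blast
  then show ?thesis
    by cases (simp_all only: sum_three three_arith, simp_all only: add_ac)
qed

lemma corner_exponent_simps:
  "corner_exponent 0 = (- 1, 0)" "corner_exponent 1 = (1, - 1)" "corner_exponent 2 = (0, 1)"
  by (simp_all add: corner_exponent_def)

lemma corner_exponent_sum: "corner_exponent k + (corner_exponent (k + 1) + corner_exponent (k + 2)) = 0"
  by (subst sum_three_shift[symmetric]) (simp add: sum_three corner_exponent_simps zero_prod_def)

text \<open>The only consequence of the topology of the surface that the combinatorics needs.\<close>

definition slot_bound :: "('v::finite, 's) dotted \<Rightarrow> bool" where
  "slot_bound \<tau> \<longleftrightarrow> (\<forall>\<alpha>. card (slots \<tau> \<alpha>) \<le> 2)"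

lemma slot_bound_three:
  assumes "slot_bound \<tau>" "tri_side \<tau> a i = \<alpha>" "tri_side \<tau> b j = \<alpha>" "tri_side \<tau> c k = \<alpha>"
  shows "(a, i) = (b, j) \<or> (a, i) = (c, k) \<or> (b, j) = (c, k)"
proof (rule ccontr)
  assume "\<not> ?thesis"
  then have "card {(a, i), (b, j), (c, k)} = 3"
    by auto
  moreover have "{(a, i), (b, j), (c, k)} \<subseteq> slots \<tau> \<alpha>"
    using assms by (auto simp: slots_def)
  ultimately have "3 \<le> card (slots \<tau> \<alpha>)"
    by (metis card_mono finite)
  then show False
    using assms(1) unfolding slot_bound_def by (metis Suc_n_not_le_n numeral_2_eq_2 numeral_3_eq_3 order_trans)
qed

definition folded_edge :: "('v, 's) dotted \<Rightarrow> 's set \<Rightarrow> bool" where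
  "folded_edge \<tau> \<alpha> \<longleftrightarrow> (\<exists>v k. folded_at \<tau> v k \<and> tri_side \<tau> v k = \<alpha>)"

lemma encircle_not_folded: "\<not> folded_edge \<tau> \<alpha> \<Longrightarrow> encircle \<tau> \<alpha> = \<alpha>"
  unfolding encircle_def folded_edge_def by (rule if_not_P)

text \<open>The local computation behind \<open>eps\<close>: the exponents (-1,0), (1,-1), (0,1)
  have form 1 on each cyclically consecutive pair. The sides are abstract here so that the case
  distinction stays propositional.\<close>

lemma corner_exponent_form:
  fixes a b :: 'e
  assumes "s0 \<noteq> s1" "s1 \<noteq> s2" "s2 \<noteq> s0"
  defines "E \<equiv> \<lambda>x. (if x = s0 then (- 1, 0) else 0) + ((if x = s1 then (1, - 1) else 0) +
      (if x = s2 then (0, 1) else (0 :: int \<times> int)))"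
  shows "fst (E a) * snd (E b) - snd (E a) * fst (E b) =
    (if a = s0 \<and> b = s1 \<or> a = s1 \<and> b = s2 \<or> a = s2 \<and> b = s0 then 1
     else if b = s0 \<and> a = s1 \<or> b = s1 \<and> a = s2 \<or> b = s2 \<and> a = s0 then - 1 else 0)"
  using assms(1-3) unfolding E_def
  by (cases "a = s0"; cases "a = s1"; cases "a = s2"; cases "b = s0"; cases "b = s1"; cases "b = s2"; simp)

lemma three_succ: "(k :: 3) \<noteq> k + 1" "k \<noteq> k + 2" "k + 1 \<noteq> k + 2" "k + 1 + 1 = k + 2" "k + 2 + 1 = k"
  using three_cases[of k] by (auto simp: three_arith)

lemma edge_exponent_nth:
  "edge_exponent \<tau> \<alpha> $ u =
     (\<Sum>k\<in>UNIV. if tri_side \<tau> u k = \<alpha> \<or> tri_side \<tau> u k = encircle \<tau> \<alpha> then corner_exponent k else 0)"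
proof -
  let ?c = "\<lambda>v k. tri_side \<tau> v k = \<alpha> \<or> tri_side \<tau> v k = encircle \<tau> \<alpha>"
  have "edge_exponent \<tau> \<alpha> $ u =
      (\<Sum>(v, k)\<in>UNIV. if ?c v k then (if v = u then corner_exponent k else 0) else 0)"
    unfolding edge_exponent_def sum_component
  proof (rule sum.mono_neutral_cong_left)
    have mem: "x \<in> slots \<tau> \<alpha> \<union> slots \<tau> (encircle \<tau> \<alpha>) \<longleftrightarrow> ?c (fst x) (snd x)" for x
      by (simp add: slots_def split_beta)
    show "\<forall>x\<in>UNIV - (slots \<tau> \<alpha> \<union> slots \<tau> (encircle \<tau> \<alpha>)).
        (case x of (v, k) \<Rightarrow> if ?c v k then (if v = u then corner_exponent k else 0) else 0) = 0"
    proof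
      fix x assume "x \<in> UNIV - (slots \<tau> \<alpha> \<union> slots \<tau> (encircle \<tau> \<alpha>))"
      then have "\<not> ?c (fst x) (snd x)"
        unfolding Diff_iff mem by blast
      then show "(case x of (v, k) \<Rightarrow> if ?c v k then (if v = u then corner_exponent k else 0) else 0) = 0"
        by (simp add: split_beta)
    qed
    show "(case x of (v, k) \<Rightarrow> axis v (corner_exponent k)) $ u =
        (case x of (v, k) \<Rightarrow> if ?c v k then (if v = u then corner_exponent k else 0) else 0)"
      if "x \<in> slots \<tau> \<alpha> \<union> slots \<tau> (encircle \<tau> \<alpha>)" for x
      using that unfolding mem by (simp add: split_beta axis_def eq_commute)
  qed simp_all
  also have "\<dots> = (\<Sum>v\<in>UNIV. \<Sum>k\<in>UNIV. if ?c v k then (if v = u then corner_exponent k else 0) else 0)"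
    by (simp add: sum.cartesian_product)
  also have "\<dots> = (\<Sum>v\<in>UNIV. if v = u then \<Sum>k\<in>UNIV. if ?c u k then corner_exponent k else 0 else 0)"
  proof (intro sum.cong refl)
    show "(\<Sum>k\<in>UNIV. if ?c v k then (if v = u then corner_exponent k else 0) else 0) =
        (if v = u then \<Sum>k\<in>UNIV. if ?c u k then corner_exponent k else 0 else 0)" for v
      by (cases "v = u") (simp_all cong: if_cong)
  qed
  finally show ?thesis
    by simp
qed

context
  fixes \<tau> :: "('v::finite, 's) dotted"
  assumes bound: "slot_bound \<tau>"
begin

text \<open>Two sides of the folded triangle already fill both slots of the edge.\<close>

lemma folded_at_unique:
  assumes "folded_at \<tau> v k" "tri_side \<tau> v k = \<alpha>" "tri_side \<tau> v' k' = \<alpha>"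
  shows "v' = v" "k' = k \<or> k' = k + 1"
  using slot_bound_three[OF bound, of v k \<alpha> v "k + 1" v' k'] assms three_succ(1)[of k]
  by (auto simp: folded_at_def)

lemma folded_loop_neq: "folded_at \<tau> v k \<Longrightarrow> tri_side \<tau> v (k + 2) \<noteq> tri_side \<tau> v k"
  using folded_at_unique(2)[of v k "tri_side \<tau> v k" v "k + 2"] three_succ[of k] by metis

text \<open>Makes the \<open>THE\<close> in \<open>encircle\<close> usable. The fold sits at a
  unique position k: a second fold at k + 1 would make all three sides equal, giving the edge a
  third slot.\<close>

lemma encircle_folded:
  assumes "folded_at \<tau> v k"
  shows "encircle \<tau> (tri_side \<tau> v k) = tri_side \<tau> v (k + 2)"
proof -
  have "(THE \<beta>. \<exists>v' k'. folded_at \<tau> v' k' \<and> tri_side \<tau> v' k' = tri_side \<tau> v k \<and>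
      \<beta> = tri_side \<tau> v' (k' + 2)) = tri_side \<tau> v (k + 2)"
  proof (rule the_equality)
    fix \<beta> assume "\<exists>v' k'. folded_at \<tau> v' k' \<and> tri_side \<tau> v' k' = tri_side \<tau> v k \<and> \<beta> = tri_side \<tau> v' (k' + 2)"
    then obtain v' k' where *: "folded_at \<tau> v' k'" "tri_side \<tau> v' k' = tri_side \<tau> v k" "\<beta> = tri_side \<tau> v' (k' + 2)"
      by blast
    have "v' = v" "k' = k \<or> k' = k + 1"
      using folded_at_unique[OF assms refl *(2)] by auto
    moreover have "k' \<noteq> k + 1"
    proof
      assume "k' = k + 1"
      then have "tri_side \<tau> v (k + 1) = tri_side \<tau> v (k + 1 + 1)" "tri_side \<tau> v (k + 1) = tri_side \<tau> v k"
        using *(1,2) \<open>v' = v\<close> by (simp_all only: folded_at_def)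
      then show False
        using folded_loop_neq[OF assms] by (simp only: three_succ(4))
    qed
    ultimately show "\<beta> = tri_side \<tau> v (k + 2)"
      using *(3) by auto
  qed (use assms in blast)
  then show ?thesis
    unfolding encircle_def using assms by (subst if_P) blast+
qed

text \<open>Encircling edges are never folded themselves, so \<open>encircle\<close> need not be
  iterated and no edge is encircled by a folded one.\<close>

lemma loop_not_folded:
  assumes "folded_at \<tau> v k"
  shows "\<not> folded_edge \<tau> (tri_side \<tau> v (k + 2))"
proof
  assume "folded_edge \<tau> (tri_side \<tau> v (k + 2))"
  then obtain v' k' where *: "folded_at \<tau> v' k'" "tri_side \<tau> v' k' = tri_side \<tau> v (k + 2)"
    unfolding folded_edge_def by blast
  have "v' = v" "k + 2 = k' \<or> k + 2 = k' + 1"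
    using folded_at_unique[OF *(1,2), of v "k + 2"] by auto
  then have "k' = k + 2 \<or> k' = k + 1"
    using three_cases[of k] three_cases[of k'] by (auto simp: three_arith)
  then show False
  proof
    assume "k' = k + 2"
    then show False
      using *(1) \<open>v' = v\<close> folded_loop_neq[OF assms] by (simp only: folded_at_def three_succ(5))
  next
    assume "k' = k + 1"
    then show False
      using *(2) \<open>v' = v\<close> assms folded_loop_neq[OF assms] by (simp only: folded_at_def)
  qed
qed

lemma side_of_nonfolded_triangle:
  assumes "\<not> self_folded \<tau> u" "tri_side \<tau> u k = \<alpha>"
  shows "encircle \<tau> \<alpha> = \<alpha>"
proof (rule encircle_not_folded)
  show "\<not> folded_edge \<tau> \<alpha>"
  proof
    assume "folded_edge \<tau> \<alpha>"
    then obtain v k' where v: "folded_at \<tau> v k'" "tri_side \<tau> v k' = \<alpha>"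
      unfolding folded_edge_def by blast
    then have "u = v"
      using folded_at_unique(1)[OF v assms(2)] by blast
    then show False
      using v(1) assms(1) unfolding self_folded_def by blast
  qed
qed

text \<open>The form is evaluated triangle by triangle. In a triangle that is not self-folded the
  component of the exponent is read off from the sides equal to the encircling edge, as in
  \<open>eps_tri\<close>. Self-folded triangles, which \<open>eps\<close> omits, have to contribute
  zero.\<close>

lemma eps_eq_weyl_form: "eps \<tau> \<alpha> \<beta> = weyl_form (edge_exponent \<tau> \<alpha>) (edge_exponent \<tau> \<beta>)"
proof -
  let ?w = "\<lambda>u \<alpha> \<beta>. fst (edge_exponent \<tau> \<alpha> $ u) * snd (edge_exponent \<tau> \<beta> $ u) -
      snd (edge_exponent \<tau> \<alpha> $ u) * fst (edge_exponent \<tau> \<beta> $ u)"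
  have nonfolded: "?w u \<alpha> \<beta> = eps_tri \<tau> u \<alpha> \<beta>" if u: "\<not> self_folded \<tau> u" for u
  proof -
    have "tri_side \<tau> u k = \<gamma> \<or> tri_side \<tau> u k = encircle \<tau> \<gamma> \<longleftrightarrow> encircle \<tau> \<gamma> = tri_side \<tau> u k" for k \<gamma>
      using side_of_nonfolded_triangle[OF u, of k \<gamma>]
      by (cases "tri_side \<tau> u k = \<gamma>") (simp_all add: eq_commute)
    then have E: "edge_exponent \<tau> \<gamma> $ u =
        (\<Sum>k\<in>UNIV. if encircle \<tau> \<gamma> = tri_side \<tau> u k then corner_exponent k else 0)" for \<gamma>
      unfolding edge_exponent_nth by simp
    have d: "tri_side \<tau> u 0 \<noteq> tri_side \<tau> u 1" "tri_side \<tau> u 1 \<noteq> tri_side \<tau> u 2"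
      "tri_side \<tau> u 2 \<noteq> tri_side \<tau> u 0"
      using u unfolding self_folded_def folded_at_def ex_three three_arith by blast+
    show ?thesis
      unfolding E sum_three corner_exponent_simps eps_tri_def ex_three three_arith
      by (rule corner_exponent_form[OF d])
  qed
  have folded: "?w u \<alpha> \<beta> = 0" if u: "self_folded \<tau> u" for u
  proof -
    obtain k where k: "folded_at \<tau> u k"
      using u unfolding self_folded_def by blast
    let ?a = "tri_side \<tau> u k" and ?b = "tri_side \<tau> u (k + 2)"
    have sides: "tri_side \<tau> u (k + 1) = ?a" "?b \<noteq> ?a"
      using k folded_loop_neq[OF k] by (auto simp: folded_at_def)
    \<comment> \<open>The folded edge collects all three weights, with sum zero; any other edge sees
      at most the weight of the loop. Two such components are proportional, so the form vanishes on
      them.\<close>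
    have "edge_exponent \<tau> \<gamma> $ u \<in> {0, corner_exponent (k + 2)}" for \<gamma>
    proof (cases "\<gamma> = ?a")
      case True
      then have "edge_exponent \<tau> \<gamma> $ u =
          corner_exponent k + (corner_exponent (k + 1) + corner_exponent (k + 2))"
        unfolding edge_exponent_nth sum_three_shift[of _ k]
        by (simp only: encircle_folded[OF k] sides(1) simp_thms if_True)
      also have "\<dots> = 0"
        by (rule corner_exponent_sum)
      finally show ?thesis
        by simp
    next
      case False
      moreover have "encircle \<tau> \<gamma> \<noteq> ?a"
      proof (cases "folded_edge \<tau> \<gamma>")
        case True
        then obtain v' k' where "folded_at \<tau> v' k'" "tri_side \<tau> v' k' = \<gamma>"
          unfolding folded_edge_def by blast
        then have "\<not> folded_edge \<tau> (encircle \<tau> \<gamma>)"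
          using encircle_folded loop_not_folded by metis
        then show ?thesis
          using k unfolding folded_edge_def by blast
      qed (use False encircle_not_folded in metis)
      ultimately show ?thesis
        unfolding edge_exponent_nth sum_three_shift[of _ k] sides(1)
        by (cases "?b = \<gamma> \<or> ?b = encircle \<tau> \<gamma>") (simp_all only: eq_commute[of ?a] simp_thms if_True if_False
          insert_iff empty_iff add_0)
    qed
    then have "edge_exponent \<tau> \<alpha> $ u \<in> {0, corner_exponent (k + 2)}"
      "edge_exponent \<tau> \<beta> $ u \<in> {0, corner_exponent (k + 2)}"
      by blast+
    then show ?thesis
      by (auto simp: mult.commute)
  qed
  have "weyl_form (edge_exponent \<tau> \<alpha>) (edge_exponent \<tau> \<beta>) =
      (\<Sum>u\<in>UNIV. if \<not> self_folded \<tau> u then eps_tri \<tau> u \<alpha> \<beta> else 0)"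
    unfolding weyl_form_def using nonfolded folded by (intro sum.cong refl) auto
  also have "\<dots> = eps \<tau> \<alpha> \<beta>"
    unfolding eps_def by (simp add: sum.If_cases)
  finally show ?thesis ..
qed

end

section \<open>Edge exponents under a flip\<close>

text \<open>The effect of conjugation by \<open>S_op v w\<close> on exponents: U_v goes to U_v U_w,
  P_w to the inverse of P_v times P_w, while P_v and U_w are fixed.\<close>

definition flip_exponent :: "'v::finite \<Rightarrow> 'v \<Rightarrow> 'v weyl_exponent \<Rightarrow> 'v weyl_exponent" where
  "flip_exponent v w x =
     (\<chi> u. if u = v then (fst (x $ v), snd (x $ v) - snd (x $ w))
           else if u = w then (fst (x $ w) + fst (x $ v), snd (x $ w)) else x $ u)"

text \<open>Only the slots of the edge itself, without those of the encircling edge. The flip is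
  uniform at this level; the correction for folded edges is added afterwards.\<close>

definition edge_sum :: "('v::finite, 's) dotted \<Rightarrow> 's set \<Rightarrow> 'v weyl_exponent" where
  "edge_sum \<tau> \<alpha> = (\<chi> u. \<Sum>k\<in>UNIV. if tri_side \<tau> u k = \<alpha> then corner_exponent k else 0)"

lemma flip_exponent_add: "flip_exponent v w (x + y) = flip_exponent v w x + flip_exponent v w y"
  by (simp add: flip_exponent_def vec_eq_iff prod_eq_iff)

lemma edge_exponent_eq_edge_sum:
  "edge_exponent \<tau> \<alpha> =
     (if encircle \<tau> \<alpha> = \<alpha> then edge_sum \<tau> \<alpha> else edge_sum \<tau> \<alpha> + edge_sum \<tau> (encircle \<tau> \<alpha>))"
proof (cases "encircle \<tau> \<alpha> = \<alpha>")
  case True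
  then show ?thesis
    by (simp add: vec_eq_iff edge_exponent_nth edge_sum_def)
next
  case False
  have "(if P \<or> Q then c else 0) = (if P then c else 0) + (if Q then c else (0 :: int \<times> int))"
    if "\<not> (P \<and> Q)" for P Q c
    using that by auto
  then have "(if tri_side \<tau> u k = \<alpha> \<or> tri_side \<tau> u k = encircle \<tau> \<alpha> then corner_exponent k else 0) =
      (if tri_side \<tau> u k = \<alpha> then corner_exponent k else 0) +
      (if tri_side \<tau> u k = encircle \<tau> \<alpha> then corner_exponent k else 0)" for u k
    using False by simp
  then show ?thesis
    using False by (simp add: vec_eq_iff edge_exponent_nth edge_sum_def sum.distrib)
qed

section \<open>The square of a flip, whose outer sides may be glued to one another\<close>

context
  fixes \<tau>1 \<tau>2 :: "('v::finite, 's) dotted" and v w :: 'v and \<kappa> \<kappa>' ab bc cd da :: "'s set"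
  assumes bound1: "slot_bound \<tau>1" and bound2: "slot_bound \<tau>2" and vw: "v \<noteq> w"
    and same: "\<And>u. u \<noteq> v \<Longrightarrow> u \<noteq> w \<Longrightarrow> tri_side \<tau>2 u = tri_side \<tau>1 u"
    and v1: "tri_side \<tau>1 v 0 = ab" "tri_side \<tau>1 v 1 = \<kappa>" "tri_side \<tau>1 v 2 = da"
    and w1: "tri_side \<tau>1 w 0 = bc" "tri_side \<tau>1 w 1 = cd" "tri_side \<tau>1 w 2 = \<kappa>"
    and v2: "tri_side \<tau>2 v 0 = \<kappa>'" "tri_side \<tau>2 v 1 = cd" "tri_side \<tau>2 v 2 = da"
    and w2: "tri_side \<tau>2 w 0 = bc" "tri_side \<tau>2 w 1 = \<kappa>'" "tri_side \<tau>2 w 2 = ab"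
begin

lemma kappa_slots:
  assumes "tri_side \<tau>1 u k = \<kappa>"
  shows "(u, k) = (v, 1) \<or> (u, k) = (w, 2)"
  using slot_bound_three[OF bound1 v1(2) w1(3) assms] vw by blast

lemma kappa'_slots:
  assumes "tri_side \<tau>2 u k = \<kappa>'"
  shows "(u, k) = (v, 0) \<or> (u, k) = (w, 1)"
  using slot_bound_three[OF bound2 v2(1) w2(2) assms] vw by blast

lemma kappa_neq: "ab \<noteq> \<kappa>" "bc \<noteq> \<kappa>" "cd \<noteq> \<kappa>" "da \<noteq> \<kappa>"
  using kappa_slots[of v 0] kappa_slots[of v 2] kappa_slots[of w 0] kappa_slots[of w 1] v1 w1 vw
  by (auto simp only: prod.inject three_arith)

lemma kappa'_neq: "ab \<noteq> \<kappa>'" "bc \<noteq> \<kappa>'" "cd \<noteq> \<kappa>'" "da \<noteq> \<kappa>'"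
  using kappa'_slots[of v 1] kappa'_slots[of v 2] kappa'_slots[of w 0] kappa'_slots[of w 2] v2 w2 vw
  by (auto simp only: prod.inject three_arith)

lemma encircle_kappa: "encircle \<tau>1 \<kappa> = \<kappa>"
proof (rule encircle_not_folded)
  show "\<not> folded_edge \<tau>1 \<kappa>"
  proof
    assume "folded_edge \<tau>1 \<kappa>"
    then obtain u k where u: "tri_side \<tau>1 u k = \<kappa>" "tri_side \<tau>1 u (k + 1) = \<kappa>"
      unfolding folded_edge_def folded_at_def by metis
    then show False
      using kappa_slots[OF u(1)] kappa_slots[OF u(2)] vw three_succ(1)[of k] by auto
  qed
qed

lemma encircle_kappa': "encircle \<tau>2 \<kappa>' = \<kappa>'"
proof (rule encircle_not_folded)
  show "\<not> folded_edge \<tau>2 \<kappa>'"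
  proof
    assume "folded_edge \<tau>2 \<kappa>'"
    then obtain u k where u: "tri_side \<tau>2 u k = \<kappa>'" "tri_side \<tau>2 u (k + 1) = \<kappa>'"
      unfolding folded_edge_def folded_at_def by metis
    then show False
      using kappa'_slots[OF u(1)] kappa'_slots[OF u(2)] vw three_succ(1)[of k] by auto
  qed
qed

lemma edge_sum_kappa: "edge_sum \<tau>1 \<kappa> $ u = (if u = v then (1, - 1) else if u = w then (0, 1) else 0)"
proof -
  consider "u = v" | "u = w" | "u \<noteq> v" "u \<noteq> w"
    by blast
  then show ?thesis
  proof cases
    case 3
    then have "tri_side \<tau>1 u k \<noteq> \<kappa>" for k
      using kappa_slots[of u k] by blast
    then show ?thesis
      using 3 by (simp add: edge_sum_def)
  qed (use vw kappa_neq in \<open>simp_all add: edge_sum_def sum_three corner_exponent_simps v1 w1\<close>)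
qed

lemma edge_sum_kappa': "edge_sum \<tau>2 \<kappa>' $ u = (if u = v then (- 1, 0) else if u = w then (1, - 1) else 0)"
proof -
  consider "u = v" | "u = w" | "u \<noteq> v" "u \<noteq> w"
    by blast
  then show ?thesis
  proof cases
    case 3
    then have "tri_side \<tau>2 u k \<noteq> \<kappa>'" for k
      using kappa'_slots[of u k] by blast
    then show ?thesis
      using 3 by (simp add: edge_sum_def)
  qed (use vw kappa'_neq in \<open>simp_all add: edge_sum_def sum_three corner_exponent_simps v2 w2\<close>)
qed

lemma flip_edge_sum_kappa': "flip_exponent v w (edge_sum \<tau>2 \<kappa>') = - edge_sum \<tau>1 \<kappa>"
  using vw by (simp add: vec_eq_iff flip_exponent_def edge_sum_kappa edge_sum_kappa' zero_prod_def)

text \<open>The sides \<open>bc\<close> and \<open>da\<close> keep their triangle and their weight,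
  while \<open>ab\<close> and \<open>cd\<close> change triangle and each pick up one copy of the
  exponent of \<kappa>. The truth values count occurrences, which covers
  \<open>ab = cd\<close>.\<close>

lemma flip_edge_sum:
  assumes "\<alpha> \<noteq> \<kappa>" "\<alpha> \<noteq> \<kappa>'"
  shows "flip_exponent v w (edge_sum \<tau>2 \<alpha>) =
    edge_sum \<tau>1 \<alpha> + weyl_scale (of_bool (ab = \<alpha>) + of_bool (cd = \<alpha>)) (edge_sum \<tau>1 \<kappa>)"
proof -
  have "flip_exponent v w (edge_sum \<tau>2 \<alpha>) $ u =
    (edge_sum \<tau>1 \<alpha> + weyl_scale (of_bool (ab = \<alpha>) + of_bool (cd = \<alpha>)) (edge_sum \<tau>1 \<kappa>)) $ u" for u
  proof -
    have c: "\<kappa> \<noteq> \<alpha>" "\<kappa>' \<noteq> \<alpha>"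
      using assms by auto
    have E2: "edge_sum \<tau>2 \<alpha> $ v = (if cd = \<alpha> then (1, - 1) else 0) + (if da = \<alpha> then (0, 1) else 0)"
      "edge_sum \<tau>2 \<alpha> $ w = (if bc = \<alpha> then (- 1, 0) else 0) + (if ab = \<alpha> then (0, 1) else 0)"
      using c by (simp_all add: edge_sum_def sum_three corner_exponent_simps v2 w2)
    have E1: "edge_sum \<tau>1 \<alpha> $ v = (if ab = \<alpha> then (- 1, 0) else 0) + (if da = \<alpha> then (0, 1) else 0)"
      "edge_sum \<tau>1 \<alpha> $ w = (if bc = \<alpha> then (- 1, 0) else 0) + (if cd = \<alpha> then (1, - 1) else 0)"
      using c by (simp_all add: edge_sum_def sum_three corner_exponent_simps v1 w1)
    consider "u = v" | "u = w" | "u \<noteq> v" "u \<noteq> w"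
      by blast
    then show ?thesis
    proof cases
      case 1
      then show ?thesis
        using vw by (simp add: flip_exponent_def weyl_scale_def E1 E2 edge_sum_kappa)
    next
      case 2
      then show ?thesis
        using vw by (simp add: flip_exponent_def weyl_scale_def E1 E2 edge_sum_kappa)
    next
      case 3
      then have "edge_sum \<tau>1 \<kappa> $ u = 0" "edge_sum \<tau>2 \<alpha> $ u = edge_sum \<tau>1 \<alpha> $ u"
        by (simp add: edge_sum_kappa, simp add: edge_sum_def same)
      then show ?thesis
        using 3 by (simp add: flip_exponent_def weyl_scale_def zero_prod_def)
    qed
  qed
  then show ?thesis
    by (simp add: vec_eq_iff)
qed

text \<open>To be compared with \<open>flip_edge_sum\<close>: there the occurrences in
  \<open>ab\<close> and \<open>cd\<close> are counted, here those in \<open>bc\<close> and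
  \<open>da\<close> are subtracted. The positive part of this number equals the former count unless
  both kinds of sides occur.\<close>

lemma weyl_form_edge_sum_kappa:
  assumes "\<alpha> \<noteq> \<kappa>"
  shows "weyl_form (edge_sum \<tau>1 \<alpha>) (edge_sum \<tau>1 \<kappa>) =
    of_bool (ab = \<alpha>) + of_bool (cd = \<alpha>) - of_bool (bc = \<alpha>) - of_bool (da = \<alpha>)"
proof -
  let ?t = "\<lambda>u. fst (edge_sum \<tau>1 \<alpha> $ u) * snd (edge_sum \<tau>1 \<kappa> $ u) -
      snd (edge_sum \<tau>1 \<alpha> $ u) * fst (edge_sum \<tau>1 \<kappa> $ u)"
  have c: "\<kappa> \<noteq> \<alpha>"
    using assms by auto
  have E1: "edge_sum \<tau>1 \<alpha> $ v = (if ab = \<alpha> then (- 1, 0) else 0) + (if da = \<alpha> then (0, 1) else 0)"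
    "edge_sum \<tau>1 \<alpha> $ w = (if bc = \<alpha> then (- 1, 0) else 0) + (if cd = \<alpha> then (1, - 1) else 0)"
    using c by (simp_all add: edge_sum_def sum_three corner_exponent_simps v1 w1)
  have "weyl_form (edge_sum \<tau>1 \<alpha>) (edge_sum \<tau>1 \<kappa>) = (\<Sum>u\<in>{v, w}. ?t u)"
    unfolding weyl_form_def by (rule sum.mono_neutral_right) (auto simp: edge_sum_kappa)
  also have "\<dots> = ?t v + ?t w"
    using vw by simp
  finally show ?thesis
    using vw by (simp add: edge_sum_kappa E1)
qed

lemma edge_exponent_kappa: "edge_exponent \<tau>1 \<kappa> = edge_sum \<tau>1 \<kappa>"
  by (simp add: edge_exponent_eq_edge_sum encircle_kappa)

lemma flip_edge_exponent_kappa': "flip_exponent v w (edge_exponent \<tau>2 \<kappa>') = - edge_exponent \<tau>1 \<kappa>"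
  by (simp add: edge_exponent_eq_edge_sum encircle_kappa encircle_kappa' flip_edge_sum_kappa')

text \<open>A fold inside the square cannot involve \<kappa>, whose two slots lie in different
  triangles. Only a fold at the corner a of \<open>v\<close> or at the corner c of \<open>w\<close>
  remains, and then \<kappa> is the encircling loop.\<close>

lemma folded_edge_flip_cases:
  assumes "folded_edge \<tau>1 \<alpha>"
  obtains "ab = \<alpha>" "da = \<alpha>" "encircle \<tau>1 \<alpha> = \<kappa>"
    | "bc = \<alpha>" "cd = \<alpha>" "encircle \<tau>1 \<alpha> = \<kappa>"
    | u k where "u \<noteq> v" "u \<noteq> w" "folded_at \<tau>1 u k" "tri_side \<tau>1 u k = \<alpha>"
proof -
  obtain u k where u: "folded_at \<tau>1 u k" "tri_side \<tau>1 u k = \<alpha>"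
    using assms unfolding folded_edge_def by blast
  have enc: "encircle \<tau>1 \<alpha> = tri_side \<tau>1 u (k + 2)"
    using encircle_folded[OF bound1 u(1)] u(2) by simp
  have next_side: "tri_side \<tau>1 u (k + 1) = \<alpha>"
    using u unfolding folded_at_def by simp
  consider "u = v" "k = 0" | "u = v" "k = 1" | "u = v" "k = 2" | "u = w" "k = 0" | "u = w" "k = 1"
    | "u = w" "k = 2" | "u \<noteq> v" "u \<noteq> w"
    using three_cases[of k] by blast
  then show ?thesis
  proof cases
    case 3
    then have "da = \<alpha>" "ab = \<alpha>" "encircle \<tau>1 \<alpha> = \<kappa>"
      using u(2) next_side enc v1 by (simp_all only: three_arith)
    then show ?thesis
      using that(1) by blast
  next
    case 4
    then have "bc = \<alpha>" "cd = \<alpha>" "encircle \<tau>1 \<alpha> = \<kappa>"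
      using u(2) next_side enc w1 by (simp_all only: three_arith)
    then show ?thesis
      using that(2) by blast
  next
    case 7
    then show ?thesis
      using that(3) u by blast
  next
    case 1
    then have "tri_side \<tau>1 v 0 = \<alpha>" "tri_side \<tau>1 v 1 = \<alpha>"
      using u(2) next_side by (simp_all only: three_arith)
    then show ?thesis
      using v1 kappa_neq by simp
  next
    case 2
    then have "tri_side \<tau>1 v 1 = \<alpha>" "tri_side \<tau>1 v 2 = \<alpha>"
      using u(2) next_side by (simp_all only: three_arith)
    then show ?thesis
      using v1 kappa_neq by simp
  next
    case 5
    then have "tri_side \<tau>1 w 1 = \<alpha>" "tri_side \<tau>1 w 2 = \<alpha>"
      using u(2) next_side by (simp_all only: three_arith)
    then show ?thesis
      using w1 kappa_neq by simp
  next
    case 6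
    then have "tri_side \<tau>1 w 2 = \<alpha>" "tri_side \<tau>1 w 0 = \<alpha>"
      using u(2) next_side by (simp_all only: three_arith)
    then show ?thesis
      using w1 kappa_neq by simp
  qed
qed

lemma folded_edge_flip_cases':
  assumes "folded_edge \<tau>2 \<alpha>"
  obtains "cd = \<alpha>" "da = \<alpha>" "encircle \<tau>2 \<alpha> = \<kappa>'"
    | "ab = \<alpha>" "bc = \<alpha>" "encircle \<tau>2 \<alpha> = \<kappa>'"
    | u k where "u \<noteq> v" "u \<noteq> w" "folded_at \<tau>2 u k" "tri_side \<tau>2 u k = \<alpha>"
proof -
  obtain u k where u: "folded_at \<tau>2 u k" "tri_side \<tau>2 u k = \<alpha>"
    using assms unfolding folded_edge_def by blast
  have enc: "encircle \<tau>2 \<alpha> = tri_side \<tau>2 u (k + 2)"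
    using encircle_folded[OF bound2 u(1)] u(2) by simp
  have next_side: "tri_side \<tau>2 u (k + 1) = \<alpha>"
    using u unfolding folded_at_def by simp
  consider "u = v" "k = 0" | "u = v" "k = 1" | "u = v" "k = 2" | "u = w" "k = 0" | "u = w" "k = 1"
    | "u = w" "k = 2" | "u \<noteq> v" "u \<noteq> w"
    using three_cases[of k] by blast
  then show ?thesis
  proof cases
    case 2
    then have "cd = \<alpha>" "da = \<alpha>" "encircle \<tau>2 \<alpha> = \<kappa>'"
      using u(2) next_side enc v2 by (simp_all only: three_arith)
    then show ?thesis
      using that(1) by blast
  next
    case 6
    then have "ab = \<alpha>" "bc = \<alpha>" "encircle \<tau>2 \<alpha> = \<kappa>'"
      using u(2) next_side enc w2 by (simp_all only: three_arith)
    then show ?thesis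
      using that(2) by blast
  next
    case 7
    then show ?thesis
      using that(3) u by blast
  next
    case 1
    then have "tri_side \<tau>2 v 0 = \<alpha>" "tri_side \<tau>2 v 1 = \<alpha>"
      using u(2) next_side by (simp_all only: three_arith)
    then show ?thesis
      using v2 kappa'_neq by simp
  next
    case 3
    then have "tri_side \<tau>2 v 2 = \<alpha>" "tri_side \<tau>2 v 0 = \<alpha>"
      using u(2) next_side by (simp_all only: three_arith)
    then show ?thesis
      using v2 kappa'_neq by simp
  next
    case 4
    then have "tri_side \<tau>2 w 0 = \<alpha>" "tri_side \<tau>2 w 1 = \<alpha>"
      using u(2) next_side by (simp_all only: three_arith)
    then show ?thesis
      using w2 kappa'_neq by simp
  next
    case 5
    then have "tri_side \<tau>2 w 1 = \<alpha>" "tri_side \<tau>2 w 2 = \<alpha>"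
      using u(2) next_side by (simp_all only: three_arith)
    then show ?thesis
      using w2 kappa'_neq by simp
  qed
qed

text \<open>Gluing a side of one kind to an adjacent side makes the count of
  \<open>flip_edge_sum\<close> exceed the positive part of \<open>eps\<close> by one. Exactly then
  the edge is folded in one of the two triangulations, with \<kappa> or \<kappa>' as its loop, and
  the exponent of that loop contained in \<open>edge_exponent\<close> restores the balance. An edge
  folded outside the square contributes through its loop only.\<close>

lemma flip_edge_exponent:
  assumes "\<alpha> \<noteq> \<kappa>" "\<alpha> \<noteq> \<kappa>'"
  shows "flip_exponent v w (edge_exponent \<tau>2 \<alpha>) =
    edge_exponent \<tau>1 \<alpha> + weyl_scale (max 0 (eps \<tau>1 \<alpha> \<kappa>)) (edge_exponent \<tau>1 \<kappa>)"
proof -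
  let ?n = "\<lambda>\<alpha>. of_bool (ab = \<alpha>) + of_bool (cd = \<alpha>) :: int"
    and ?m = "\<lambda>\<alpha>. of_bool (bc = \<alpha>) + of_bool (da = \<alpha>) :: int"
  have eps: "eps \<tau>1 \<alpha> \<kappa> = weyl_form (edge_exponent \<tau>1 \<alpha>) (edge_sum \<tau>1 \<kappa>)"
    unfolding eps_eq_weyl_form[OF bound1] edge_exponent_kappa ..
  note F = flip_edge_sum[OF assms] and form = weyl_form_edge_sum_kappa[OF assms(1)]
  have outside: "ab \<noteq> \<alpha> \<and> bc \<noteq> \<alpha> \<and> cd \<noteq> \<alpha> \<and> da \<noteq> \<alpha>"
    if "folded_at \<tau>1 u k" "tri_side \<tau>1 u k = \<alpha>" "u \<noteq> v" "u \<noteq> w" for u k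
    using folded_at_unique(1)[OF bound1 that(1,2), of v 0] folded_at_unique(1)[OF bound1 that(1,2), of v 2]
      folded_at_unique(1)[OF bound1 that(1,2), of w 0] folded_at_unique(1)[OF bound1 that(1,2), of w 1]
      v1 w1 that(3,4) by metis
  have fold_iff: "folded_at \<tau>1 u k \<longleftrightarrow> folded_at \<tau>2 u k" "tri_side \<tau>2 u k = tri_side \<tau>1 u k"
    if "u \<noteq> v" "u \<noteq> w" for u k
    using same[OF that] unfolding folded_at_def by simp_all
  \<comment> \<open>If \<alpha> occurs among both kinds of sides, two neighbouring sides of the
    square coincide, and each of the four corners of such a coincidence is a folded corner before or
    after the flip.\<close>
  have square_folded: "max 0 (?n \<alpha> - ?m \<alpha>) = ?n \<alpha> \<or> folded_edge \<tau>1 \<alpha> \<or> folded_edge \<tau>2 \<alpha>"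
  proof -
    have "folded_at \<tau>1 v 2" if "ab = da"
      unfolding folded_at_def three_arith using that v1 by simp
    moreover have "folded_at \<tau>1 w 0" if "bc = cd"
      unfolding folded_at_def three_arith using that w1 by simp
    moreover have "folded_at \<tau>2 v 1" if "cd = da"
      unfolding folded_at_def three_arith using that v2 by simp
    moreover have "folded_at \<tau>2 w 2" if "ab = bc"
      unfolding folded_at_def three_arith using that w2 by simp
    ultimately have *: "ab = da \<Longrightarrow> folded_edge \<tau>1 ab" "bc = cd \<Longrightarrow> folded_edge \<tau>1 bc"
      "cd = da \<Longrightarrow> folded_edge \<tau>2 cd" "ab = bc \<Longrightarrow> folded_edge \<tau>2 ab"
      unfolding folded_edge_def using v1 w1 v2 w2 by metis+
    show ?thesis
    proof (cases "ab = \<alpha> \<or> cd = \<alpha>")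
      case True
      then show ?thesis
      proof (cases "bc = \<alpha> \<or> da = \<alpha>")
        case True
        then show ?thesis
          using \<open>ab = \<alpha> \<or> cd = \<alpha>\<close> * by metis
      qed auto
    qed auto
  qed
  show ?thesis
  proof (cases "folded_edge \<tau>1 \<alpha>")
    case True
    then show ?thesis
    proof (cases rule: folded_edge_flip_cases)
      case 1
      have "tri_side \<tau>1 v 0 = \<alpha>" "tri_side \<tau>1 v 2 = \<alpha>"
        using 1 v1 by simp_all
      then have other: "cd \<noteq> \<alpha>" "bc \<noteq> \<alpha>"
        using slot_bound_three[OF bound1, of v 0 \<alpha> v 2 w 1] slot_bound_three[OF bound1, of v 0 \<alpha> v 2 w 0]
          w1 vw three_arith by blast+
      have "\<not> folded_edge \<tau>2 \<alpha>"
      proof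
        assume "folded_edge \<tau>2 \<alpha>"
        then show False
        proof (cases rule: folded_edge_flip_cases')
          case (3 u k)
          then show False
            using outside[of u k] fold_iff[of u k] 1 by metis
        qed (use other in blast)+
      qed
      then have "encircle \<tau>2 \<alpha> = \<alpha>"
        by (rule encircle_not_folded)
      then have E2: "edge_exponent \<tau>2 \<alpha> = edge_sum \<tau>2 \<alpha>"
        by (simp add: edge_exponent_eq_edge_sum)
      have E1: "edge_exponent \<tau>1 \<alpha> = edge_sum \<tau>1 \<alpha> + edge_sum \<tau>1 \<kappa>"
        using 1(3) assms(1) by (simp add: edge_exponent_eq_edge_sum)
      have "eps \<tau>1 \<alpha> \<kappa> = 0"
        using 1 other by (simp add: eps E1 weyl_form_simps form)
      then show ?thesis
        using 1 other by (simp add: E1 E2 F weyl_scale_def vec_eq_iff zero_prod_def)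
    next
      case 2
      have "tri_side \<tau>1 w 0 = \<alpha>" "tri_side \<tau>1 w 1 = \<alpha>"
        using 2 w1 by simp_all
      then have other: "ab \<noteq> \<alpha>" "da \<noteq> \<alpha>"
        using slot_bound_three[OF bound1, of w 0 \<alpha> w 1 v 0] slot_bound_three[OF bound1, of w 0 \<alpha> w 1 v 2]
          v1 vw three_arith by blast+
      have "\<not> folded_edge \<tau>2 \<alpha>"
      proof
        assume "folded_edge \<tau>2 \<alpha>"
        then show False
        proof (cases rule: folded_edge_flip_cases')
          case (3 u k)
          then show False
            using outside[of u k] fold_iff[of u k] 2 by metis
        qed (use other in blast)+
      qed
      then have "encircle \<tau>2 \<alpha> = \<alpha>"
        by (rule encircle_not_folded)
      then have E2: "edge_exponent \<tau>2 \<alpha> = edge_sum \<tau>2 \<alpha>"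
        by (simp add: edge_exponent_eq_edge_sum)
      have E1: "edge_exponent \<tau>1 \<alpha> = edge_sum \<tau>1 \<alpha> + edge_sum \<tau>1 \<kappa>"
        using 2(3) assms(1) by (simp add: edge_exponent_eq_edge_sum)
      have "eps \<tau>1 \<alpha> \<kappa> = 0"
        using 2 other by (simp add: eps E1 weyl_form_simps form)
      then show ?thesis
        using 2 other by (simp add: E1 E2 F weyl_scale_def vec_eq_iff zero_prod_def)
    next
      case (3 u k)
      note out = outside[OF 3(3,4,1,2)]
      let ?b = "tri_side \<tau>1 u (k + 2)"
      have enc: "encircle \<tau>1 \<alpha> = ?b" "encircle \<tau>2 \<alpha> = ?b"
        using encircle_folded[OF bound1 3(3)] encircle_folded[OF bound2, of u k] fold_iff[OF 3(1,2)] 3(3,4)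
        by simp_all
      have b: "?b \<noteq> \<alpha>" "?b \<noteq> \<kappa>" "?b \<noteq> \<kappa>'"
        using folded_loop_neq[OF bound1 3(3)] 3 kappa_slots[of u "k + 2"] kappa'_slots[of u "k + 2"]
          fold_iff(2)[OF 3(1,2), of "k + 2"] by auto
      have E: "edge_exponent \<tau>1 \<alpha> = edge_sum \<tau>1 \<alpha> + edge_sum \<tau>1 ?b"
        "edge_exponent \<tau>2 \<alpha> = edge_sum \<tau>2 \<alpha> + edge_sum \<tau>2 ?b"
        using enc b by (simp_all add: edge_exponent_eq_edge_sum)
      have eps': "eps \<tau>1 \<alpha> \<kappa> = ?n ?b - ?m ?b"
        unfolding eps E weyl_form_add_left form weyl_form_edge_sum_kappa[OF b(2)] using out by simp
      \<comment> \<open>The loop has one of its two slots in the folded triangle \<open>u\<close>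
        outside the square, so at most one side of the square can equal it.\<close>
      have one: "?n ?b = 0 \<or> ?m ?b = 0"
      proof (rule ccontr)
        assume "\<not> ?thesis"
        then have *: "(ab = ?b \<or> cd = ?b) \<and> (bc = ?b \<or> da = ?b)"
          by (simp split: if_splits add: of_bool_def)
        have two: "(a, i) = (b, j)" if "tri_side \<tau>1 a i = ?b" "tri_side \<tau>1 b j = ?b" "a \<noteq> u" "b \<noteq> u" for a b i j
          using slot_bound_three[OF bound1 refl that(1,2)] that(3,4) by blast
        show False
          using * two[of v 0 v 2] two[of v 0 w 0] two[of w 1 v 2] two[of w 1 w 0] v1 w1 vw 3(1,2)
          by (elim conjE disjE) (simp_all add: three_arith)
      qed
      then have "max 0 (eps \<tau>1 \<alpha> \<kappa>) = ?n ?b"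
        unfolding eps' by (cases "ab = ?b"; cases "cd = ?b"; cases "bc = ?b"; cases "da = ?b"; simp)
      then show ?thesis
        unfolding E flip_exponent_add F flip_edge_sum[OF b(2,3)] edge_exponent_kappa
        using out by (simp add: weyl_scale_def vec_eq_iff zero_prod_def)
    qed
  next
    case not1: False
    then have E1: "edge_exponent \<tau>1 \<alpha> = edge_sum \<tau>1 \<alpha>"
      by (simp add: edge_exponent_eq_edge_sum encircle_not_folded)
    show ?thesis
    proof (cases "folded_edge \<tau>2 \<alpha>")
      case True
      \<comment> \<open>The copy of \<kappa> gained from the flip cancels against the image of the
        loop \<kappa>', which is minus the exponent of \<kappa>.\<close>
      have key: ?thesis if enc: "encircle \<tau>2 \<alpha> = \<kappa>'" and n: "?n \<alpha> = 1" and m: "?m \<alpha> = 1"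
      proof -
        have E2: "edge_exponent \<tau>2 \<alpha> = edge_sum \<tau>2 \<alpha> + edge_sum \<tau>2 \<kappa>'"
          using enc assms(2) by (simp add: edge_exponent_eq_edge_sum)
        have "eps \<tau>1 \<alpha> \<kappa> = 0"
          unfolding eps E1 form using n m by simp
        then show ?thesis
          unfolding E1 E2 flip_exponent_add F flip_edge_sum_kappa' n
          by (simp add: weyl_scale_def vec_eq_iff zero_prod_def)
      qed
      from True show ?thesis
      proof (cases rule: folded_edge_flip_cases')
        case 1
        have "tri_side \<tau>2 v 1 = \<alpha>" "tri_side \<tau>2 v 2 = \<alpha>"
          using 1 v2 by simp_all
        then have "ab \<noteq> \<alpha>" "bc \<noteq> \<alpha>"
          using slot_bound_three[OF bound2, of v 1 \<alpha> v 2 w 2] slot_bound_three[OF bound2, of v 1 \<alpha> v 2 w 0]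
            w2 vw three_arith by blast+
        then show ?thesis
          using key 1 by simp
      next
        case 2
        have "tri_side \<tau>2 w 0 = \<alpha>" "tri_side \<tau>2 w 2 = \<alpha>"
          using 2 w2 by simp_all
        then have "cd \<noteq> \<alpha>" "da \<noteq> \<alpha>"
          using slot_bound_three[OF bound2, of w 0 \<alpha> w 2 v 1] slot_bound_three[OF bound2, of w 0 \<alpha> w 2 v 2]
            v2 vw three_arith by blast+
        then show ?thesis
          using key 2 by simp
      next
        case (3 u k)
        then show ?thesis
          using not1 fold_iff[of u k] unfolding folded_edge_def by metis
      qed
    next
      case False
      then have E2: "edge_exponent \<tau>2 \<alpha> = edge_sum \<tau>2 \<alpha>"
        by (simp add: edge_exponent_eq_edge_sum encircle_not_folded)
      have "max 0 (eps \<tau>1 \<alpha> \<kappa>) = ?n \<alpha>"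
        using square_folded False not1 unfolding eps E1 form by (simp add: algebra_simps)
      then show ?thesis
        unfolding E1 E2 F edge_exponent_kappa by simp
    qed
  qed
qed

end

section \<open>The operator of a dot rotation\<close>

text \<open>An element of order three in SL_2(Z) acting at the site v. It permutes the three corner
  exponents cyclically: (-1,0) to (1,-1) to (0,1) to (-1,0).\<close>

definition rotation_exponent :: "'v::finite \<Rightarrow> 'v weyl_exponent \<Rightarrow> 'v weyl_exponent" where
  "rotation_exponent v x =
     (\<chi> u. if u = v then (- fst (x $ v) - snd (x $ v), fst (x $ v)) else x $ u)"

text \<open>Frees the entries from the canonical representatives: any integers in the residue
  classes may be used in the exponent.\<close>

lemma A1_entry:
  fixes m k :: "'n::finite mod_ring"
  assumes "odd CARD('n)" "[to_int_mod_ring m = M] (mod int CARD('n))"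
    "[to_int_mod_ring k = K] (mod int CARD('n))"
  shows "A1 $ m $ k =
    of_real (real CARD('n) powr (- 1 / 2)) * cis (pi / 2 * ((1 - real CARD('n)) / 6)) *
      qroot CARD('n) powi (- (M\<^sup>2) - 2 * K * M)"
proof -
  let ?m = "to_int_mod_ring m" and ?k = "to_int_mod_ring k"
  have "inverse (gauss CARD('n) ?m) * qroot CARD('n) powi (- 2 * ?k * ?m) =
      qroot CARD('n) powi (- (?m\<^sup>2) + (- 2 * ?k * ?m))"
    unfolding gauss_def power_int_minus[symmetric] by (rule power_int_add[symmetric]) simp
  also have "\<dots> = qroot CARD('n) powi (- (M\<^sup>2) + (- 2 * K * M))"
    using assms by (intro qroot_powi_cong assms(1) cong_add cong_mult cong_refl cong_pow
        iffD2[OF cong_minus_minus_iff]) auto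
  finally show ?thesis
    by (simp add: A1_def mult.assoc)
qed

text \<open>The intertwining relation at one site, entry by entry. Shifting M by a in the Gaussian
  exponent -M^2 - 2KM produces exactly the linear terms that distinguish the phases of (a, b) and
  (-a-b, a).\<close>

lemma A1_weyl_site:
  fixes m k :: "'n::finite mod_ring"
  assumes odd: "odd CARD('n)"
  shows "A1 $ m $ (k + of_int_mod_ring b) * qroot CARD('n) powi (2 * a * to_int_mod_ring k + a * b) =
    qroot CARD('n) powi (2 * (- a - b) * to_int_mod_ring (m - of_int_mod_ring a) + (- a - b) * a) *
      A1 $ (m - of_int_mod_ring a) $ k"
proof -
  let ?N = "int CARD('n)" and ?q = "qroot CARD('n)"
  have add: "[to_int_mod_ring (l + of_int_mod_ring c) = to_int_mod_ring l + c] (mod ?N)" for l :: "'n mod_ring" and c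
    by (rule cong_trans[OF to_int_mod_ring_add_cong]) (intro cong_add cong_refl to_int_of_int_mod_ring_cong)
  have sub: "[to_int_mod_ring (m - of_int_mod_ring a) = to_int_mod_ring m - a] (mod ?N)"
    using add[of m "- a"] by (simp add: of_int_mod_ring_uminus)
  have phase: "?q powi (2 * (- a - b) * to_int_mod_ring (m - of_int_mod_ring a) + (- a - b) * a) =
      ?q powi (2 * (- a - b) * (to_int_mod_ring m - a) + (- a - b) * a)"
    by (intro qroot_powi_cong odd cong_add cong_mult cong_refl sub)
  show ?thesis
    unfolding phase A1_entry[OF odd cong_refl add] A1_entry[OF odd sub cong_refl]
    by (simp add: power_int_add[symmetric] power2_eq_square algebra_simps)
qed

lemma weyl_shift_eq_iff: "m = weyl_shift x k \<longleftrightarrow> k = weyl_shift (- x) m"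
proof
  have inv: "weyl_shift x (weyl_shift (- x) m) = m" "weyl_shift (- x) (weyl_shift x k) = k" for m k
    by (simp_all add: weyl_shift_def fun_eq_iff of_int_mod_ring_uminus)
  show "k = weyl_shift (- x) m" if "m = weyl_shift x k"
    using inv(2)[of k] that by simp
  show "m = weyl_shift x k" if "k = weyl_shift (- x) m"
    using inv(1)[of m] that by simp
qed

lemma act_on_eq_0: "\<not> (\<forall>u. u \<noteq> v \<longrightarrow> m u = k u) \<Longrightarrow> act_on v M $ m $ k = 0"
  unfolding act_on_def vec_lambda_beta by (rule if_not_P)

lemma A_op_weyl:
  fixes x :: "'v::finite weyl_exponent"
  assumes odd: "odd CARD('n::finite)"
  shows "A_op v ** weyl x = weyl (rotation_exponent v x) ** (A_op v :: ('v, 'n) operator)"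
proof (intro vec_eq_iff[THEN iffD2] allI)
  fix m k :: "'v \<Rightarrow> 'n mod_ring"
  let ?y = "rotation_exponent v x"
  let ?ph = "\<lambda>x u (j :: 'n mod_ring). qroot CARD('n) powi (2 * fst (x $ u) * to_int_mod_ring j + fst (x $ u) * snd (x $ u))"
  let ?k = "weyl_shift x k" and ?m = "weyl_shift (- ?y) m"
  have y: "?y $ u = (if u = v then (- fst (x $ v) - snd (x $ v), fst (x $ v)) else x $ u)" for u
    by (simp add: rotation_exponent_def)
  have phase: "weyl_phase z j = ?ph z v (j v) * (\<Prod>u\<in>UNIV - {v}. ?ph z u (j u))"
    for z :: "'v weyl_exponent" and j :: "'v \<Rightarrow> 'n mod_ring"
    unfolding weyl_phase_def by (rule prod.remove) simp_all
  have off: "m u = ?k u \<longleftrightarrow> ?m u = k u" if "u \<noteq> v" for u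
    using that by (auto simp: weyl_shift_def y of_int_mod_ring_uminus diff_eq_eq)
  have l: "(A_op v ** weyl x) $ m $ k = A_op v $ m $ ?k * weyl_phase x k"
    unfolding weyl_def by (rule mult_monomial_matrix)
  have r: "(weyl ?y ** A_op v) $ m $ k = weyl_phase ?y ?m * A_op v $ ?m $ k"
    unfolding weyl_def by (rule monomial_matrix_mult) (rule weyl_shift_eq_iff)
  show "(A_op v ** weyl x) $ m $ k = (weyl ?y ** (A_op v :: ('v, 'n) operator)) $ m $ k"
  proof (cases "\<forall>u. u \<noteq> v \<longrightarrow> m u = ?k u")
    case True
    then have eq: "?m u = k u" if "u \<noteq> v" for u
      using off that by blast
    have "A1 $ m v $ ?k v * ?ph x v (k v) = ?ph ?y v (?m v) * A1 $ ?m v $ k v"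
      using A1_weyl_site[OF odd, of "m v" "k v" "snd (x $ v)" "fst (x $ v)"]
      by (simp add: weyl_shift_def y of_int_mod_ring_uminus)
    moreover have "(\<Prod>u\<in>UNIV - {v}. ?ph x u (k u)) = (\<Prod>u\<in>UNIV - {v}. ?ph ?y u (?m u))"
      using eq by (intro prod.cong refl) (auto simp: y)
    ultimately show ?thesis
      unfolding l r using True eq by (simp add: act_on_def phase mult_ac)
  next
    case False
    then have "\<not> (\<forall>u. u \<noteq> v \<longrightarrow> ?m u = k u)"
      using off by blast
    from act_on_eq_0[OF this] act_on_eq_0[OF False] show ?thesis
      unfolding l r by simp
  qed
qed

text \<open>Used for products of operators acting at the site v: only the states that agree with k
  elsewhere contribute to the entry.\<close>

lemma sum_fun_upd:
  fixes f :: "('v::finite \<Rightarrow> 'a::finite) \<Rightarrow> complex"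
  assumes "\<And>l. \<not> (\<forall>u. u \<noteq> v \<longrightarrow> l u = k u) \<Longrightarrow> f l = 0"
  shows "(\<Sum>l\<in>UNIV. f l) = (\<Sum>t\<in>UNIV. f (k(v := t)))"
proof -
  have "(\<Sum>t\<in>UNIV. f (k(v := t))) = sum f (range (\<lambda>t. k(v := t)))"
    by (rule sum.reindex_cong[symmetric]) (auto intro!: inj_onI dest: fun_upd_eqD)
  also have "\<dots> = sum f UNIV"
  proof (rule sum.mono_neutral_left)
    show "\<forall>l\<in>UNIV - range (\<lambda>t. k(v := t)). f l = 0"
    proof
      fix l assume l: "l \<in> UNIV - range (\<lambda>t. k(v := t))"
      have "l = k(v := l v)" if "\<forall>u. u \<noteq> v \<longrightarrow> l u = k u"
        using that by (auto simp: fun_eq_iff)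
      then show "f l = 0"
        using l assms by blast
    qed
  qed auto
  finally show ?thesis ..
qed

lemma act_on_mult: "act_on v M ** act_on v M' = (act_on v (M ** M') :: ('v::finite, 'n::finite) operator)"
proof (intro vec_eq_iff[THEN iffD2] allI)
  fix m k :: "'v \<Rightarrow> 'n mod_ring"
  have "(act_on v M ** act_on v M') $ m $ k = (\<Sum>t\<in>UNIV. act_on v M $ m $ (k(v := t)) * act_on v M' $ (k(v := t)) $ k)"
    unfolding matrix_matrix_mult_def vec_lambda_beta
    by (rule sum_fun_upd) (auto simp: act_on_def)
  also have "\<dots> = act_on v (M ** M') $ m $ k"
  proof (cases "\<forall>u. u \<noteq> v \<longrightarrow> m u = k u")
    case True
    then show ?thesis
      by (simp add: act_on_def matrix_matrix_mult_def)
  next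
    case False
    then have upd: "\<not> (\<forall>u. u \<noteq> v \<longrightarrow> m u = (k(v := t)) u)" for t
      by auto
    show ?thesis
      unfolding act_on_eq_0[OF upd] act_on_eq_0[OF False] by simp
  qed
  finally show "(act_on v M ** act_on v M') $ m $ k = act_on v (M ** M') $ m $ k" .
qed

lemma act_on_one: "act_on v (mat 1) = (mat 1 :: ('v::finite, 'n::finite) operator)"
proof (intro vec_eq_iff[THEN iffD2] allI)
  fix m k :: "'v \<Rightarrow> 'n mod_ring"
  have "(\<forall>u. u \<noteq> v \<longrightarrow> m u = k u) \<and> m v = k v \<longleftrightarrow> m = k"
    unfolding fun_eq_iff by metis
  then show "act_on v (mat 1) $ m $ k = (mat 1 :: ('v, 'n) operator) $ m $ k"
    by (cases "m = k") (auto simp: act_on_def mat_def)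
qed

text \<open>\<open>A1\<close> combines a Fourier kernel with a Gaussian phase. The inverse Fourier
  kernel with the opposite phase undoes it, the sum over k being a sum of roots of unity.\<close>

lemma A1_inverse:
  assumes odd: "odd CARD('n::finite)"
  obtains B where "A1 ** B = (mat 1 :: 'n local_operator)"
proof
  let ?N = "CARD('n)"
  let ?q = "qroot ?N"
  define z where "z = complex_of_real (real ?N powr (- 1 / 2)) * cis (pi / 2 * ((1 - real ?N) / 6))"
  have z: "z \<noteq> 0"
    by (simp add: z_def)
  define B :: "'n local_operator" where
    "B = (\<chi> k m. inverse z / of_nat ?N * ?q powi ((to_int_mod_ring m)\<^sup>2 + 2 * to_int_mod_ring k * to_int_mod_ring m))"
  have A1: "A1 $ m $ k = z * ?q powi (- ((to_int_mod_ring m)\<^sup>2) - 2 * to_int_mod_ring k * to_int_mod_ring m)"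
    for m k :: "'n mod_ring"
    unfolding z_def by (rule A1_entry[OF odd cong_refl cong_refl])
  show "A1 ** B = (mat 1 :: 'n local_operator)"
  proof (intro vec_eq_iff[THEN iffD2] allI)
    fix m m' :: "'n mod_ring"
    let ?M = "to_int_mod_ring m" and ?M' = "to_int_mod_ring m'"
    have "(A1 ** B) $ m $ m' = (\<Sum>k\<in>(UNIV :: 'n mod_ring set). ?q powi (?M'\<^sup>2 - ?M\<^sup>2) / of_nat ?N *
        ?q powi (2 * (?M' - ?M) * to_int_mod_ring k))"
      unfolding matrix_matrix_mult_def vec_lambda_beta
    proof (intro sum.cong refl)
      fix k :: "'n mod_ring"
      let ?K = "to_int_mod_ring k"
      have "?q powi (- (?M\<^sup>2) - 2 * ?K * ?M) * ?q powi (?M'\<^sup>2 + 2 * ?K * ?M') =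
          ?q powi (?M'\<^sup>2 - ?M\<^sup>2) * ?q powi (2 * (?M' - ?M) * ?K)"
        by (simp add: power_int_add[symmetric] algebra_simps)
      then show "A1 $ m $ k * B $ k $ m' = ?q powi (?M'\<^sup>2 - ?M\<^sup>2) / of_nat ?N * ?q powi (2 * (?M' - ?M) * ?K)"
        unfolding A1 B_def vec_lambda_beta using z by (simp add: field_simps)
    qed
    also have "\<dots> = ?q powi (?M'\<^sup>2 - ?M\<^sup>2) / of_nat ?N * (\<Sum>j<?N. ?q powi (2 * (?M' - ?M) * int j))"
      unfolding sum_mod_ring[of "\<lambda>k. ?q powi (2 * (?M' - ?M) * k)", symmetric] by (rule sum_distrib_left[symmetric])
    also have "\<dots> = (mat 1 :: 'n local_operator) $ m $ m'"
    proof -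
      have "int ?N dvd ?M' - ?M \<longleftrightarrow> of_int_mod_ring ?M' = (of_int_mod_ring ?M :: 'n mod_ring)"
        by (simp only: of_int_mod_ring_eq_iff cong_iff_dvd_diff)
      then have "int ?N dvd ?M' - ?M \<longleftrightarrow> m = m'"
        by auto
      then show ?thesis
        unfolding qroot_sum[OF odd] by (simp add: mat_def)
    qed
    finally show "(A1 ** B) $ m $ m' = (mat 1 :: 'n local_operator) $ m $ m'" .
  qed
qed

lemma A_op_Units:
  assumes "odd CARD('n::finite)"
  shows "(A_op v :: ('v::finite, 'n) operator) \<in> Units operators"
proof -
  obtain B where "A1 ** B = (mat 1 :: 'n local_operator)"
    by (rule A1_inverse[OF assms])
  then have "(A_op v :: ('v, 'n) operator) ** act_on v B = mat 1"
    by (simp add: act_on_mult act_on_one)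
  then show ?thesis
    by (rule operators_UnitsI)
qed

lemma encircle_rotation:
  fixes \<tau>1 \<tau>2 :: "('a, 'b) dotted"
  assumes "\<And>u k. tri_side \<tau>2 u k = tri_side \<tau>1 u (if u = v then k + 1 else k)"
  shows "encircle \<tau>2 \<alpha> = encircle \<tau>1 \<alpha>"
proof -
  have ex: "(\<exists>u k. folded_at \<tau> u k \<and> tri_side \<tau> u k = \<alpha>) \<longleftrightarrow>
      (\<exists>\<beta> u k. folded_at \<tau> u k \<and> tri_side \<tau> u k = \<alpha> \<and> \<beta> = tri_side \<tau> u (k + 2))"
    for \<tau> :: "('a, 'b) dotted"
    by blast
  have key: "(\<exists>u k. folded_at \<tau>2 u k \<and> tri_side \<tau>2 u k = \<alpha> \<and> \<beta> = tri_side \<tau>2 u (k + 2)) \<longleftrightarrow>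
      (\<exists>u k. folded_at \<tau>1 u k \<and> tri_side \<tau>1 u k = \<alpha> \<and> \<beta> = tri_side \<tau>1 u (k + 2))" for \<beta>
  proof safe
    fix u k
    assume "folded_at \<tau>2 u k"
    then show "\<exists>u' k'. folded_at \<tau>1 u' k' \<and> tri_side \<tau>1 u' k' = tri_side \<tau>2 u k \<and>
        tri_side \<tau>2 u (k + 2) = tri_side \<tau>1 u' (k' + 2)"
      by (intro exI[of _ u] exI[of _ "if u = v then k + 1 else k"])
        (auto simp only: folded_at_def assms add_ac split: if_splits)
  next
    fix u k
    assume f: "folded_at \<tau>1 u k"
    \<comment> \<open>Modulo 3, adding 2 undoes the rotation by 1.\<close>
    define k' where "k' = (if u = v then k + 2 else k)"
    have k': "(if u = v then k' + 1 else k') = k" "(if u = v then k' + 1 + 1 else k' + 1) = k + 1"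
      "(if u = v then k' + 2 + 1 else k' + 2) = k + 2"
      using three_cases[of k] by (auto simp: k'_def three_arith)
    show "\<exists>u' k'. folded_at \<tau>2 u' k' \<and> tri_side \<tau>2 u' k' = tri_side \<tau>1 u k \<and>
        tri_side \<tau>1 u (k + 2) = tri_side \<tau>2 u' (k' + 2)"
      by (intro exI[of _ u] exI[of _ k'])
        (use f in \<open>simp only: folded_at_def assms k' simp_thms\<close>)
  qed
  show ?thesis
    unfolding encircle_def ex key by (rule refl)
qed

lemma edge_exponent_rotation:
  assumes "\<And>u k. tri_side \<tau>2 u k = tri_side \<tau>1 u (if u = v then k + 1 else k)"
  shows "rotation_exponent v (edge_exponent \<tau>2 \<alpha>) = edge_exponent \<tau>1 \<alpha>"
proof -
  have "rotation_exponent v (edge_exponent \<tau>2 \<alpha>) $ u = edge_exponent \<tau>1 \<alpha> $ u" for u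
  proof (cases "u = v")
    case True
    have "tri_side \<tau>2 v 0 = tri_side \<tau>1 v 1" "tri_side \<tau>2 v 1 = tri_side \<tau>1 v 2" "tri_side \<tau>2 v 2 = tri_side \<tau>1 v 0"
      using assms[of v 0] assms[of v 1] assms[of v 2] by (simp_all only: three_arith simp_thms if_True)
    then show ?thesis
      using True by (simp add: rotation_exponent_def edge_exponent_nth encircle_rotation[OF assms] sum_three
          corner_exponent_simps zero_prod_def)
  next
    case False
    then show ?thesis
      by (simp add: rotation_exponent_def edge_exponent_nth encircle_rotation[OF assms] assms)
  qed
  then show ?thesis
    by (simp add: vec_eq_iff)
qed

section \<open>The operator of a flip\<close>

text \<open>The sum over i is a sum of roots of unity that forces j = - k w. The operator is a
  controlled shift: it subtracts the label at \<open>w\<close> from the label at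
  \<open>v\<close>.\<close>

lemma S_op_eq:
  fixes v w :: "'v::finite"
  assumes odd: "odd CARD('n::finite)" and vw: "v \<noteq> w"
  shows "S_op v w = (monomial_matrix (\<lambda>k. k(v := k v - k w)) (\<lambda>_. 1) :: ('v, 'n) operator)"
proof (intro vec_eq_iff[THEN iffD2] allI)
  fix m k :: "'v \<Rightarrow> 'n mod_ring"
  let ?N = "CARD('n)" and ?q = "qroot CARD('n)" and ?W = "weyl :: _ \<Rightarrow> ('v, 'n) operator"
  let ?z = "\<lambda>i j. weyl_scale (int i) (axis w (1, 0)) + weyl_scale (int j) (axis v (0, 1))"
  let ?K = "to_int_mod_ring (k w)"
  have term_eq: "U_op w [^]\<^bsub>operators\<^esub> i ** P_op v [^]\<^bsub>operators\<^esub> j = ?W (?z i j)" for i j :: nat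
  proof -
    have "weyl_form (axis w (1, 0)) (axis v (0, 1)) = 0"
      unfolding weyl_form_def using vw by (intro sum.neutral) (auto simp: axis_def)
    then show ?thesis
      by (simp add: U_op_eq P_op_eq weyl_pow[OF odd] weyl_mult[OF odd] weyl_form_simps)
  qed
  have z: "?z i j $ u = (if u = w then (int i, 0) else if u = v then (0, int j) else 0)" for i j u
    using vw by (auto simp: weyl_scale_def axis_def zero_prod_def)
  have shift: "weyl_shift (?z i j) k = k(v := k v + of_int_mod_ring (int j))" for i j
    using vw by (auto simp: weyl_shift_def fun_eq_iff z simp del: vector_add_component)
  have phase: "weyl_phase (?z i j) k = ?q powi (2 * int i * ?K)" for i j
  proof -
    have "weyl_phase (?z i j) k = (\<Prod>u\<in>UNIV. if u = w then ?q powi (2 * int i * ?K) else 1)"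
      unfolding weyl_phase_def using vw by (intro prod.cong refl) (auto simp: z simp del: vector_add_component)
    then show ?thesis
      by simp
  qed
  have W: "?W (?z i j) $ m $ k = (if m = k(v := k v + of_int_mod_ring (int j)) then ?q powi (2 * int i * ?K) else 0)" for i j
    by (simp add: weyl_def monomial_matrix_def shift phase)
  \<comment> \<open>The unique power of P_v that survives the summation over i.\<close>
  define j0 where "j0 = nat (to_int_mod_ring (- k w))"
  have j0: "j0 < ?N" "of_int_mod_ring (int j0) = - k w"
    using bij_betw_apply[OF bij_to_int_mod_ring, of "- k w"] by (simp_all add: j0_def to_int_mod_ring_nonneg)
  have dvd: "int ?N dvd (int j + ?K) \<longleftrightarrow> j = j0" if "j < ?N" for j
  proof -
    have "int ?N dvd (int j + ?K) \<longleftrightarrow> (of_int_mod_ring (int j + ?K) :: 'n mod_ring) = of_int_mod_ring 0"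
      unfolding of_int_mod_ring_eq_iff by (simp add: cong_0_iff)
    also have "\<dots> \<longleftrightarrow> (of_int_mod_ring (int j) :: 'n mod_ring) = of_int_mod_ring (int j0)"
      by (simp add: of_int_mod_ring_add j0(2) eq_neg_iff_add_eq_0)
    also have "\<dots> \<longleftrightarrow> j = j0"
      unfolding of_int_mod_ring_eq_iff cong_int_iff using that j0(1) by (simp add: cong_def)
    finally show ?thesis .
  qed
  have inner: "(\<Sum>i<?N. ?q ^ (2 * i * j) * ?q powi (2 * int i * ?K)) = (if j = j0 then of_nat ?N else 0)"
    if "j < ?N" for j
  proof -
    have "?q ^ (2 * i * j) * ?q powi (2 * int i * ?K) = ?q powi (2 * (int j + ?K) * int i)" for i
    proof -
      have "?q ^ (2 * i * j) = ?q powi (2 * int i * int j)"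
        by (simp flip: power_int_of_nat)
      then show ?thesis
        by (simp add: power_int_add[symmetric] algebra_simps)
    qed
    then show ?thesis
      using qroot_sum[OF odd, of "int j + ?K"] dvd[OF that] by simp
  qed
  have "S_op v w $ m $ k = 1 / of_nat ?N * (\<Sum>i<?N. \<Sum>j<?N. ?q ^ (2 * i * j) * ?W (?z i j) $ m $ k)"
    by (simp add: S_op_def mat_mult_component term_eq sum_component)
  also have "\<dots> = 1 / of_nat ?N * (\<Sum>j<?N. \<Sum>i<?N. ?q ^ (2 * i * j) * ?W (?z i j) $ m $ k)"
    by (subst sum.swap) (rule refl)
  also have "(\<Sum>j<?N. \<Sum>i<?N. ?q ^ (2 * i * j) * ?W (?z i j) $ m $ k) =
      (\<Sum>j<?N. if j = j0 then (if m = k(v := k v - k w) then of_nat ?N else 0) else 0)"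
  proof (intro sum.cong refl)
    fix j assume "j \<in> {..<?N}"
    then have j: "j < ?N"
      by simp
    show "(\<Sum>i<?N. ?q ^ (2 * i * j) * ?W (?z i j) $ m $ k) =
        (if j = j0 then (if m = k(v := k v - k w) then of_nat ?N else 0) else 0)"
    proof (cases "m = k(v := k v + of_int_mod_ring (int j))")
      case True
      have "(\<Sum>i<?N. ?q ^ (2 * i * j) * ?W (?z i j) $ m $ k) = (if j = j0 then of_nat ?N else 0)"
        unfolding W if_P[OF True] by (rule inner[OF j])
      then show ?thesis
        using True j0(2) by auto
    next
      case False
      then have "(\<Sum>i<?N. ?q ^ (2 * i * j) * ?W (?z i j) $ m $ k) = 0"
        unfolding W by (intro sum.neutral) simp
      moreover have "j = j0 \<Longrightarrow> m \<noteq> k(v := k v - k w)"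
        using False j0(2) by auto
      ultimately show ?thesis
        by auto
    qed
  qed
  also have "1 / of_nat ?N * \<dots> = monomial_matrix (\<lambda>k. k(v := k v - k w)) (\<lambda>_. 1) $ m $ k"
    using j0(1) by (simp add: monomial_matrix_def)
  finally show "(S_op v w :: ('v, 'n) operator) $ m $ k =
      monomial_matrix (\<lambda>k. k(v := k v - k w)) (\<lambda>_. 1) $ m $ k" .
qed

lemma S_op_Units:
  fixes v w :: "'v::finite"
  assumes odd: "odd CARD('n::finite)" and vw: "v \<noteq> w"
  shows "(S_op v w :: ('v, 'n) operator) \<in> Units operators"
proof (rule operators_UnitsI)
  show "S_op v w ** monomial_matrix (\<lambda>k. k(v := k v + k w)) (\<lambda>_. 1) = (mat 1 :: ('v, 'n) operator)"
    using vw by (simp add: S_op_eq[OF assms] monomial_matrix_mult_monomial_matrix mat_eq_monomial_matrix)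
qed

lemma S_op_weyl:
  fixes v w :: "'v::finite" and x :: "'v weyl_exponent"
  assumes odd: "odd CARD('n::finite)" and vw: "v \<noteq> w"
  shows "S_op v w ** weyl x = weyl (flip_exponent v w x) ** (S_op v w :: ('v, 'n) operator)"
proof -
  let ?y = "flip_exponent v w x" and ?q = "qroot CARD('n)"
  let ?s = "\<lambda>k :: 'v \<Rightarrow> 'n mod_ring. k(v := k v - k w)"
  let ?ph = "\<lambda>x u (j :: 'n mod_ring). ?q powi (2 * fst (x $ u) * to_int_mod_ring j + fst (x $ u) * snd (x $ u))"
  have y: "?y $ u = (if u = v then (fst (x $ v), snd (x $ v) - snd (x $ w))
      else if u = w then (fst (x $ w) + fst (x $ v), snd (x $ w)) else x $ u)" for u
    by (simp add: flip_exponent_def)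
  have shift: "?s (weyl_shift x k) = weyl_shift ?y (?s k)" for k
    using vw by (auto simp: fun_eq_iff weyl_shift_def y of_int_mod_ring_diff)
  have split: "weyl_phase z j = ?ph z v (j v) * (?ph z w (j w) * (\<Prod>u\<in>UNIV - {v} - {w}. ?ph z u (j u)))"
    for z :: "'v weyl_exponent" and j :: "'v \<Rightarrow> 'n mod_ring"
    unfolding weyl_phase_def
    using vw by (simp add: prod.remove[of UNIV v] prod.remove[of "UNIV - {v}" w])
  have phase: "weyl_phase x k = weyl_phase ?y (?s k)" for k
  proof -
    let ?A = "to_int_mod_ring (k v)" and ?B = "to_int_mod_ring (k w)"
    have cong: "[to_int_mod_ring (k v - k w) = ?A - ?B] (mod int CARD('n))"
      by (simp only: of_int_mod_ring_eq_iff[symmetric] of_int_mod_ring_to_int_mod_ring of_int_mod_ring_diff)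
    have "?ph ?y v (k v - k w) = ?q powi (2 * fst (x $ v) * (?A - ?B) + fst (x $ v) * (snd (x $ v) - snd (x $ w)))"
      unfolding y by (simp only: simp_thms if_True fst_conv snd_conv)
        (intro qroot_powi_cong odd cong_add cong_mult cong_refl cong)
    then have "?ph x v (k v) * ?ph x w (k w) = ?ph ?y v (k v - k w) * ?ph ?y w (k w)"
      using vw by (simp add: y power_int_add[symmetric] algebra_simps)
    moreover have "(\<Prod>u\<in>UNIV - {v} - {w}. ?ph x u (k u)) = (\<Prod>u\<in>UNIV - {v} - {w}. ?ph ?y u (?s k u))"
      by (intro prod.cong refl) (auto simp: y)
    ultimately show ?thesis
      unfolding split using vw by (simp add: mult.assoc[symmetric])
  qed
  show ?thesis
    unfolding S_op_eq[OF assms] weyl_def monomial_matrix_mult_monomial_matrix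
    by (simp add: shift phase)
qed

text \<open>The functional calculus has the property that \<open>spectral_apply\<close> describes.
  It is the only such matrix, because the columns of the projections are eigenvectors, and the
  projections detect equality.\<close>

lemma spectral_apply_eq:
  fixes Y :: "complex ^ 'b::finite ^ 'b"
  assumes odd: "odd N" and Y_pow: "Y [^]\<^bsub>operators\<^esub> N = mat 1"
  shows "spectral_apply N \<Psi> Y = scalar_ring.functional_calc operators mat N Y \<Psi>"
proof -
  interpret scalar_ring "operators :: (complex ^ 'b ^ 'b) ring" mat
    by (rule operators_scalar_ring)
  let ?q = "qroot N" and ?F = "functional_calc N Y \<Psi>"
  have Y: "Y \<in> carrier operators" "Y [^]\<^bsub>operators\<^esub> N = \<one>\<^bsub>operators\<^esub>"
    using Y_pow by simp_all
  \<comment> \<open>A vector is encoded as the matrix with all columns equal to it, so that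
    statements about left multiplication in the matrix ring apply to vectors.\<close>
  let ?C = "\<lambda>x. (\<chi> i j. x $ i) :: complex ^ 'b ^ 'b"
  have column: "A ** ?C x = ?C (A *v x)" for A :: "complex ^ 'b ^ 'b" and x :: "complex ^ 'b"
    by (simp add: matrix_matrix_mult_def matrix_vector_mult_def)
  have scale: "mat c ** ?C x = ?C (c *s x)" for c and x :: "complex ^ 'b"
    by (simp add: vec_eq_iff mat_mult_component)
  show ?thesis
    unfolding spectral_apply_def
  proof (rule the_equality)
    show "\<forall>k x. Y *v x = ?q powi (2 * k) *s x \<longrightarrow> ?F *v x = \<Psi> (?q powi (2 * k)) *s x"
    proof (intro allI impI)
      fix k and x :: "complex ^ 'b"
      assume "Y *v x = ?q powi (2 * k) *s x"
      then have "Y ** ?C x = mat (?q powi (2 * k)) ** ?C x"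
        by (simp only: column[of Y] scale)
      then have "?F ** ?C x = mat (\<Psi> (?q powi (2 * k))) ** ?C x"
        using functional_calc_eigen[OF odd Y, of "?C x" k \<Psi>] by simp
      then show "?F *v x = \<Psi> (?q powi (2 * k)) *s x"
        unfolding column[of ?F] scale by (simp add: vec_eq_iff)
    qed
    fix F assume F: "\<forall>k x. Y *v x = ?q powi (2 * k) *s x \<longrightarrow> F *v x = \<Psi> (?q powi (2 * k)) *s x"
    show "F = ?F"
    proof (rule eq_if_eq_on_eigen_proj[OF odd Y])
      fix k
      let ?E = "eigen_proj N Y k"
      have col: "(A ** ?E) $ i $ j = (A *v column j ?E) $ i" for A :: "complex ^ 'b ^ 'b" and i j
        by (simp add: matrix_matrix_mult_def matrix_vector_mult_def column_def)
      have sc: "(mat c ** ?E) $ i $ j = (c *s column j ?E) $ i" for c i j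
        by (simp add: mat_mult_component column_def)
      have "Y ** ?E = mat (?q powi (2 * k)) ** ?E"
        using eigen_proj_eigen[OF odd Y, of k] by simp
      then have Y_col: "Y *v column j ?E = ?q powi (2 * k) *s column j ?E" for j
        unfolding vec_eq_iff col[symmetric] sc[symmetric] by simp
      have F_col: "F *v column j ?E = \<Psi> (?q powi (2 * k)) *s column j ?E" for j
        by (rule F[rule_format, OF Y_col])
      have "F ** ?E = mat (\<Psi> (?q powi (2 * k))) ** ?E"
      proof (intro vec_eq_iff[THEN iffD2] allI)
        show "(F ** ?E) $ i $ j = (mat (\<Psi> (?q powi (2 * k))) ** ?E) $ i $ j" for i j
          unfolding col[of F] sc F_col ..
      qed
      then show "F \<otimes>\<^bsub>operators\<^esub> ?E = ?F \<otimes>\<^bsub>operators\<^esub> ?E"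
        using functional_calc_eigen_proj[OF odd Y, of \<Psi> k] by simp
    qed simp_all
  qed
qed

section \<open>Equivariance of the embedding\<close>

lemma dotted_triangulation_slot_bound:
  assumes "dotted_triangulation S \<tau>"
  shows "slot_bound \<tau>"
  unfolding slot_bound_def
proof
  fix \<alpha>
  show "card (slots \<tau> \<alpha>) \<le> 2"
  proof (cases "\<alpha> \<in> edges \<tau>")
    case True
    then have "card (slots \<tau> \<alpha>) = (if interior_edge S \<alpha> then 2 else 1)"
      using assms unfolding dotted_triangulation_def by blast
    then show ?thesis
      by simp
  next
    case False
    then have "slots \<tau> \<alpha> = {}"
      by (auto simp: edges_def slots_def)
    then show ?thesis
      by simp
  qed
qed

lemma gen_scale_nonzero: "gen_scale p \<tau> \<alpha> \<noteq> 0"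
  by (simp add: gen_scale_def)

definition iota_gen :: "'s coeff \<Rightarrow> ('v::finite, 's) dotted \<Rightarrow> 's set \<Rightarrow> ('v, 'n::finite) operator" where
  "iota_gen p \<tau> \<alpha> = mat (gen_scale p \<tau> \<alpha>) ** weyl (edge_exponent \<tau> \<alpha>)"

lemma iota_eq:
  assumes "odd CARD('n::finite)"
  shows "iota p \<tau> = induced_hom operators mat (iota_gen p \<tau> :: _ \<Rightarrow> ('v::finite, 'n) operator)"
  by (simp add: iota_def iota_gen_def[abs_def] iota_bar_eq[OF assms])

lemma scalar_weyl_inverse:
  assumes "odd CARD('n::finite)" "c \<noteq> 0"
  shows "(mat c ** weyl x) ** (mat (inverse c) ** weyl (- x)) = (mat 1 :: ('v::finite, 'n) operator)"
proof -
  have "(mat c ** weyl x) ** (mat (inverse c) ** weyl (- x)) =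
      mat c ** (weyl x ** (mat (inverse c) ** (weyl (- x) :: ('v, 'n) operator)))"
    by (rule matrix_mul_assoc[symmetric])
  also have "\<dots> = (mat c ** mat (inverse c)) ** (weyl x ** weyl (- x))"
    unfolding mat_mult_lcomm[of "weyl x"] by (rule matrix_mul_assoc)
  finally show ?thesis
    using assms(2) by (simp add: weyl_uminus[OF assms(1)] mat_mult_mat)
qed

lemma iota_gen_solution:
  assumes odd: "odd CARD('n::finite)" and bound: "slot_bound \<tau>"
  shows "CF_solution operators mat CARD('n) p \<tau> (iota_gen p \<tau> :: _ \<Rightarrow> ('v::finite, 'n) operator)"
  unfolding CF_solution_def
proof (intro ballI conjI)
  interpret scalar_ring "operators :: ('v, 'n) operator ring" mat
    by (rule operators_scalar_ring)
  fix \<alpha>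
  show "(iota_gen p \<tau> \<alpha> :: ('v, 'n) operator) \<in> Units operators"
    unfolding iota_gen_def by (rule operators_UnitsI[OF scalar_weyl_inverse[OF odd gen_scale_nonzero]])
  have "(mat c ** weyl x) [^]\<^bsub>operators\<^esub> CARD('n) = (mat (c ^ CARD('n)) :: ('v, 'n) operator)" for c x
    using s_mult_pow[of "weyl x" c "CARD('n)"] weyl_pow_card[OF odd, of x] by simp
  then show "(iota_gen p \<tau> \<alpha> :: ('v, 'n) operator) [^]\<^bsub>operators\<^esub> CARD('n) = mat (gen_scale p \<tau> \<alpha> ^ CARD('n))"
    by (simp add: iota_gen_def)
  fix \<beta>
  have "q_commute CARD('n) (eps \<tau> \<alpha> \<beta>) (weyl (edge_exponent \<tau> \<alpha>)) (weyl (edge_exponent \<tau> \<beta>))"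
    using weyl_commute[OF odd, of "edge_exponent \<tau> \<alpha>" "edge_exponent \<tau> \<beta>"]
    by (simp add: q_commute_def eps_eq_weyl_form[OF bound])
  from q_commute_scalar[OF this, of "gen_scale p \<tau> \<alpha>"]
  have "q_commute CARD('n) (eps \<tau> \<alpha> \<beta>) (iota_gen p \<tau> \<alpha>) (weyl (edge_exponent \<tau> \<beta>))"
    by (simp add: iota_gen_def)
  then have "q_commute CARD('n) (- eps \<tau> \<alpha> \<beta>) (weyl (edge_exponent \<tau> \<beta>)) (iota_gen p \<tau> \<alpha>)"
    by (rule q_commute_sym) simp_all
  from q_commute_scalar[OF this, of "gen_scale p \<tau> \<beta>"]
  have "q_commute CARD('n) (- eps \<tau> \<alpha> \<beta>) (iota_gen p \<tau> \<beta>) (iota_gen p \<tau> \<alpha>)"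
    by (simp add: iota_gen_def)
  then have "q_commute CARD('n) (- (- eps \<tau> \<alpha> \<beta>)) (iota_gen p \<tau> \<alpha>) (iota_gen p \<tau> \<beta>)"
    by (rule q_commute_sym) simp_all
  then show "iota_gen p \<tau> \<alpha> \<otimes>\<^bsub>operators\<^esub> (iota_gen p \<tau> \<beta> :: ('v, 'n) operator) =
      mat (qroot CARD('n) powi (2 * eps \<tau> \<alpha> \<beta>)) \<otimes>\<^bsub>operators\<^esub>
        (iota_gen p \<tau> \<beta> \<otimes>\<^bsub>operators\<^esub> iota_gen p \<tau> \<alpha>)"
    by (simp add: q_commute_def)
qed

lemma intertwiner_conj:
  assumes "odd CARD('n::finite)" "(Q :: ('v::finite, 'n) operator) \<in> Units operators" "Q ** weyl x = weyl y ** Q"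
  shows "conj_by Q (mat c ** weyl x) = mat c ** weyl y"
proof (rule conj_by_eq[OF assms(2)])
  have "Q ** (mat c ** weyl x) = mat c ** (Q ** weyl x)"
    by (rule mat_mult_lcomm)
  then show "Q ** (mat c ** weyl x) = (mat c ** weyl y) ** Q"
    by (simp add: assms(3) matrix_mul_assoc)
qed

lemma dot_rotation_iota:
  fixes \<tau>1 \<tau>2 :: "('v::finite, 's) dotted" and S :: "'s surface_data"
  assumes odd: "odd CARD('n::finite)" and rot: "dot_rotation S v \<tau>1 \<tau>2"
    and x: "x \<in> carrier (CF CARD('n) p \<tau>2)"
  shows "conj_by (A_op v :: ('v, 'n) operator) (iota p \<tau>2 x) = iota p \<tau>1 x"
proof -
  let ?A = "A_op v :: ('v, 'n) operator"
  let ?g1 = "iota_gen p \<tau>1 :: _ \<Rightarrow> ('v, 'n) operator" and ?g2 = "iota_gen p \<tau>2 :: _ \<Rightarrow> ('v, 'n) operator"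
  have side: "\<And>u k. tri_side \<tau>2 u k = tri_side \<tau>1 u (if u = v then k + 1 else k)"
    and bound: "slot_bound \<tau>2"
    using rot unfolding dot_rotation_def by (auto intro: dotted_triangulation_slot_bound)
  have "edges \<tau>2 = edges \<tau>1"
  proof
    show "edges \<tau>2 \<subseteq> edges \<tau>1"
      unfolding edges_def side by blast
    have "tri_side \<tau>1 u k = tri_side \<tau>2 u (if u = v then k + 2 else k)" for u k
      unfolding side by (cases "u = v") (simp_all only: three_succ(5) simp_thms if_True if_False)
    then show "edges \<tau>1 \<subseteq> edges \<tau>2"
      unfolding edges_def by blast
  qed
  then have scale: "gen_scale p \<tau>1 \<alpha> = gen_scale p \<tau>2 \<alpha>" for \<alpha>
    by (simp add: gen_scale_def)
  have A: "?A \<in> Units operators"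
    by (rule A_op_Units[OF odd])
  have g1: "?g1 \<alpha> = conj_by ?A (?g2 \<alpha>)" for \<alpha>
    unfolding iota_gen_def scale
    by (subst intertwiner_conj[OF odd A A_op_weyl[OF odd]]) (simp add: edge_exponent_rotation[OF side])
  have sol2: "CF_solution operators mat CARD('n) p \<tau>2 ?g2"
    by (rule iota_gen_solution[OF odd bound])
  \<comment> \<open>The relations of \<open>\<tau>2\<close> hold for the generators of
    \<open>\<tau>1\<close> because these are conjugates. Hence \<open>iota p \<tau>1\<close> can be
    evaluated on cosets of the ideal of \<open>\<tau>2\<close> without comparing the two
    ideals.\<close>
  have sol1: "CF_solution operators mat CARD('n) p \<tau>2 ?g1"
    by (rule CF_solution_hom[OF operators_scalar_ring operators_scalar_ring conj_by_hom(1)[OF A] conj_by_hom(2)[OF A] sol2 g1])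
  obtain f where f: "f \<in> carrier (free_algebra (edges \<tau>2))" "x = CF_class CARD('n) p \<tau>2 f"
    using x by (rule CF_carrierE)
  have "free_eval operators mat ?g1 f = conj_by ?A (free_eval operators mat ?g2 f)"
    by (rule hom_free_eval[OF operators_scalar_ring operators_scalar_ring conj_by_hom(1)[OF A] conj_by_hom(2)[OF A] _ g1 f(1)])
      (use sol2 in \<open>unfold CF_solution_def, blast\<close>)
  then show ?thesis
    unfolding iota_eq[OF odd] f(2)
    by (simp only: CF_solution_induced_hom(1)[OF operators_scalar_ring sol1 f(1)]
        CF_solution_induced_hom(1)[OF operators_scalar_ring sol2 f(1)])
qed

text \<open>Extracts from the immersed square the incidences of sides with triangles that the
  exponent calculation uses. The two triangles traverse a diagonal in opposite directions, but open
  segments carry no direction.\<close>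

lemma dotted_flip_sides:
  assumes "dotted_flip S v w \<kappa> \<kappa>' \<tau>1 \<tau>2"
  obtains ab bc cd da where "v \<noteq> w" "slot_bound \<tau>1" "slot_bound \<tau>2"
    "\<And>u. u \<noteq> v \<Longrightarrow> u \<noteq> w \<Longrightarrow> tri_side \<tau>2 u = tri_side \<tau>1 u"
    "tri_side \<tau>1 v 0 = ab" "tri_side \<tau>1 v 1 = \<kappa>" "tri_side \<tau>1 v 2 = da"
    "tri_side \<tau>1 w 0 = bc" "tri_side \<tau>1 w 1 = cd" "tri_side \<tau>1 w 2 = \<kappa>"
    "tri_side \<tau>2 v 0 = \<kappa>'" "tri_side \<tau>2 v 1 = cd" "tri_side \<tau>2 v 2 = da"
    "tri_side \<tau>2 w 0 = bc" "tri_side \<tau>2 w 1 = \<kappa>'" "tri_side \<tau>2 w 2 = ab"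
proof -
  obtain g where g: "\<kappa> = g ` open_segment (corner 4 1) (corner 4 3)"
      "\<kappa>' = g ` open_segment (corner 4 0) (corner 4 2)"
      "(tri_side \<tau>1 v 0, tri_side \<tau>1 v 1, tri_side \<tau>1 v 2) =
        (g ` open_segment (corner 4 0) (corner 4 1), g ` open_segment (corner 4 1) (corner 4 3),
         g ` open_segment (corner 4 3) (corner 4 0))"
      "(tri_side \<tau>1 w 0, tri_side \<tau>1 w 1, tri_side \<tau>1 w 2) =
        (g ` open_segment (corner 4 1) (corner 4 2), g ` open_segment (corner 4 2) (corner 4 3),
         g ` open_segment (corner 4 3) (corner 4 1))"
      "(tri_side \<tau>2 v 0, tri_side \<tau>2 v 1, tri_side \<tau>2 v 2) =
        (g ` open_segment (corner 4 0) (corner 4 2), g ` open_segment (corner 4 2) (corner 4 3),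
         g ` open_segment (corner 4 3) (corner 4 0))"
      "(tri_side \<tau>2 w 0, tri_side \<tau>2 w 1, tri_side \<tau>2 w 2) =
        (g ` open_segment (corner 4 1) (corner 4 2), g ` open_segment (corner 4 2) (corner 4 0),
         g ` open_segment (corner 4 0) (corner 4 1))"
    using assms unfolding dotted_flip_def Let_def by (elim conjE exE) (rule that; assumption)
  have arc: "g ` open_segment (corner 4 3) (corner 4 1) = \<kappa>" "g ` open_segment (corner 4 2) (corner 4 0) = \<kappa>'"
    unfolding g(1,2) by (simp_all only: open_segment_commute)
  note flip = assms[unfolded dotted_flip_def, THEN conjunct1]
    assms[unfolded dotted_flip_def, THEN conjunct2, THEN conjunct1]
    assms[unfolded dotted_flip_def, THEN conjunct2, THEN conjunct2, THEN conjunct1]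
    assms[unfolded dotted_flip_def, THEN conjunct2, THEN conjunct2, THEN conjunct2, THEN conjunct1]
  have others: "tri_side \<tau>2 u = tri_side \<tau>1 u" if "u \<noteq> v" "u \<noteq> w" for u
    using flip(4) that by blast
  note sides = g(3-6)[folded g(1,2), unfolded arc prod.inject]
  show ?thesis
    by (rule that[OF flip(3) dotted_triangulation_slot_bound[OF flip(1)] dotted_triangulation_slot_bound[OF flip(2)] others
          sides(1)[THEN conjunct1] sides(1)[THEN conjunct2, THEN conjunct1] sides(1)[THEN conjunct2, THEN conjunct2]
          sides(2)[THEN conjunct1] sides(2)[THEN conjunct2, THEN conjunct1] sides(2)[THEN conjunct2, THEN conjunct2]
          sides(3)[THEN conjunct1] sides(3)[THEN conjunct2, THEN conjunct1] sides(3)[THEN conjunct2, THEN conjunct2]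
          sides(4)[THEN conjunct1] sides(4)[THEN conjunct2, THEN conjunct1] sides(4)[THEN conjunct2, THEN conjunct2]])
qed

text \<open>Only the terms at v and w change, and the changes cancel. Consequently the exchange
  matrix after the flip can be computed from the images of the exponents under the flip.\<close>

lemma weyl_form_flip:
  assumes "v \<noteq> w"
  shows "weyl_form (flip_exponent v w x) (flip_exponent v w y) = weyl_form x y"
proof -
  let ?t = "\<lambda>x y u. fst (x $ u) * snd (y $ u) - snd (x $ u) * fst (y $ u)"
  have split: "weyl_form x y = ?t x y v + (?t x y w + (\<Sum>u\<in>UNIV - {v} - {w}. ?t x y u))" for x y
    unfolding weyl_form_def
    using assms by (simp add: sum.remove[of UNIV v] sum.remove[of "UNIV - {v}" w])
  have "(\<Sum>u\<in>UNIV - {v} - {w}. ?t (flip_exponent v w x) (flip_exponent v w y) u) =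
      (\<Sum>u\<in>UNIV - {v} - {w}. ?t x y u)"
    by (intro sum.cong refl) (simp add: flip_exponent_def)
  then show ?thesis
    unfolding split using assms by (simp add: flip_exponent_def algebra_simps)
qed

lemma flip_iota:
  fixes \<tau>1 \<tau>2 :: "('v::finite, 's) dotted" and S :: "'s surface_data"
  assumes odd: "odd CARD('n::finite)" and glob: "global_coefficient TYPE('v) CARD('n) S p"
    and flip: "dotted_flip S v w \<kappa> \<kappa>' \<tau>1 \<tau>2"
    and branch: "dilog_branch CARD('n) (p (edges \<tau>1) \<kappa>) \<Psi>"
    and x: "x \<in> carrier (CF CARD('n) p \<tau>2)"
  shows "conj_by (T_op \<Psi> v w :: ('v, 'n) operator) (iota p \<tau>2 x) =
    iota p \<tau>1 (mu_star CARD('n) p \<tau>1 \<kappa> \<kappa>' x)"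
proof -
  let ?N = "CARD('n)"
  let ?q = "qroot ?N" and ?R = "CF ?N p \<tau>1" and ?s = "CF_scalar ?N p \<tau>1" and ?X = "CF_gen ?N p \<tau>1"
  let ?g1 = "iota_gen p \<tau>1 :: _ \<Rightarrow> ('v, 'n) operator" and ?g2 = "iota_gen p \<tau>2 :: _ \<Rightarrow> ('v, 'n) operator"
  let ?e = "eps \<tau>1" and ?E1 = "edge_exponent \<tau>1" and ?E2 = "edge_exponent \<tau>2"
  let ?y1 = "gen_scale p \<tau>1" and ?y2 = "gen_scale p \<tau>2"
  have N_pos: "?N > 0"
    by simp
  obtain ab bc cd da where sides: "v \<noteq> w" "slot_bound \<tau>1" "slot_bound \<tau>2"
    "\<And>u. u \<noteq> v \<Longrightarrow> u \<noteq> w \<Longrightarrow> tri_side \<tau>2 u = tri_side \<tau>1 u"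
    "tri_side \<tau>1 v 0 = ab" "tri_side \<tau>1 v 1 = \<kappa>" "tri_side \<tau>1 v 2 = da"
    "tri_side \<tau>1 w 0 = bc" "tri_side \<tau>1 w 1 = cd" "tri_side \<tau>1 w 2 = \<kappa>"
    "tri_side \<tau>2 v 0 = \<kappa>'" "tri_side \<tau>2 v 1 = cd" "tri_side \<tau>2 v 2 = da"
    "tri_side \<tau>2 w 0 = bc" "tri_side \<tau>2 w 1 = \<kappa>'" "tri_side \<tau>2 w 2 = ab"
    using flip by (rule dotted_flip_sides) blast
  note square = sides(2,3,1,4-)
  have \<kappa>: "\<kappa> \<in> edges \<tau>1"
    using sides(6) unfolding edges_def by blast
  have edges2: "\<alpha> \<in> edges \<tau>1 \<and> \<alpha> \<noteq> \<kappa>" if \<alpha>: "\<alpha> \<in> edges \<tau>2" "\<alpha> \<noteq> \<kappa>'" for \<alpha>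
  proof -
    obtain u k where u: "tri_side \<tau>2 u k = \<alpha>"
      using \<alpha>(1) unfolding edges_def by blast
    consider "u \<noteq> v" "u \<noteq> w" | "\<alpha> \<in> {ab, bc, cd, da}"
      using u \<alpha>(2) sides(11-16) three_cases[of k] by blast
    then show ?thesis
    proof cases
      case 1
      then have "tri_side \<tau>1 u k = \<alpha>"
        using u sides(4) by metis
      then show ?thesis
        using kappa_slots[OF square, of u k] 1 unfolding edges_def by blast
    next
      case 2
      have "{ab, bc, cd, da} \<subseteq> edges \<tau>1"
        using sides(5-10) unfolding edges_def by blast
      then show ?thesis
        using 2 kappa_neq[OF square] by blast
    qed
  qed

  \<comment> \<open>Coefficients at the flipped edge\<close>
  obtain a b where ab_def: "p (edges \<tau>1) \<kappa> = (a, b)"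
    by (cases "p (edges \<tau>1) \<kappa>")
  have tri1: "dotted_triangulation S \<tau>1"
    using flip unfolding dotted_flip_def by blast
  \<comment> \<open>A boundary edge has one slot, but \<kappa> has one in \<open>v\<close> and one
    in \<open>w\<close>. So its coefficient lies on the Fermat curve without the added point, and a
    and b, by which the telescoping products divide, are nonzero.\<close>
  have "interior_edge S \<kappa>"
  proof (rule ccontr)
    assume "\<not> interior_edge S \<kappa>"
    then have "card (slots \<tau>1 \<kappa>) = 1"
      using tri1 \<kappa> unfolding dotted_triangulation_def by simp
    moreover have "{(v, 1), (w, 2)} \<subseteq> slots \<tau>1 \<kappa>"
      using sides by (simp add: slots_def)
    then have "card {(v, 1 :: 3), (w, 2)} \<le> card (slots \<tau>1 \<kappa>)"
      by (intro card_mono) auto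
    ultimately show False
      using sides(1) by simp
  qed
  then have "(a, b) \<in> fermat ?N"
    using glob tri1 \<kappa> ab_def unfolding global_coefficient_def by metis
  then have ab: "a \<noteq> 0" "b \<noteq> 0"
    by (auto simp: fermat_def)
  have y_\<kappa>: "?y1 \<kappa> = a / b"
    using ab by (simp add: gen_scale_def yratio_def ab_def)
  have flip_coeff: "p (edges \<tau>2) \<kappa>' = (b, a)"
    "\<And>\<alpha>. \<alpha> \<in> edges \<tau>1 \<Longrightarrow> \<alpha> \<noteq> \<kappa> \<Longrightarrow>
      ycoord p \<tau>2 \<alpha> = ycoord p \<tau>1 \<alpha> * (if ?e \<alpha> \<kappa> \<ge> 0 then a else b) powi ?e \<alpha> \<kappa>"
  proof -
    have "p (edges \<tau>2) \<kappa>' = prod.swap (p (edges \<tau>1) \<kappa>) \<and> (\<forall>\<alpha> \<in> edges \<tau>1 - {\<kappa>}.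
        ycoord p \<tau>2 \<alpha> = ycoord p \<tau>1 \<alpha> *
          (if ?e \<alpha> \<kappa> \<ge> 0 then fst (p (edges \<tau>1) \<kappa>) else snd (p (edges \<tau>1) \<kappa>)) powi ?e \<alpha> \<kappa>)"
      using glob flip unfolding global_coefficient_def by blast
    then show "p (edges \<tau>2) \<kappa>' = (b, a)"
      "\<And>\<alpha>. \<alpha> \<in> edges \<tau>1 \<Longrightarrow> \<alpha> \<noteq> \<kappa> \<Longrightarrow>
        ycoord p \<tau>2 \<alpha> = ycoord p \<tau>1 \<alpha> * (if ?e \<alpha> \<kappa> \<ge> 0 then a else b) powi ?e \<alpha> \<kappa>"
      unfolding ab_def by simp_all
  qed
  have y_\<kappa>': "?y2 \<kappa>' = inverse (?y1 \<kappa>)"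
    using ab by (simp add: gen_scale_def[of _ \<tau>2] yratio_def flip_coeff(1) y_\<kappa>)

  \<comment> \<open>Recursion and nonvanishing of the dilogarithm\<close>
  have root: "(?q powi (2 * k)) ^ ?N = 1" for k
    using qroot_powi_cong[OF odd, of "2 * k * int ?N" 0]
    by (simp add: cong_mult_self_right power_int_mult)
  have \<Psi>_rec: "\<Psi> (?q powi (2 * (k + 1))) = (b + a * ?q powi (2 * k + 1)) * \<Psi> (?q powi (2 * k))" for k
  proof -
    have "?q ^ 2 * ?q powi (2 * k) = ?q powi (2 * (k + 1))"
      by (simp add: power_int_add distrib_left mult.commute)
    moreover have "?q * a * ?q powi (2 * k) = a * ?q powi (2 * k + 1)"
      by (simp add: power_int_add)
    ultimately show ?thesis
      using dilog_branch_recursion(1)[OF odd branch root[of k]] by (simp add: ab_def)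
  qed
  have \<Psi>_nz: "\<Psi> (?q powi (2 * k)) \<noteq> 0" for k
    by (rule dilog_branch_recursion(2)[OF odd branch root])

  \<comment> \<open>The normalised generator, its dilogarithm and the monomial family\<close>
  interpret R: scalar_ring ?R ?s
    by (rule CF_scalar_ring)
  define Y where "Y = ?s (inverse (?y1 \<kappa>)) \<otimes>\<^bsub>?R\<^esub> ?X \<kappa>"
  define F where "F = R.functional_calc ?N Y \<Psi>"
  define c where "c \<alpha> = nat (?e \<alpha> \<kappa>)" for \<alpha>
  \<comment> \<open>Chosen so that the image of \<open>M\<close> under the embedding is the new
    coordinate times a Weyl operator: the quotient exchanges the coordinates and the power of q
    undoes the reordering.\<close>
  define t where "t \<alpha> = ?y2 \<alpha> / ?y1 \<alpha> * ?q powi (- (int (c \<alpha>))\<^sup>2)" for \<alpha>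
  define M where "M \<alpha> = (if \<alpha> = \<kappa>' then inv\<^bsub>?R\<^esub> (?X \<kappa>)
      else ?s (t \<alpha>) \<otimes>\<^bsub>?R\<^esub> (?X \<alpha> \<otimes>\<^bsub>?R\<^esub> Y [^]\<^bsub>?R\<^esub> c \<alpha>))" for \<alpha>
  have X_Units: "?X \<alpha> \<in> Units ?R" and X_pow: "?X \<alpha> [^]\<^bsub>?R\<^esub> ?N = ?s (?y1 \<alpha> ^ ?N)"
    if "\<alpha> \<in> edges \<tau>1" for \<alpha>
    using CF_gen_Units[OF that] CF_gen_power[OF that] by blast+
  have X_cl: "?X \<alpha> \<in> carrier ?R" if "\<alpha> \<in> edges \<tau>1" for \<alpha>
    by (rule R.Units_closed[OF X_Units[OF that]])
  have Y_cl: "Y \<in> carrier ?R"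
    unfolding Y_def using X_cl[OF \<kappa>] by simp
  have Y_Units: "Y \<in> Units ?R"
    unfolding Y_def by (intro R.Units_m_closed R.s_Units X_Units \<kappa>) (simp add: gen_scale_nonzero)
  have Y_pow: "Y [^]\<^bsub>?R\<^esub> ?N = \<one>\<^bsub>?R\<^esub>"
    unfolding Y_def R.s_mult_pow[OF X_cl[OF \<kappa>]] X_pow[OF \<kappa>]
    by (simp add: R.s_one gen_scale_nonzero power_inverse flip: R.s_mult)
  have X_\<kappa>: "?X \<kappa> = ?s (a / b) \<otimes>\<^bsub>?R\<^esub> Y"
    unfolding Y_def using X_cl[OF \<kappa>] ab by (subst R.s_s) (simp_all add: y_\<kappa> R.s_one)
  have F_Units: "F \<in> Units ?R"
    unfolding F_def by (rule R.functional_calc_Units[OF odd Y_cl Y_pow]) (rule \<Psi>_nz)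
  have F_cl: "F \<in> carrier ?R"
    by (rule R.Units_closed[OF F_Units])
  have comm: "R.q_commute ?N (?e \<alpha> \<beta>) (?X \<alpha>) (?X \<beta>)" if "\<alpha> \<in> edges \<tau>1" "\<beta> \<in> edges \<tau>1" for \<alpha> \<beta>
    unfolding R.q_commute_def by (rule CF_gen_commute[OF that])
  have eps_swap: "?e \<beta> \<alpha> = - ?e \<alpha> \<beta>" for \<alpha> \<beta>
    unfolding eps_eq_weyl_form[OF sides(2)] by (rule weyl_form_swap)
  have Y_comm: "R.q_commute ?N (?e \<kappa> \<alpha>) Y (?X \<alpha>)" if "\<alpha> \<in> edges \<tau>1" for \<alpha>
    unfolding Y_def by (rule R.q_commute_scalar[OF comm[OF \<kappa> that] X_cl[OF \<kappa>] X_cl[OF that]])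
  have max_c: "max 0 (?e \<alpha> \<kappa>) = int (c \<alpha>)" for \<alpha>
    by (simp add: c_def max_def)

  \<comment> \<open>The cluster transformation as a conjugated monomial family\<close>
  have mu: "mu_gen ?N p \<tau>1 \<kappa> \<kappa>' \<alpha> = F \<otimes>\<^bsub>?R\<^esub> M \<alpha> \<otimes>\<^bsub>?R\<^esub> inv\<^bsub>?R\<^esub> F" if \<alpha>: "\<alpha> \<in> edges \<tau>2" for \<alpha>
  proof (cases "\<alpha> = \<kappa>'")
    case True
    \<comment> \<open>F is a polynomial in Y, a scalar multiple of the generator of \<kappa>, so
      conjugation by F fixes that generator and its inverse.\<close>
    have "F \<otimes>\<^bsub>?R\<^esub> ?X \<kappa> = ?X \<kappa> \<otimes>\<^bsub>?R\<^esub> F"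
    proof -
      have "F \<otimes>\<^bsub>?R\<^esub> ?X \<kappa> = ?s (a / b) \<otimes>\<^bsub>?R\<^esub> (F \<otimes>\<^bsub>?R\<^esub> Y)"
        unfolding X_\<kappa> by (rule R.s_prod_lcomm[OF F_cl Y_cl])
      also have "F \<otimes>\<^bsub>?R\<^esub> Y = Y \<otimes>\<^bsub>?R\<^esub> F"
        unfolding F_def by (rule R.functional_calc_comm[OF odd Y_cl Y_pow])
      finally show ?thesis
        unfolding X_\<kappa> using F_cl Y_cl by (simp add: R.m_assoc)
    qed
    then have "R.q_commute ?N 0 (?X \<kappa>) F"
      by (simp add: R.q_commute_def R.s_one F_cl X_cl[OF \<kappa>])
    then have "inv\<^bsub>?R\<^esub> (?X \<kappa>) \<otimes>\<^bsub>?R\<^esub> F = F \<otimes>\<^bsub>?R\<^esub> inv\<^bsub>?R\<^esub> (?X \<kappa>)"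
      using R.q_commute_inv[OF _ X_Units[OF \<kappa>] F_cl, of ?N 0] X_Units[OF \<kappa>]
      by (simp add: R.q_commute_def R.s_one F_cl)
    then have "F \<otimes>\<^bsub>?R\<^esub> inv\<^bsub>?R\<^esub> (?X \<kappa>) \<otimes>\<^bsub>?R\<^esub> inv\<^bsub>?R\<^esub> F = inv\<^bsub>?R\<^esub> (?X \<kappa>) \<otimes>\<^bsub>?R\<^esub> F \<otimes>\<^bsub>?R\<^esub> inv\<^bsub>?R\<^esub> F"
      by simp
    also have "\<dots> = inv\<^bsub>?R\<^esub> (?X \<kappa>)"
      using X_Units[OF \<kappa>] F_Units F_cl by (simp add: R.m_assoc)
    finally show ?thesis
      using True by (simp add: mu_gen_def M_def Let_def)
  next
    case False
    then have \<alpha>1: "\<alpha> \<in> edges \<tau>1" "\<alpha> \<noteq> \<kappa>"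
      using edges2[OF \<alpha>] by auto
    let ?P = "if ?e \<alpha> \<kappa> \<ge> 0 then a else b"
    let ?l = "if ycoord p \<tau>1 \<alpha> = 0 then ?P powi (- ?e \<alpha> \<kappa>) else 1"
    let ?t0 = "?P powi ?e \<alpha> \<kappa> * ?q powi (- (int (c \<alpha>))\<^sup>2)"
    let ?G = "foldr (\<lambda>j x. (\<one>\<^bsub>?R\<^esub> \<oplus>\<^bsub>?R\<^esub> ?s (?q ^ (2 * j - 1)) \<otimes>\<^bsub>?R\<^esub> (?X \<kappa> [^]\<^bsub>?R\<^esub> (- sgn (?e \<alpha> \<kappa>))))
        [^]\<^bsub>?R\<^esub> (- sgn (?e \<alpha> \<kappa>)) \<otimes>\<^bsub>?R\<^esub> x) [1..<Suc (nat \<bar>?e \<alpha> \<kappa>\<bar>)] \<one>\<^bsub>?R\<^esub>"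
    let ?m = "?X \<alpha> \<otimes>\<^bsub>?R\<^esub> Y [^]\<^bsub>?R\<^esub> c \<alpha>"
    have m_cl: "?m \<in> carrier ?R"
      using X_cl[OF \<alpha>1(1)] Y_cl by simp
    have YX: "Y \<otimes>\<^bsub>?R\<^esub> ?X \<alpha> = ?s (?q powi (- 2 * ?e \<alpha> \<kappa>)) \<otimes>\<^bsub>?R\<^esub> (?X \<alpha> \<otimes>\<^bsub>?R\<^esub> Y)"
      using Y_comm[OF \<alpha>1(1)] by (simp add: R.q_commute_def eps_swap[of \<kappa> \<alpha>])
    have XG: "?X \<alpha> \<otimes>\<^bsub>?R\<^esub> ?G = F \<otimes>\<^bsub>?R\<^esub> (?s ?t0 \<otimes>\<^bsub>?R\<^esub> ?m) \<otimes>\<^bsub>?R\<^esub> inv\<^bsub>?R\<^esub> F"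
      unfolding F_def c_def X_\<kappa>
      by (rule R.dilog_conjugation[OF odd Y_cl Y_pow X_cl[OF \<alpha>1(1)] YX ab \<Psi>_rec \<Psi>_nz])
    have G_cl: "?G \<in> carrier ?R"
      unfolding X_\<kappa> by (rule R.dilog_product_closed[OF odd Y_cl Y_pow X_cl[OF \<alpha>1(1)] YX ab \<Psi>_rec \<Psi>_nz])
    have P: "?P \<noteq> 0"
      using ab by simp
    \<comment> \<open>If the coordinate is zero, both scales are 1 and the leading scalar of
      \<open>mu_gen\<close> cancels the power of \<open>?P\<close>. Otherwise the leading scalar is
      1 and that power is the quotient of the coordinates.\<close>
    have t_eq: "?l * ?t0 = t \<alpha>"
    proof (cases "ycoord p \<tau>1 \<alpha> = 0")
      case True
      then show ?thesis
        using P by (simp add: t_def gen_scale_def flip_coeff(2)[OF \<alpha>1] power_int_minus mult.assoc[symmetric])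
    next
      case False
      then show ?thesis
        using P by (simp add: t_def gen_scale_def flip_coeff(2)[OF \<alpha>1])
    qed
    have "mu_gen ?N p \<tau>1 \<kappa> \<kappa>' \<alpha> = ?s ?l \<otimes>\<^bsub>?R\<^esub> ?X \<alpha> \<otimes>\<^bsub>?R\<^esub> ?G"
      unfolding mu_gen_def Let_def ab_def fst_conv snd_conv by (rule if_not_P[OF False])
    also have "\<dots> = ?s ?l \<otimes>\<^bsub>?R\<^esub> (?X \<alpha> \<otimes>\<^bsub>?R\<^esub> ?G)"
      by (rule R.m_assoc[OF R.s_closed X_cl[OF \<alpha>1(1)] G_cl])
    also have "\<dots> = (?s ?l \<otimes>\<^bsub>?R\<^esub> (F \<otimes>\<^bsub>?R\<^esub> (?s ?t0 \<otimes>\<^bsub>?R\<^esub> ?m))) \<otimes>\<^bsub>?R\<^esub> inv\<^bsub>?R\<^esub> F"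
      unfolding XG by (rule R.m_assoc[symmetric]) (use F_cl F_Units m_cl in auto)
    also have "?s ?l \<otimes>\<^bsub>?R\<^esub> (F \<otimes>\<^bsub>?R\<^esub> (?s ?t0 \<otimes>\<^bsub>?R\<^esub> ?m)) = F \<otimes>\<^bsub>?R\<^esub> (?s ?l \<otimes>\<^bsub>?R\<^esub> (?s ?t0 \<otimes>\<^bsub>?R\<^esub> ?m))"
      by (rule R.s_prod_lcomm[symmetric]) (use F_cl m_cl in auto)
    also have "?s ?l \<otimes>\<^bsub>?R\<^esub> (?s ?t0 \<otimes>\<^bsub>?R\<^esub> ?m) = M \<alpha>"
      unfolding M_def if_not_P[OF False] R.s_s[OF m_cl] t_eq ..
    finally show ?thesis .
  qed

  \<comment> \<open>The monomial family satisfies the relations after the flip\<close>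
  have M_solution: "CF_solution ?R ?s ?N p \<tau>2 M"
    unfolding CF_solution_def
  proof (intro ballI conjI)
    define B where "B \<alpha> = (if \<alpha> = \<kappa>' then inv\<^bsub>?R\<^esub> (?X \<kappa>) else ?X \<alpha> \<otimes>\<^bsub>?R\<^esub> Y [^]\<^bsub>?R\<^esub> c \<alpha>)" for \<alpha>
    have B_Units: "B \<alpha> \<in> Units ?R" if "\<alpha> \<in> edges \<tau>2" for \<alpha>
    proof (cases "\<alpha> = \<kappa>'")
      case True
      then show ?thesis
        using X_Units[OF \<kappa>] by (simp add: B_def)
    next
      case False
      then show ?thesis
        using edges2[OF that] X_Units Y_Units by (auto simp: B_def intro!: R.Units_m_closed R.Units_pow_closed)
    qed
    have B_cl: "B \<alpha> \<in> carrier ?R" if "\<alpha> \<in> edges \<tau>2" for \<alpha>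
      by (rule R.Units_closed[OF B_Units[OF that]])
    have t_nz: "t \<alpha> \<noteq> 0" for \<alpha>
      by (simp add: t_def gen_scale_nonzero)
    have MB: "M \<alpha> = ?s (if \<alpha> = \<kappa>' then 1 else t \<alpha>) \<otimes>\<^bsub>?R\<^esub> B \<alpha>" if "\<alpha> \<in> edges \<tau>2" for \<alpha>
      using B_cl[OF that] by (cases "\<alpha> = \<kappa>'") (simp_all add: M_def B_def R.s_one)
    define E where "E \<alpha> = flip_exponent v w (?E2 \<alpha>)" for \<alpha>
    have E\<kappa>': "E \<kappa>' = - ?E1 \<kappa>"
      unfolding E_def by (rule flip_edge_exponent_kappa'[OF square])
    have E: "E \<alpha> = ?E1 \<alpha> + weyl_scale (int (c \<alpha>)) (?E1 \<kappa>)" if "\<alpha> \<in> edges \<tau>2" "\<alpha> \<noteq> \<kappa>'" for \<alpha>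
      unfolding E_def using flip_edge_exponent[OF square] edges2[OF that] that(2) by (simp add: max_c)
    \<comment> \<open>The flip of exponents is symplectic, so the new exchange matrix is expressed
      in the exponents of the old triangulation, where the generators live.\<close>
    have eps2: "eps \<tau>2 \<alpha> \<beta> = weyl_form (E \<alpha>) (E \<beta>)" for \<alpha> \<beta>
      unfolding eps_eq_weyl_form[OF sides(3)] E_def weyl_form_flip[OF sides(1)] ..
    \<comment> \<open>Bilinearity of the form is imitated one argument at a time: here a single
      generator against a monomial, and in \<open>BB\<close> a monomial in both places.\<close>
    have XB: "R.q_commute ?N (weyl_form (?E1 \<alpha>) (E \<beta>)) (?X \<alpha>) (B \<beta>)"
      if \<alpha>: "\<alpha> \<in> edges \<tau>1" and \<beta>: "\<beta> \<in> edges \<tau>2" for \<alpha> \<beta>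
    proof -
      have "R.q_commute ?N (- weyl_form (?E1 \<alpha>) (E \<beta>)) (B \<beta>) (?X \<alpha>)"
      proof (cases "\<beta> = \<kappa>'")
        case True
        have "R.q_commute ?N (- ?e \<kappa> \<alpha>) (inv\<^bsub>?R\<^esub> (?X \<kappa>)) (?X \<alpha>)"
          by (rule R.q_commute_inv[OF comm[OF \<kappa> \<alpha>] X_Units[OF \<kappa>] X_cl[OF \<alpha>]])
        then show ?thesis
          using True by (simp add: B_def E\<kappa>' weyl_form_simps eps_eq_weyl_form[OF sides(2)]
              weyl_form_swap[of "?E1 \<kappa>" "?E1 \<alpha>"])
      next
        case False
        then have \<beta>1: "\<beta> \<in> edges \<tau>1"
          using edges2[OF \<beta>] by blast
        have "R.q_commute ?N (?e \<beta> \<alpha> + int (c \<beta>) * ?e \<kappa> \<alpha>) (?X \<beta> \<otimes>\<^bsub>?R\<^esub> Y [^]\<^bsub>?R\<^esub> c \<beta>) (?X \<alpha>)"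
          by (intro R.q_commute_mult comm \<beta>1 \<alpha> R.q_commute_pow Y_comm X_cl R.nat_pow_closed Y_cl)
        then show ?thesis
          using False by (simp add: B_def E[OF \<beta> False] weyl_form_simps eps_swap[of _ \<alpha>] eps_eq_weyl_form[OF sides(2), of \<alpha>])
      qed
      then have "R.q_commute ?N (- (- weyl_form (?E1 \<alpha>) (E \<beta>))) (?X \<alpha>) (B \<beta>)"
        by (rule R.q_commute_sym[OF _ B_cl[OF \<beta>] X_cl[OF \<alpha>]])
      then show ?thesis
        by simp
    qed
    have BB: "R.q_commute ?N (weyl_form (E \<alpha>) (E \<beta>)) (B \<alpha>) (B \<beta>)"
      if \<alpha>: "\<alpha> \<in> edges \<tau>2" and \<beta>: "\<beta> \<in> edges \<tau>2" for \<alpha> \<beta>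
    proof (cases "\<alpha> = \<kappa>'")
      case True
      have "R.q_commute ?N (- weyl_form (?E1 \<kappa>) (E \<beta>)) (inv\<^bsub>?R\<^esub> (?X \<kappa>)) (B \<beta>)"
        by (rule R.q_commute_inv[OF XB[OF \<kappa> \<beta>] X_Units[OF \<kappa>] B_cl[OF \<beta>]])
      then show ?thesis
        using True by (simp only: B_def[of "\<kappa>'"] E\<kappa>' weyl_form_simps simp_thms if_True)
    next
      case False
      then have \<alpha>1: "\<alpha> \<in> edges \<tau>1"
        using edges2[OF \<alpha>] by blast
      have YB: "R.q_commute ?N (weyl_form (?E1 \<kappa>) (E \<beta>)) Y (B \<beta>)"
        unfolding Y_def by (rule R.q_commute_scalar[OF XB[OF \<kappa> \<beta>] X_cl[OF \<kappa>] B_cl[OF \<beta>]])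
      have "R.q_commute ?N (weyl_form (?E1 \<alpha>) (E \<beta>) + int (c \<alpha>) * weyl_form (?E1 \<kappa>) (E \<beta>))
          (?X \<alpha> \<otimes>\<^bsub>?R\<^esub> Y [^]\<^bsub>?R\<^esub> c \<alpha>) (B \<beta>)"
        by (intro R.q_commute_mult XB \<alpha>1 \<beta> R.q_commute_pow YB X_cl R.nat_pow_closed Y_cl B_cl)
      then show ?thesis
        using False by (simp add: B_def[of \<alpha>] E[OF \<alpha> False] weyl_form_simps)
    qed
    fix \<alpha> assume \<alpha>: "\<alpha> \<in> edges \<tau>2"
    show "M \<alpha> \<in> Units ?R"
      unfolding MB[OF \<alpha>] by (intro R.Units_m_closed R.s_Units B_Units \<alpha>) (simp add: t_nz)
    show "M \<alpha> [^]\<^bsub>?R\<^esub> ?N = ?s (?y2 \<alpha> ^ ?N)"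
    proof (cases "\<alpha> = \<kappa>'")
      case True
      have Yi: "inv\<^bsub>?R\<^esub> Y \<in> carrier ?R"
        by (rule R.Units_inv_closed[OF Y_Units])
      have "inv\<^bsub>?R\<^esub> (?X \<kappa>) = ?s (inverse (?y1 \<kappa>)) \<otimes>\<^bsub>?R\<^esub> inv\<^bsub>?R\<^esub> Y"
      proof (rule R.inv_char)
        have "?X \<kappa> \<otimes>\<^bsub>?R\<^esub> (?s (inverse (?y1 \<kappa>)) \<otimes>\<^bsub>?R\<^esub> inv\<^bsub>?R\<^esub> Y) = ?s (inverse (?y1 \<kappa>)) \<otimes>\<^bsub>?R\<^esub> (?X \<kappa> \<otimes>\<^bsub>?R\<^esub> inv\<^bsub>?R\<^esub> Y)"
          by (rule R.s_prod_lcomm[OF X_cl[OF \<kappa>] Yi])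
        also have "\<dots> = Y \<otimes>\<^bsub>?R\<^esub> inv\<^bsub>?R\<^esub> Y"
          unfolding R.m_assoc[OF R.s_closed X_cl[OF \<kappa>] Yi, symmetric] Y_def[symmetric] ..
        finally show "?X \<kappa> \<otimes>\<^bsub>?R\<^esub> (?s (inverse (?y1 \<kappa>)) \<otimes>\<^bsub>?R\<^esub> inv\<^bsub>?R\<^esub> Y) = \<one>\<^bsub>?R\<^esub>"
          using Y_Units by simp
        have "?s (inverse (?y1 \<kappa>)) \<otimes>\<^bsub>?R\<^esub> inv\<^bsub>?R\<^esub> Y \<otimes>\<^bsub>?R\<^esub> ?X \<kappa> = ?s (inverse (?y1 \<kappa>)) \<otimes>\<^bsub>?R\<^esub> (inv\<^bsub>?R\<^esub> Y \<otimes>\<^bsub>?R\<^esub> ?X \<kappa>)"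
          using X_cl[OF \<kappa>] Yi by (intro R.m_assoc) simp_all
        also have "\<dots> = inv\<^bsub>?R\<^esub> Y \<otimes>\<^bsub>?R\<^esub> Y"
          unfolding R.s_prod_lcomm[OF Yi X_cl[OF \<kappa>], symmetric] Y_def[symmetric] ..
        finally show "?s (inverse (?y1 \<kappa>)) \<otimes>\<^bsub>?R\<^esub> inv\<^bsub>?R\<^esub> Y \<otimes>\<^bsub>?R\<^esub> ?X \<kappa> = \<one>\<^bsub>?R\<^esub>"
          using Y_Units by simp
      qed (use X_cl[OF \<kappa>] Y_Units in auto)
      moreover have "(inv\<^bsub>?R\<^esub> Y) [^]\<^bsub>?R\<^esub> ?N = \<one>\<^bsub>?R\<^esub>"
        using R.pow_mult_distrib[OF _ Yi Y_cl, of ?N] Yi Y_pow Y_Units by simp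
      ultimately show ?thesis
        using True Y_Units by (simp add: M_def R.s_mult_pow y_\<kappa>')
    next
      case False
      then have \<alpha>1: "\<alpha> \<in> edges \<tau>1" "\<alpha> \<noteq> \<kappa>"
        using edges2[OF \<alpha>] by auto
      let ?Z = "Y [^]\<^bsub>?R\<^esub> c \<alpha>"
      have Z: "?Z \<in> carrier ?R"
        using Y_cl by simp
      have "R.q_commute ?N (- (int (c \<alpha>) * ?e \<kappa> \<alpha>)) (?X \<alpha>) ?Z"
        by (rule R.q_commute_sym[OF R.q_commute_pow[OF Y_comm[OF \<alpha>1(1)] Y_cl X_cl[OF \<alpha>1(1)]] Z X_cl[OF \<alpha>1(1)]])
      from R.pow_q_commute[OF this X_cl[OF \<alpha>1(1)] Z, of ?N]
      have "(?X \<alpha> \<otimes>\<^bsub>?R\<^esub> ?Z) [^]\<^bsub>?R\<^esub> ?N =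
          ?s (?q powi (- (- (int (c \<alpha>) * ?e \<kappa> \<alpha>)) * int ?N * (int ?N - 1))) \<otimes>\<^bsub>?R\<^esub>
            (?X \<alpha> [^]\<^bsub>?R\<^esub> ?N \<otimes>\<^bsub>?R\<^esub> ?Z [^]\<^bsub>?R\<^esub> ?N)" .
      \<comment> \<open>For the N-th power the reordering exponent is a multiple of N.\<close>
      also have "?q powi (- (- (int (c \<alpha>) * ?e \<kappa> \<alpha>)) * int ?N * (int ?N - 1)) = ?q powi 0"
        by (rule qroot_powi_cong[OF odd]) (simp add: cong_0_iff)
      also have "?Z [^]\<^bsub>?R\<^esub> ?N = \<one>\<^bsub>?R\<^esub>"
        using R.nat_pow_pow[OF Y_cl, of "c \<alpha>" ?N] R.nat_pow_pow[OF Y_cl, of ?N "c \<alpha>"] Y_pow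
        by (simp add: mult.commute)
      also have "?X \<alpha> [^]\<^bsub>?R\<^esub> ?N = ?s (?y1 \<alpha> ^ ?N)"
        by (rule X_pow[OF \<alpha>1(1)])
      finally have pow: "(?X \<alpha> \<otimes>\<^bsub>?R\<^esub> ?Z) [^]\<^bsub>?R\<^esub> ?N = ?s (?y1 \<alpha> ^ ?N)"
        by (simp add: R.s_one)
      have "(?q powi (- (int (c \<alpha>))\<^sup>2)) ^ ?N = ?q powi 0"
        unfolding power_int_of_nat[symmetric] power_int_mult[symmetric]
        by (rule qroot_powi_cong[OF odd]) (simp add: cong_0_iff)
      then have "t \<alpha> ^ ?N * ?y1 \<alpha> ^ ?N = ?y2 \<alpha> ^ ?N"
        by (simp add: t_def power_mult_distrib power_divide gen_scale_nonzero)
      then show ?thesis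
        using X_cl[OF \<alpha>1(1)] Z False by (simp add: M_def R.s_mult_pow pow flip: R.s_mult)
    qed
    fix \<beta> assume \<beta>: "\<beta> \<in> edges \<tau>2"
    have M_cl: "M \<gamma> \<in> carrier ?R" if "\<gamma> \<in> edges \<tau>2" for \<gamma>
      unfolding MB[OF that] using B_cl[OF that] by simp
    have "R.q_commute ?N (weyl_form (E \<beta>) (E \<alpha>)) (M \<beta>) (B \<alpha>)"
      unfolding MB[OF \<beta>] by (rule R.q_commute_scalar[OF BB[OF \<beta> \<alpha>] B_cl[OF \<beta>] B_cl[OF \<alpha>]])
    from R.q_commute_sym[OF this M_cl[OF \<beta>] B_cl[OF \<alpha>]]
    have "R.q_commute ?N (weyl_form (E \<alpha>) (E \<beta>)) (B \<alpha>) (M \<beta>)"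
      unfolding weyl_form_swap[of "E \<beta>" "E \<alpha>"] by simp
    from R.q_commute_scalar[OF this B_cl[OF \<alpha>] M_cl[OF \<beta>]]
    have "R.q_commute ?N (eps \<tau>2 \<alpha> \<beta>) (M \<alpha>) (M \<beta>)"
      unfolding MB[OF \<alpha>] eps2 .
    then show "M \<alpha> \<otimes>\<^bsub>?R\<^esub> M \<beta> = ?s (?q powi (2 * eps \<tau>2 \<alpha> \<beta>)) \<otimes>\<^bsub>?R\<^esub> (M \<beta> \<otimes>\<^bsub>?R\<^esub> M \<alpha>)"
      by (simp only: R.q_commute_def)
  qed

  \<comment> \<open>Transport to operators\<close>
  let ?mu = "mu_gen ?N p \<tau>1 \<kappa> \<kappa>'"
  have mu_solution: "CF_solution ?R ?s ?N p \<tau>2 ?mu"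
    by (rule CF_solution_hom[OF CF_scalar_ring CF_scalar_ring R.conj_hom(1)[OF F_Units] R.conj_hom(2)[OF F_Units] M_solution mu])
  have sol1: "CF_solution operators mat ?N p \<tau>1 ?g1" and sol2: "CF_solution operators mat ?N p \<tau>2 ?g2"
    using iota_gen_solution[OF odd] sides(2,3) by blast+
  let ?h = "induced_hom operators mat ?g1"
  have h: "?h \<in> Ring.ring_hom ?R operators" "\<And>c. ?h (?s c) = mat c" "\<And>\<alpha>. \<alpha> \<in> edges \<tau>1 \<Longrightarrow> ?h (?X \<alpha>) = ?g1 \<alpha>"
    using CF_solution_induced_hom(2-4)[OF operators_scalar_ring sol1] by blast+
  have h_mult: "?h (x \<otimes>\<^bsub>?R\<^esub> y) = ?h x ** ?h y" if "x \<in> carrier ?R" "y \<in> carrier ?R" for x y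
    using ring_hom_mult[OF h(1) that] by simp
  interpret O: scalar_ring "operators :: ('v, 'n) operator ring" mat
    by (rule operators_scalar_ring)
  note rings = R.ring_axioms O.ring_axioms

  let ?W = "weyl :: _ \<Rightarrow> ('v, 'n) operator"
  have hY: "?h Y = ?W (?E1 \<kappa>)"
  proof -
    have "?h Y = mat (inverse (?y1 \<kappa>)) ** (mat (?y1 \<kappa>) ** ?W (?E1 \<kappa>))"
      unfolding Y_def using X_cl[OF \<kappa>] by (simp add: h_mult h(2) h(3)[OF \<kappa>] iota_gen_def)
    then show ?thesis
      by (simp add: matrix_mul_assoc mat_mult_mat gen_scale_nonzero)
  qed
  \<comment> \<open>A homomorphism takes the interpolating polynomial in Y to the same polynomial in
    the matrix of Y, which is its spectral calculus.\<close>
  have hF: "?h F = spectral_apply ?N \<Psi> (?W (?E1 \<kappa>))"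
    unfolding F_def ring_hom_functional_calc[OF CF_scalar_ring operators_scalar_ring h(1,2) Y_cl] hY
    by (rule spectral_apply_eq[OF odd weyl_pow_card[OF odd], symmetric])
  have hM: "?h (M \<alpha>) = mat (?y2 \<alpha>) ** ?W (flip_exponent v w (?E2 \<alpha>))" if \<alpha>: "\<alpha> \<in> edges \<tau>2" for \<alpha>
  proof (cases "\<alpha> = \<kappa>'")
    case True
    have "?h (M \<alpha>) = inv\<^bsub>operators\<^esub> (mat (?y1 \<kappa>) ** ?W (?E1 \<kappa>))"
      using True ring_hom_Units(2)[OF rings h(1) X_Units[OF \<kappa>]] by (simp add: M_def h(3)[OF \<kappa>] iota_gen_def)
    also have "\<dots> = mat (inverse (?y1 \<kappa>)) ** ?W (- ?E1 \<kappa>)"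
      by (rule operators_inv_eq[OF scalar_weyl_inverse[OF odd gen_scale_nonzero]])
    finally show ?thesis
      by (simp add: True y_\<kappa>' flip_edge_exponent_kappa'[OF square])
  next
    case False
    then have \<alpha>1: "\<alpha> \<in> edges \<tau>1" "\<alpha> \<noteq> \<kappa>"
      using edges2[OF \<alpha>] by auto
    let ?V = "weyl_scale (int (c \<alpha>)) (?E1 \<kappa>)"
    have "?h (Y [^]\<^bsub>?R\<^esub> c \<alpha>) = ?W ?V"
      using ring_hom_nat_pow[OF rings h(1) Y_cl, of "c \<alpha>"] by (simp add: hY weyl_pow[OF odd])
    then have "?h (M \<alpha>) = mat (t \<alpha>) ** ((mat (?y1 \<alpha>) ** ?W (?E1 \<alpha>)) ** ?W ?V)"
      using False X_cl[OF \<alpha>1(1)] Y_cl by (simp add: M_def h_mult h(2) h(3)[OF \<alpha>1(1)] iota_gen_def)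
    also have "\<dots> = (mat (t \<alpha>) ** mat (?y1 \<alpha>)) ** (?W (?E1 \<alpha>) ** ?W ?V)"
      by (simp only: matrix_mul_assoc)
    also have "\<dots> = mat (t \<alpha> * ?y1 \<alpha> * ?q powi weyl_form (?E1 \<alpha>) ?V) ** ?W (?E1 \<alpha> + ?V)"
      by (simp add: weyl_mult[OF odd] mat_mult_mat matrix_mul_assoc)
    also have "t \<alpha> * ?y1 \<alpha> * ?q powi weyl_form (?E1 \<alpha>) ?V = ?y2 \<alpha>"
    proof -
      \<comment> \<open>The form is c times \<epsilon>, and c is either 0 or \<epsilon>. This is
        where the factor q^(-c^2) in \<open>t\<close> cancels.\<close>
      have "weyl_form (?E1 \<alpha>) ?V = (int (c \<alpha>))\<^sup>2"
        by (simp add: weyl_form_simps eps_eq_weyl_form[OF sides(2), symmetric] c_def power2_eq_square)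
      then show ?thesis
        by (simp add: t_def gen_scale_nonzero power_int_minus)
    qed
    finally show ?thesis
      using flip_edge_exponent[OF square \<alpha>1(2) False] by (simp add: max_c)
  qed

  \<comment> \<open>Factorisation of the flip operator\<close>
  let ?S = "S_op v w :: ('v, 'n) operator" and ?T = "T_op \<Psi> v w :: ('v, 'n) operator"
  have T_eq: "?T = ?h F ** ?S"
  proof -
    have "axis v (a :: int \<times> int) + axis v b = axis v (a + b)" "- axis v a = axis v (- a)" for a b
      by (auto simp: vec_eq_iff axis_def)
    \<comment> \<open>The diagonal is the middle side of \<open>v\<close> and the last side of
      \<open>w\<close>, so its Weyl operator is the argument of the dilogarithm in
      \<open>T_op\<close>.\<close>
    moreover have "?E1 \<kappa> = axis v (1, - 1) + axis w (0, 1)"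
    proof -
      have "?E1 \<kappa> = edge_sum \<tau>1 \<kappa>"
        by (rule edge_exponent_kappa[OF square])
      moreover have "edge_sum \<tau>1 \<kappa> $ u = (if u = v then (1, - 1) else if u = w then (0, 1) else 0)" for u
        by (rule edge_sum_kappa[OF square])
      ultimately show ?thesis
        using sides(1) by (simp add: vec_eq_iff axis_def zero_prod_def)
    qed
    ultimately have "weyl_prod ?N [inv\<^bsub>operators\<^esub> (P_op v), U_op v, P_op w] = ?W (?E1 \<kappa>)"
      using weyl_prod_weyl[OF odd, of "[axis v (0, - 1), axis v (1, 0), axis w (0, 1)]"]
      by (simp add: U_op_eq P_op_eq weyl_Units[OF odd] add.assoc[symmetric])
    then show ?thesis
      by (simp add: T_op_def hF)
  qed
  have hF_Units: "?h F \<in> Units operators"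
    by (rule ring_hom_Units(1)[OF rings h(1) F_Units])
  have T_Units: "?T \<in> Units operators"
    unfolding T_eq using O.Units_m_closed[OF hF_Units S_op_Units[OF odd sides(1)]] by simp
  have conj: "?h (?mu \<alpha>) = conj_by ?T (?g2 \<alpha>)" if \<alpha>: "\<alpha> \<in> edges \<tau>2" for \<alpha>
  proof -
    have M_cl: "M \<alpha> \<in> carrier ?R"
      using M_solution \<alpha> R.Units_closed unfolding CF_solution_def by blast
    have "?h (?mu \<alpha>) = ?h F ** ?h (M \<alpha>) ** inv\<^bsub>operators\<^esub> (?h F)"
      unfolding mu[OF \<alpha>] using F_cl F_Units M_cl
      by (simp add: h_mult ring_hom_Units(2)[OF rings h(1) F_Units])
    then have "?h (?mu \<alpha>) ** ?T = ?h F ** ?h (M \<alpha>) ** (inv\<^bsub>operators\<^esub> (?h F) ** ?h F) ** ?S"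
      by (simp only: T_eq matrix_mul_assoc)
    also have "\<dots> = ?h F ** (?h (M \<alpha>) ** ?S)"
      by (simp add: operators_inv(2)[OF hF_Units] matrix_mul_assoc)
    \<comment> \<open>\<open>S_op\<close> realises the monomial part: it intertwines the generator
      after the flip with the image of \<open>M\<close>, while \<open>?h F\<close> accounts for the
      rest of the conjugation.\<close>
    also have "?h (M \<alpha>) ** ?S = ?S ** ?g2 \<alpha>"
      unfolding hM[OF \<alpha>] iota_gen_def mat_mult_lcomm S_op_weyl[OF odd sides(1)] by (rule matrix_mul_assoc[symmetric])
    finally have "?T ** ?g2 \<alpha> = ?h (?mu \<alpha>) ** ?T"
      by (simp add: T_eq matrix_mul_assoc)
    then show ?thesis
      by (rule conj_by_eq[OF T_Units, symmetric])
  qed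

  \<comment> \<open>From generators to arbitrary elements\<close>
  obtain f where f: "f \<in> carrier (free_algebra (edges \<tau>2))" "x = CF_class ?N p \<tau>2 f"
    using x by (rule CF_carrierE)
  have "iota p \<tau>1 (mu_star ?N p \<tau>1 \<kappa> \<kappa>' x) = ?h (free_eval ?R ?s ?mu f)"
    unfolding iota_eq[OF odd] mu_star_def f(2) CF_solution_induced_hom(1)[OF CF_scalar_ring mu_solution f(1)] ..
  also have "\<dots> = free_eval operators mat (\<lambda>\<alpha>. ?h (?mu \<alpha>)) f"
    by (rule hom_free_eval[OF CF_scalar_ring operators_scalar_ring h(1,2) _ refl f(1), symmetric])
      (use mu_solution in \<open>unfold CF_solution_def, blast\<close>)
  also have "\<dots> = conj_by ?T (free_eval operators mat ?g2 f)"
    by (rule hom_free_eval[OF operators_scalar_ring operators_scalar_ring conj_by_hom(1)[OF T_Units] conj_by_hom(2)[OF T_Units] _ conj f(1)])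
      (use sol2 in \<open>unfold CF_solution_def, blast\<close>)
  also have "free_eval operators mat ?g2 f = iota p \<tau>2 x"
    unfolding iota_eq[OF odd] f(2) CF_solution_induced_hom(1)[OF operators_scalar_ring sol2 f(1)] ..
  finally show ?thesis ..
qed

theorem theorem3:
  fixes S :: "'s surface_data" and p :: "'s coeff"
  assumes "odd CARD('n::finite)"
    and "marked_surface S"
    and "global_coefficient TYPE('v::finite) CARD('n) S p"
  shows "(\<forall>(v::'v) \<tau>1 \<tau>2. dot_rotation S v \<tau>1 \<tau>2 \<longrightarrow>
            (\<forall>x \<in> carrier (CF CARD('n) p \<tau>2).
               conj_by (A_op v :: ('v, 'n) operator) (iota p \<tau>2 x) = iota p \<tau>1 x)) \<and>
         (\<forall>(v::'v) w \<kappa> \<kappa>' \<tau>1 \<tau>2 \<Psi>. dotted_flip S v w \<kappa> \<kappa>' \<tau>1 \<tau>2 \<longrightarrow>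
            dilog_generic CARD('n) (p (edges \<tau>1) \<kappa>) \<longrightarrow>
            dilog_branch CARD('n) (p (edges \<tau>1) \<kappa>) \<Psi> \<longrightarrow>
            (\<forall>x \<in> carrier (CF CARD('n) p \<tau>2).
               conj_by (T_op \<Psi> v w :: ('v, 'n) operator) (iota p \<tau>2 x) =
               iota p \<tau>1 (mu_star CARD('n) p \<tau>1 \<kappa> \<kappa>' x)))"
  using dot_rotation_iota[OF assms(1)] flip_iota[OF assms(1,3)] by blast

end
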